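(* Every $H^1$-projective Banach space is a G.T. space of cotype 2, i.e. it satisfies Grothendieck's theorem and is of cotype 2.
   Context: All Banach spaces are complex. Let $\mathbb{T}$ be the unit circle with normalized Haar measure $dm$. For a Banach space $X$, $\widetilde H^1(X)$ is the closure in the Bochner space $L^1(\mathbb{T};X)$ of the set of $X$-valued analytic polynomials $\sum_{k=0}^n z^k x_k$ ($n\in\mathbb{N}$, $x_k\in X$), with the $L^1(\mathbb{T};X)$-norm; $H^1=\widetilde H^1(\mathbb{C})$ is the scalar Hardy space. $\hat\otimes$ denotes the (completed) projective tensor product. There is a canonical norm-one inclusion map $H^1\hat\otimes X\hookrightarrow\widetilde H^1(X)$ sending $h\otimes x$ to $h(\cdot)x$. $X$ is called $H^1$-projective if this map is surjective; equivalently, if there is a constant $c$ such that $\|F\|_{H^1\hat\otimes X}\le c\,\|F\|_{\widetilde H^1(X)}$ for all $F\in H^1\hat\otimes X$. Let $\varepsilon_n:\{+1,-1\}^{\mathbb{N}}\to\{+1,-1\}$ be the coordinate functions, with the uniform probability measure on $\{+1,-1\}^{\mathbb{N}}$. A Banach space $X$ is of cotype 2 if there is a constant $c$ such that $\left(\sum_{k=1}^n\|x_k\|^2\right)^{1/2}\le c\left(\mathbb{E}\left\|\sum_{k=1}^n\varepsilon_kx_k\right\|^2\right)^{1/2}$ for all $n$ and all $x_1,\dots,x_n\in X$. A bounded operator $u:X\to Y$ is 1-summing if there is a constant $c$ such that $\sum_{k=1}^n\|u(x_k)\|\le c\,\sup\{\sum_{k=1}^n|\langle\xi,x_k\rangle|:\xi\in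 X^*,\|\xi\|\le1\}$ for all $n$ and all $x_1,\dots,x_n\in X$. $X$ satisfies Grothendieck's theorem (is a G.T. space) if every bounded operator from $X$ into a Hilbert space is 1-summing. *)

theory Defs
  imports "HOL-Probability.Probability"
begin

section \<open>Complex Banach and Hilbert spaces\<close>

class complex_banach = banach +
  fixes scaleC :: "complex \<Rightarrow> 'a \<Rightarrow> 'a"  (infixr \<open>*\<^sub>C\<close> 75)
  assumes scaleC_add_right: "c *\<^sub>C (x + y) = c *\<^sub>C x + c *\<^sub>C y"
    and scaleC_add_left: "(c + d) *\<^sub>C x = c *\<^sub>C x + d *\<^sub>C x"
    and scaleC_scaleC: "c *\<^sub>C d *\<^sub>C x = (c * d) *\<^sub>C x"
    and scaleR_scaleC: "r *\<^sub>R x = complex_of_real r *\<^sub>C x"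
    and norm_scaleC: "norm (c *\<^sub>C x) = cmod c * norm x"

instantiation complex :: complex_banach
begin

definition scaleC_complex :: "complex \<Rightarrow> complex \<Rightarrow> complex"
  where "scaleC_complex = (*)"

instance
  by standard (auto simp: scaleC_complex_def algebra_simps norm_mult scaleR_conv_of_real)

end

class complex_hilbert = complex_banach +
  fixes cinner :: "'a \<Rightarrow> 'a \<Rightarrow> complex"
  assumes cinner_commute: "cinner x y = cnj (cinner y x)"
    and cinner_add_left: "cinner (x + y) z = cinner x z + cinner y z"
    and cinner_scaleC_left: "cinner (c *\<^sub>C x) y = c * cinner x y"
    and norm_eq_sqrt_cinner: "norm x = sqrt (Re (cinner x x))"

instantiation complex :: complex_hilbert
begin

definition cinner_complex :: "complex \<Rightarrow> complex \<Rightarrow> complex"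
  where "cinner_complex x y = x * cnj y"

instance
  by standard
    (auto simp: cinner_complex_def scaleC_complex_def algebra_simps cmod_def power2_eq_square)

end

definition bounded_clinear :: "('x::complex_banach \<Rightarrow> 'y::complex_banach) \<Rightarrow> bool"
  where "bounded_clinear f \<longleftrightarrow> bounded_linear f \<and> (\<forall>c x. f (c *\<^sub>C x) = c *\<^sub>C f x)"


section \<open>Vector-valued Hardy spaces\<close>

definition circle_measure :: "complex measure"
  where "circle_measure =
    distr (uniform_measure lborel {0..<2 * pi}) (restrict_space borel (sphere 0 1)) cis"

text \<open>
  The library's \<^const>\<open>integrable\<close> is only available for second countable target types, whereas
  here the target may be non-separable. Elements of the Bochner space are represented by
  functions, with equality almost everywhere left implicit. The norm takes values in
  \<^typ>\<open>ennreal\<close>; for a non-measurable integrand \<^const>\<open>nn_integral\<close> still only depends on the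
  class modulo null sets, so no completion of the measure is needed.
\<close>

definition strongly_measurable :: "(complex \<Rightarrow> 'x::complex_banach) \<Rightarrow> bool"
  where "strongly_measurable F \<longleftrightarrow>
    (\<exists>s. (\<forall>i::nat. simple_function circle_measure (s i)) \<and>
         (AE z in circle_measure. (\<lambda>i. s i z) \<longlonglongrightarrow> F z))"

definition L1_norm :: "(complex \<Rightarrow> 'x::complex_banach) \<Rightarrow> ennreal"
  where "L1_norm F = (\<integral>\<^sup>+z. ennreal (norm (F z)) \<partial>circle_measure)"

definition L1_space :: "(complex \<Rightarrow> 'x::complex_banach) set"
  where "L1_space = {F. strongly_measurable F \<and> L1_norm F < \<infinity>}"

definition analytic_poly :: "nat \<Rightarrow> (nat \<Rightarrow> 'x::complex_banach) \<Rightarrow> complex \<Rightarrow> 'x"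
  where "analytic_poly n x z = (\<Sum>k\<le>n. z ^ k *\<^sub>C x k)"

definition H1_space :: "(complex \<Rightarrow> 'x::complex_banach) set"
  where "H1_space = {F \<in> L1_space.
    \<forall>e>0. \<exists>n x. L1_norm (\<lambda>z. F z - analytic_poly n x z) < e}"


section \<open>The projective tensor product of scalar \<open>H\<^sup>1\<close> with a Banach space\<close>

text \<open>
  An element of the algebraic tensor product is represented by a finite formal sum of
  elementary tensors, that is, by a list of pairs. Two lists represent the same tensor iff they
  are related by the congruence generated by the bilinearity relations; the rule \<open>tensor_AE\<close>
  identifies functions that are equal as elements of the scalar Hardy space.
\<close>

type_synonym 'x formal_tensor = "((complex \<Rightarrow> complex) \<times> 'x) list"

definition tensors :: "'x::complex_banach formal_tensor set"
  where "tensors = {u. \<forall>(h, x) \<in> set u. h \<in> H1_space}"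

inductive tensor_eq :: "'x::complex_banach formal_tensor \<Rightarrow> 'x formal_tensor \<Rightarrow> bool" where
  tensor_refl: "tensor_eq u u"
| tensor_sym: "tensor_eq u v \<Longrightarrow> tensor_eq v u"
| tensor_trans: "tensor_eq u v \<Longrightarrow> tensor_eq v w \<Longrightarrow> tensor_eq u w"
| tensor_append: "tensor_eq u u' \<Longrightarrow> tensor_eq v v' \<Longrightarrow> tensor_eq (u @ v) (u' @ v')"
| tensor_commute: "tensor_eq (u @ v) (v @ u)"
| tensor_zero: "h \<in> H1_space \<Longrightarrow> tensor_eq [(h, 0)] []"
| tensor_add_left: "h \<in> H1_space \<Longrightarrow> g \<in> H1_space \<Longrightarrow>
    tensor_eq [(\<lambda>z. h z + g z, x)] [(h, x), (g, x)]"
| tensor_add_right: "h \<in> H1_space \<Longrightarrow> tensor_eq [(h, x + y)] [(h, x), (h, y)]"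
| tensor_scale: "h \<in> H1_space \<Longrightarrow> tensor_eq [(\<lambda>z. c * h z, x)] [(h, c *\<^sub>C x)]"
| tensor_AE: "h \<in> H1_space \<Longrightarrow> g \<in> H1_space \<Longrightarrow> (AE z in circle_measure. h z = g z) \<Longrightarrow>
    tensor_eq [(h, x)] [(g, x)]"

definition tensor_diff ::
    "'x::complex_banach formal_tensor \<Rightarrow> 'x formal_tensor \<Rightarrow> 'x formal_tensor"
  where "tensor_diff u v = u @ map (\<lambda>(h, x). (h, - x)) v"

definition projective_norm :: "'x::complex_banach formal_tensor \<Rightarrow> ennreal"
  where "projective_norm u =
    (INF v \<in> {v \<in> tensors. tensor_eq u v}. (\<Sum>(h, x)\<leftarrow>v. L1_norm h * ennreal (norm x)))"

text \<open>
  The elements of the completed projective tensor product are represented by the Cauchy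
  sequences of algebraic tensors for the projective norm.
\<close>

definition projective_tensor_product :: "(nat \<Rightarrow> 'x::complex_banach formal_tensor) set"
  where "projective_tensor_product = {U. (\<forall>n. U n \<in> tensors) \<and>
    (\<forall>e>0. \<exists>N. \<forall>m\<ge>N. \<forall>n\<ge>N. projective_norm (tensor_diff (U m) (U n)) < e)}"

definition tensor_fun :: "'x::complex_banach formal_tensor \<Rightarrow> complex \<Rightarrow> 'x"
  where "tensor_fun u z = (\<Sum>(h, x)\<leftarrow>u. h z *\<^sub>C x)"

text \<open>
  The graph of the canonical map into the vector-valued Hardy space, which is the extension by
  continuity of \<^const>\<open>tensor_fun\<close>.
\<close>

definition canonical_map ::
    "(nat \<Rightarrow> 'x::complex_banach formal_tensor) \<Rightarrow> (complex \<Rightarrow> 'x) \<Rightarrow> bool"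
  where "canonical_map U F \<longleftrightarrow> F \<in> H1_space \<and>
    (\<lambda>n. L1_norm (\<lambda>z. F z - tensor_fun (U n) z)) \<longlonglongrightarrow> 0"

definition H1_projective :: "'x::complex_banach itself \<Rightarrow> bool"
  where "H1_projective _ \<longleftrightarrow>
    (\<forall>F::complex \<Rightarrow> 'x. F \<in> H1_space \<longrightarrow> (\<exists>U \<in> projective_tensor_product. canonical_map U F))"


section \<open>Cotype 2 and Grothendieck's theorem\<close>

definition sign_measure :: "(nat \<Rightarrow> real) measure"
  where "sign_measure = Pi\<^sub>M UNIV (\<lambda>_. uniform_count_measure {1, -1})"

definition cotype2 :: "'x::complex_banach itself \<Rightarrow> bool"
  where "cotype2 _ \<longleftrightarrow> (\<exists>c::real. \<forall>n (x::nat \<Rightarrow> 'x).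
    sqrt (\<Sum>k<n. (norm (x k))\<^sup>2) \<le>
      c * sqrt (\<integral>\<epsilon>. (norm (\<Sum>k<n. \<epsilon> k *\<^sub>R x k))\<^sup>2 \<partial>sign_measure))"

definition one_summing :: "('x::complex_banach \<Rightarrow> 'y::complex_banach) \<Rightarrow> bool"
  where "one_summing u \<longleftrightarrow> bounded_clinear u \<and>
    (\<exists>c::real. \<forall>n (x::nat \<Rightarrow> 'x). (\<Sum>k<n. norm (u (x k))) \<le>
      c * (SUP \<xi> \<in> {\<xi> :: 'x \<Rightarrow> complex. bounded_clinear \<xi> \<and> onorm \<xi> \<le> 1}. \<Sum>k<n. cmod (\<xi> (x k))))"

text \<open>
  HOL cannot quantify over types inside a formula. The Hilbert space is therefore a type
  argument: a space is a G.T. space iff this holds for every type \<open>'h\<close> of class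
  \<^class>\<open>complex_hilbert\<close>, so a theorem with this conclusion has to leave \<open>'h\<close> a type variable.
\<close>

definition GT_space :: "'x::complex_banach itself \<Rightarrow> 'h::complex_hilbert itself \<Rightarrow> bool"
  where "GT_space _ _ \<longleftrightarrow> (\<forall>u::'x \<Rightarrow> 'h. bounded_clinear u \<longrightarrow> one_summing u)"

end

theory Submission
  imports Defs
begin

text \<open>
  The proof rests on Paley's inequality: the map that sends \<open>h\<close> to its Fourier coefficients at
  the frequencies \<open>3\<^sup>j\<close> is bounded from the scalar Hardy space to \<open>\<ell>\<^sup>2\<close> (\<open>Paley_inequality\<close>).
  For a contraction \<open>(l\<^sub>j)\<close> from \<open>X\<close> to a finite-dimensional Hilbert space, the bilinear form
  \<open>(h, x) \<mapsto> \<Sum>\<^sub>j l\<^sub>j(x) h\<^sub>j\<close>, where \<open>h\<^sub>j\<close> is the coefficient at \<open>3\<^sup>j\<close>, is therefore bounded by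
  an absolute constant, and so is the induced functional on the projective tensor product. If
  \<open>X\<close> is \<open>H\<^sup>1\<close>-projective, every function in the vector-valued Hardy space comes from such a
  tensor, and the uniform boundedness principle yields a constant \<open>C\<close> with
  \<open>\<bar>\<Sum>\<^sub>j l\<^sub>j(F\<^sub>j)\<bar> \<le> C \<parallel>F\<parallel>\<close> for all contractions and all analytic polynomials \<open>F\<close> with
  coefficients \<open>F\<^sub>j\<close> at \<open>3\<^sup>j\<close> (\<open>H1_projective_uniformly_bounded\<close>). Both assertions follow by
  inserting suitable polynomials.

  For cotype 2, take the sum of the terms \<open>z\<^sup>m x\<^sub>k\<close> with \<open>m = 3\<^sup>k\<close>. With norming functionals
  for the \<open>x\<^sub>k\<close> the left-hand side can be made equal to the \<open>\<ell>\<^sup>2\<close> sum of the norms, and the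
  norm of this lacunary sum is controlled by the corresponding Rademacher sum
  (\<open>L1_norm_lacunary_le\<close>).

  For Grothendieck's theorem, let \<open>u\<close> map \<open>X\<close> into a Hilbert space and take the contraction
  obtained by normalising \<open>u\<close> and passing to coordinates on the span of the vectors \<open>u x\<^sub>k\<close>.
  Every unit vector is the sequence of lacunary coefficients of a polynomial that is bounded
  by 2 on the circle (\<open>bounded_polynomial_lacunary_coeffs\<close>). With such polynomials \<open>p\<^sub>k\<close> for
  the directions of the \<open>u x\<^sub>k\<close>, the function \<open>\<Sum>\<^sub>k p\<^sub>k(z) x\<^sub>k\<close> makes the left-hand side a
  multiple of \<open>\<Sum>\<^sub>k \<parallel>u x\<^sub>k\<parallel>\<close>, while its norm is at most \<open>2 sup \<Sum>\<^sub>k \<bar>\<xi>(x\<^sub>k)\<bar>\<close> over the unit ball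
  of the dual, by the Hahn--Banach theorem.

  Paley's inequality and the comparison with Rademacher sums are both proved by averaging over
  Riesz products.
\<close>


section \<open>The Hahn--Banach theorem\<close>

text \<open>
  Sublinear functionals are taken to be dominated by the norm, which bounds them below as
  well, so that pointwise infima of chains exist.
\<close>

definition sublinear :: "('a::real_normed_vector \<Rightarrow> real) \<Rightarrow> bool"
  where "sublinear p \<longleftrightarrow> (\<forall>x y. p (x + y) \<le> p x + p y) \<and> (\<forall>t\<ge>0. \<forall>x. p (t *\<^sub>R x) = t * p x)
    \<and> (\<forall>x. p x \<le> norm x)"

lemma sublinear_ge:
  assumes "sublinear p" shows "- norm x \<le> p x"
proof -
  have "p 0 = 0" using assms unfolding sublinear_def by (metis mult_zero_left order_refl scaleR_zero_left)
  moreover have "p (x + - x) \<le> p x + p (- x)" using assms unfolding sublinear_def by blast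
  moreover have "p (- x) \<le> norm (- x)" using assms unfolding sublinear_def by blast
  ultimately show ?thesis by simp
qed

lemma sublinear_norm: "sublinear norm"
  by (simp add: sublinear_def norm_triangle_ineq)

text \<open>
  \<^term>\<open>push_down p y\<close> is the largest sublinear functional below \<^term>\<open>p\<close> whose value at \<open>-y\<close> is at
  most \<open>- p y\<close>, that is, the largest one that is linear along \<open>y\<close> with value \<open>p y\<close>.
\<close>

definition push_down :: "('a::real_normed_vector \<Rightarrow> real) \<Rightarrow> 'a \<Rightarrow> 'a \<Rightarrow> real"
  where "push_down p y x = (INF t\<in>{0..}. p (x + t *\<^sub>R y) - t * p y)"

lemma push_down_le:
  assumes "sublinear p" and "t \<ge> 0"
  shows "push_down p y x \<le> p (x + t *\<^sub>R y) - t * p y"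
proof -
  have "bdd_below ((\<lambda>t. p (x + t *\<^sub>R y) - t * p y) ` {0..})"
  proof (rule bdd_belowI2)
    fix t :: real assume "t \<in> {0..}"
    then have "p (t *\<^sub>R y) = t * p y" using assms unfolding sublinear_def by simp
    moreover have "p ((x + t *\<^sub>R y) + - x) \<le> p (x + t *\<^sub>R y) + p (- x)"
      using assms unfolding sublinear_def by blast
    moreover have "p (- x) \<le> norm (- x)" using assms unfolding sublinear_def by blast
    ultimately show "- norm x \<le> p (x + t *\<^sub>R y) - t * p y" by simp
  qed
  then show ?thesis unfolding push_down_def using assms(2) by (intro cINF_lower) auto
qed

lemma push_down_approx:
  assumes "e > 0"
  obtains t where "t \<ge> 0" "p (x + t *\<^sub>R y) - t * p y < push_down p y x + e"
proof -
  have "(INF t\<in>{0..}. p (x + t *\<^sub>R y) - t * p y) < push_down p y x + e"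
    using assms by (simp add: push_down_def)
  then show ?thesis using that cInf_lessD[of "(\<lambda>t. p (x + t *\<^sub>R y) - t * p y) ` {0..}"] by fastforce
qed

lemma sublinear_push_down:
  assumes p: "sublinear p" shows "sublinear (push_down p y)"
proof -
  have hom: "p (t *\<^sub>R x) = t * p x" if "t \<ge> 0" for t x
    using p that unfolding sublinear_def by blast
  have add: "p (x + x') \<le> p x + p x'" for x x' using p unfolding sublinear_def by blast
  have le: "push_down p y x \<le> p x" for x using push_down_le[OF p, of 0 y x] by simp
  have 1: "push_down p y (x + x') \<le> push_down p y x + push_down p y x'" for x x'
  proof (rule field_le_epsilon)
    fix e :: real assume "e > 0"
    then have e: "e / 2 > 0" by simp
    obtain s where s: "s \<ge> 0" "p (x + s *\<^sub>R y) - s * p y < push_down p y x + e / 2"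
      using push_down_approx[OF e] .
    obtain t where t: "t \<ge> 0" "p (x' + t *\<^sub>R y) - t * p y < push_down p y x' + e / 2"
      using push_down_approx[OF e] .
    have "push_down p y (x + x') \<le> p (x + x' + (s + t) *\<^sub>R y) - (s + t) * p y"
      using s t by (intro push_down_le p) simp
    also have "x + x' + (s + t) *\<^sub>R y = (x + s *\<^sub>R y) + (x' + t *\<^sub>R y)" by (simp add: algebra_simps)
    also have "p \<dots> \<le> p (x + s *\<^sub>R y) + p (x' + t *\<^sub>R y)" by (rule add)
    finally show "push_down p y (x + x') \<le> push_down p y x + push_down p y x' + e"
      using s t by (simp add: algebra_simps)
  qed
  have 2: "push_down p y (r *\<^sub>R x) \<le> r * push_down p y x" if r: "r > 0" for r x
  proof (rule field_le_epsilon)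
    fix e :: real assume "e > 0"
    then have e: "e / r > 0" using r by simp
    obtain s where s: "s \<ge> 0" "p (x + s *\<^sub>R y) - s * p y < push_down p y x + e / r"
      using push_down_approx[OF e] .
    have "push_down p y (r *\<^sub>R x) \<le> p (r *\<^sub>R x + (r * s) *\<^sub>R y) - (r * s) * p y"
      using s r by (intro push_down_le p) simp
    also have "r *\<^sub>R x + (r * s) *\<^sub>R y = r *\<^sub>R (x + s *\<^sub>R y)" by (simp add: algebra_simps)
    also have "p \<dots> = r * p (x + s *\<^sub>R y)" using r by (intro hom) simp
    also have "\<dots> - (r * s) * p y = r * (p (x + s *\<^sub>R y) - s * p y)" by (simp add: algebra_simps)
    also have "\<dots> \<le> r * (push_down p y x + e / r)" using r s by (intro mult_left_mono) auto
    finally show "push_down p y (r *\<^sub>R x) \<le> r * push_down p y x + e"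
      using r by (simp add: algebra_simps)
  qed
  have p0: "p 0 = 0" using hom[of 0 0] by simp
  have zero: "push_down p y 0 = 0"
  proof -
    have "push_down p y 0 = (INF t\<in>{0::real..}. 0)"
      unfolding push_down_def by (intro arg_cong[where f=Inf] image_cong) (auto simp: hom)
    then show ?thesis by simp
  qed
  have 3: "push_down p y (r *\<^sub>R x) = r * push_down p y x" if "r \<ge> 0" for r x
  proof (cases "r = 0")
    case True then show ?thesis by (simp add: zero)
  next
    case False
    with that have r: "r > 0" by simp
    have "push_down p y (inverse r *\<^sub>R (r *\<^sub>R x)) \<le> inverse r * push_down p y (r *\<^sub>R x)"
      using r by (intro 2) simp
    then have "r * push_down p y x \<le> push_down p y (r *\<^sub>R x)" using r by (simp add: field_simps)
    with 2[OF r, of x] show ?thesis by simp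
  qed
  have 4: "push_down p y x \<le> norm x" for x
    using le[of x] p unfolding sublinear_def by (meson order_trans)
  show ?thesis unfolding sublinear_def using 1 3 4 by blast
qed

text \<open>
  By Zorn's lemma there is a minimal sublinear functional below a given one. It is linear,
  since \<^const>\<open>push_down\<close> cannot lower it any further; this replaces the usual extension of a
  functional one dimension at a time.
\<close>

lemma exists_linear_below_sublinear:
  assumes q: "sublinear q"
  obtains f where "sublinear f" "linear f" "\<And>x. f x \<le> q x"
proof -
  let ?S = "{p. sublinear p \<and> (\<forall>x. p x \<le> q x)}"
  let ?P = "\<lambda>p r. \<forall>x. r x \<le> (p x :: real)"
  have "\<exists>m\<in>?S. \<forall>a\<in>?S. ?P m a \<longrightarrow> a = m"
  proof (rule predicate_Zorn)
    show "partial_order_on ?S (relation_of ?P ?S)"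
      by (rule partial_order_on_relation_ofI) (auto intro!: ext intro: order_trans antisym)
    fix C assume C: "C \<in> Chains (relation_of ?P ?S)"
    have CS: "C \<subseteq> ?S"
      using C unfolding Chains_def relation_of_def by blast
    have ch: "?P p r \<or> ?P r p" if "p \<in> C" "r \<in> C" for p r
      using C that unfolding Chains_def relation_of_def by blast
    show "\<exists>u\<in>?S. \<forall>a\<in>C. ?P a u"
    proof (cases "C = {}")
      case True then show ?thesis using q by auto
    next
      case False
      define u where "u = (\<lambda>x. INF p\<in>C. p x)"
      have sub: "sublinear p" if "p \<in> C" for p using CS that by blast
      have bdd: "bdd_below ((\<lambda>p. p x) ` C)" for x
        by (rule bdd_belowI2[of _ "- norm x"]) (use sub sublinear_ge in blast)
      have low: "u x \<le> p x" if "p \<in> C" for p x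
        unfolding u_def by (rule cINF_lower[OF bdd that])
      have grt: "c \<le> u x" if "\<And>p. p \<in> C \<Longrightarrow> c \<le> p x" for c x
        unfolding u_def by (rule cINF_greatest[OF False]) (use that in auto)
      have 1: "u (x + y) \<le> u x + u y" for x y
      proof -
        have "u (x + y) - p x \<le> r y" if pr: "p \<in> C" "r \<in> C" for p r
        proof -
          obtain s where s: "s \<in> C" "?P p s" "?P r s" using ch[OF pr] pr by blast
          have "u (x + y) \<le> s (x + y)" by (rule low[OF s(1)])
          also have "\<dots> \<le> s x + s y" using sub[OF s(1)] unfolding sublinear_def by blast
          also have "\<dots> \<le> p x + r y" using s by (intro add_mono) auto
          finally show ?thesis by simp
        qed
        then have "u (x + y) - p x \<le> u y" if "p \<in> C" for p using that grt by blast
        then have "u (x + y) - u y \<le> u x" by (intro grt) (simp add: algebra_simps)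
        then show ?thesis by simp
      qed
      have 2: "u (t *\<^sub>R x) = t * u x" if t: "t \<ge> 0" for t x
      proof (cases "t = 0")
        case True
        have "p 0 = 0" if "p \<in> C" for p
          using sub[OF that] unfolding sublinear_def by (metis mult_zero_left order_refl scaleR_zero_left)
        then have "u 0 = (INF p\<in>C. 0)" unfolding u_def by (intro arg_cong[where f=Inf] image_cong) auto
        then show ?thesis using True False by simp
      next
        case nz: False
        with t have t: "t > 0" by simp
        have hom: "p (t *\<^sub>R x) = t * p x" if "p \<in> C" for p
          using sub[OF that] t unfolding sublinear_def by simp
        have "u (t *\<^sub>R x) / t \<le> u x"
        proof (rule grt)
          fix p assume p: "p \<in> C"
          have "u (t *\<^sub>R x) \<le> t * p x" using low[OF p] hom[OF p] by metis
          then show "u (t *\<^sub>R x) / t \<le> p x" using t by (simp add: field_simps)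
        qed
        moreover have "t * u x \<le> u (t *\<^sub>R x)"
        proof (rule grt)
          fix p assume p: "p \<in> C"
          have "t * u x \<le> t * p x" using low[OF p] t by (intro mult_left_mono) auto
          then show "t * u x \<le> p (t *\<^sub>R x)" by (simp only: hom[OF p])
        qed
        ultimately show ?thesis using t by (simp add: field_simps)
      qed
      obtain p0 where p0: "p0 \<in> C" using False by blast
      have 3: "u x \<le> norm x" "u x \<le> q x" for x
        using low[OF p0, of x] p0 CS unfolding sublinear_def by (auto intro: order_trans)
      have "u \<in> ?S" using 1 2 3 unfolding sublinear_def by blast
      then show ?thesis using low by blast
    qed
  qed
  then obtain f where f: "sublinear f" "\<And>x. f x \<le> q x"
    and min: "\<And>a. sublinear a \<Longrightarrow> (\<forall>x. a x \<le> q x) \<Longrightarrow> (\<forall>x. a x \<le> f x) \<Longrightarrow> a = f" by blast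
  have "f x + f y \<le> f (x + y)" for x y
  proof -
    have le: "push_down f y x \<le> f x" for x using push_down_le[OF f(1), of 0 y x] by simp
    have "push_down f y = f"
      using le f(2) by (intro min sublinear_push_down f) (meson order_trans)+
    then have "f x \<le> f (x + 1 *\<^sub>R y) - 1 * f y"
      using push_down_le[OF f(1), of 1 y x] by simp
    then show ?thesis by simp
  qed
  then have add: "f (x + y) = f x + f y" for x y
    using f(1) unfolding sublinear_def by (meson antisym)
  have hom: "f (t *\<^sub>R x) = t * f x" if "t \<ge> 0" for t x
    using f(1) that unfolding sublinear_def by blast
  have neg: "f (- x) = - f x" for x using add[of x "- x"] hom[of 0 0] by simp
  have "f (t *\<^sub>R x) = t * f x" for t x
    using hom[of t x] hom[of "- t" x] neg[of "t *\<^sub>R x"] by (cases "t \<ge> 0") auto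
  then have "linear f" by (intro linearI) (auto simp: add)
  then show ?thesis using that f by blast
qed

lemma bounded_clinearD:
  assumes "bounded_clinear f"
  shows "bounded_linear f" "f (x + y) = f x + f y" "f (c *\<^sub>C x) = c *\<^sub>C f x" "f 0 = 0"
    "f (x - y) = f x - f y" "f (- x) = - f x"
    "f (sum g A) = (\<Sum>a\<in>A. f (g a))" "f (r *\<^sub>R x) = r *\<^sub>R f x"
  using assms unfolding bounded_clinear_def
  by (auto dest: bounded_linear.linear simp: linear_add linear_0 linear_diff linear_neg linear_sum
      linear_scale)

theorem complex_Hahn_Banach_norm:
  fixes x0 :: "'a::complex_banach"
  obtains \<xi> :: "'a \<Rightarrow> complex" where "bounded_clinear \<xi>" "onorm \<xi> \<le> 1" "\<And>x. cmod (\<xi> x) \<le> norm x"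
    "\<xi> x0 = of_real (norm x0)"
proof -
  \<comment> \<open>Pushing the norm down along \<open>x0\<close> first forces the linear functional to be norming at \<open>x0\<close>.\<close>
  obtain f :: "'a \<Rightarrow> real" where f: "sublinear f" "linear f" and le: "\<And>x. f x \<le> push_down norm x0 x"
    using exists_linear_below_sublinear[OF sublinear_push_down[OF sublinear_norm]] by blast
  have fle: "f x \<le> norm x" for x using f(1) unfolding sublinear_def by blast
  have "f (- x0) \<le> - norm x0"
    using le[of "- x0"] push_down_le[OF sublinear_norm, of 1 x0 "- x0"] by simp
  then have fx0: "f x0 = norm x0" using fle[of x0] f(2) by (simp add: linear_neg)
  \<comment> \<open>the complex-linear functional with real part \<open>f\<close>\<close>
  define \<xi> where "\<xi> x = Complex (f x) (- f (\<i> *\<^sub>C x))" for x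
  have add: "f (x + y) = f x + f y" and sc: "f (r *\<^sub>R x) = r * f x" and neg: "f (- x) = - f x" for x y r
    using f(2) by (simp_all add: linear_add linear_scale linear_neg)
  have split: "c *\<^sub>C x = Re c *\<^sub>R x + Im c *\<^sub>R (\<i> *\<^sub>C x)" for c and x :: 'a
  proof -
    have "c = of_real (Re c) + of_real (Im c) * \<i>" by (simp add: complex_eq_iff)
    then have "c *\<^sub>C x = (of_real (Re c) + of_real (Im c) * \<i>) *\<^sub>C x" by simp
    then show ?thesis by (simp only: scaleC_add_left scaleR_scaleC scaleC_scaleC)
  qed
  have ii: "\<i> *\<^sub>C \<i> *\<^sub>C x = - x" for x :: 'a
    by (simp add: scaleC_scaleC) (metis of_real_1 of_real_minus scaleR_minus1_left scaleR_scaleC)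
  have clin: "\<xi> (c *\<^sub>C x) = c * \<xi> x" for c x
  proof -
    have "\<i> *\<^sub>C c *\<^sub>C x = Re c *\<^sub>R (\<i> *\<^sub>C x) + Im c *\<^sub>R (- x)"
      unfolding ii[symmetric] by (simp add: scaleR_scaleC scaleC_scaleC flip: scaleC_add_left)
        (intro arg_cong2[where f=scaleC] refl, simp add: complex_eq_iff)
    then have "f (\<i> *\<^sub>C c *\<^sub>C x) = Re c * f (\<i> *\<^sub>C x) + Im c * (- f x)" by (simp only: add sc neg)
    moreover have "f (c *\<^sub>C x) = Re c * f x + Im c * f (\<i> *\<^sub>C x)"
      by (subst split) (simp only: add sc)
    ultimately show ?thesis by (simp add: \<xi>_def complex_eq_iff algebra_simps)
  qed
  have xi_add: "\<xi> (x + y) = \<xi> x + \<xi> y" for x y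
    by (simp add: \<xi>_def scaleC_add_right add complex_eq_iff)
  have le1: "cmod (\<xi> x) \<le> norm x" for x
  proof -
    define c where "c = cnj (sgn (\<xi> x))"
    have c1: "cmod c \<le> 1" by (simp add: c_def norm_sgn)
    have c2: "c * \<xi> x = of_real (cmod (\<xi> x))"
    proof (cases "\<xi> x = 0")
      case False
      have "c * \<xi> x = \<xi> x * cnj (\<xi> x) / of_real (cmod (\<xi> x))"
        by (simp add: c_def sgn_eq)
      then show ?thesis
        using False by (simp add: complex_norm_square[symmetric] power2_eq_square)
    qed simp
    have "cmod (\<xi> x) = Re (\<xi> (c *\<^sub>C x))" unfolding clin c2 by simp
    also have "\<dots> = f (c *\<^sub>C x)" by (simp add: \<xi>_def)
    also have "\<dots> \<le> norm (c *\<^sub>C x)" by (rule fle)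
    also have "\<dots> \<le> norm x" using c1 by (simp add: norm_scaleC mult_left_le_one_le)
    finally show ?thesis .
  qed
  have scR: "\<xi> (r *\<^sub>R x) = r *\<^sub>R \<xi> x" for r x
    by (simp add: scaleR_scaleC clin scaleC_complex_def)
  have bl: "bounded_linear \<xi>"
    by (rule bounded_linear_intro[of _ 1]) (auto simp: xi_add scR le1)
  have "\<xi> x0 = of_real (norm x0)"
  proof (cases "x0 = 0")
    case False
    have "Re (\<xi> x0) = norm x0" by (simp add: \<xi>_def fx0)
    moreover have "(Re (\<xi> x0))\<^sup>2 + (Im (\<xi> x0))\<^sup>2 \<le> (norm x0)\<^sup>2"
      using le1[of x0] by (metis cmod_power2 norm_ge_zero power_mono)
    ultimately show ?thesis by (simp add: complex_eq_iff)
  qed (use linear_0[OF bounded_linear.linear[OF bl]] in simp)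
  moreover have "bounded_clinear \<xi>"
    unfolding bounded_clinear_def using bl clin by (simp add: scaleC_complex_def)
  moreover have "onorm \<xi> \<le> 1" by (rule onorm_bound) (simp_all add: le1)
  ultimately show ?thesis using that le1 by blast
qed


section \<open>Integration on the circle\<close>

abbreviation circle_completion :: "complex measure"
  where "circle_completion \<equiv> completion circle_measure"

lemma space_circle_measure: "space circle_measure = sphere 0 1"
  by (simp add: circle_measure_def space_restrict_space)

lemma sets_circle_measure: "sets circle_measure = sets (restrict_space borel (sphere 0 1))"
  by (simp add: circle_measure_def)

lemma measurable_cis: "cis \<in> uniform_measure lborel {0..<2 * pi} \<rightarrow>\<^sub>M restrict_space borel (sphere 0 1)"
proof (rule measurable_restrict_space2)
  have "cis \<in> borel_measurable borel"
    by (intro borel_measurable_continuous_onI continuous_on_cis continuous_on_id)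
  then show "cis \<in> borel_measurable (uniform_measure lborel {0..<2 * pi})"
    by (simp add: measurable_def)
qed auto

lemma prob_space_circle_measure: "prob_space circle_measure"
proof -
  interpret prob_space "uniform_measure lborel {0..<2 * pi}"
    by (rule prob_space_uniform_measure) auto
  show ?thesis unfolding circle_measure_def by (rule prob_space_distr[OF measurable_cis])
qed

interpretation circle: prob_space circle_measure
  by (rule prob_space_circle_measure)

interpretation circle_completion: prob_space circle_completion
proof
  show "emeasure circle_completion (space circle_completion) = 1"
    by (simp add: circle.emeasure_space_1)
qed

lemma borel_measurable_circle:
  "f \<in> borel_measurable borel \<Longrightarrow> f \<in> borel_measurable circle_measure"
  by (simp add: measurable_cong_sets[OF sets_circle_measure refl] measurable_restrict_space1)

lemma borel_measurable_circle_completion: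
  "f \<in> borel_measurable borel \<Longrightarrow> f \<in> borel_measurable circle_completion"
  by (intro measurable_completion borel_measurable_circle)

lemma integral_circle_measure:
  fixes f :: "complex \<Rightarrow> complex"
  assumes f: "f \<in> borel_measurable borel"
  shows "integral\<^sup>L circle_completion f =
    (\<integral>t. indicator {0..2 * pi} t *\<^sub>R f (cis t) \<partial>lborel) / (2 * pi)"
proof -
  have fc [measurable]: "(\<lambda>t. f (cis t)) \<in> borel_measurable borel"
    by (rule measurable_compose[OF _ f]) (simp add: borel_measurable_continuous_onI continuous_on_cis)
  have "integral\<^sup>L circle_completion f = integral\<^sup>L circle_measure f"
    by (rule integral_completion) (use f borel_measurable_circle in auto)
  also have "\<dots> = (\<integral>t. f (cis t) \<partial>uniform_measure lborel {0..<2 * pi})"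
    unfolding circle_measure_def
    by (rule integral_distr[OF measurable_cis]) (use f measurable_restrict_space1 in blast)
  also have "uniform_measure lborel {0..<2 * pi} =
      density lborel (\<lambda>t. ennreal (indicator {0..<2 * pi} t / (2 * pi)))"
    unfolding uniform_measure_def
    by (intro arg_cong2[where f=density] ext refl)
      (auto simp: indicator_def divide_ennreal[symmetric] simp flip: ennreal_1)
  also have "(\<integral>t. f (cis t) \<partial>density lborel (\<lambda>t. ennreal (indicator {0..<2 * pi} t / (2 * pi)))) =
      (\<integral>t. (indicator {0..<2 * pi} t / (2 * pi)) *\<^sub>R f (cis t) \<partial>lborel)"
    by (subst integral_density) auto
  also have "\<dots> = (\<integral>t. indicator {0..2 * pi} t *\<^sub>R f (cis t) / (2 * pi) \<partial>lborel)"
  proof (rule integral_cong_AE)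
    have "AE t in lborel. t \<noteq> 2 * pi" by (rule AE_lborel_singleton)
    then show "AE t in lborel. (indicator {0..<2 * pi} t / (2 * pi)) *\<^sub>R f (cis t) =
        indicator {0..2 * pi} t *\<^sub>R f (cis t) / (2 * pi)"
      by eventually_elim (auto simp: indicator_def scaleR_conv_of_real)
  qed auto
  also have "\<dots> = (\<integral>t. indicator {0..2 * pi} t *\<^sub>R f (cis t) \<partial>lborel) / (2 * pi)"
    by (rule integral_divide_zero)
  finally show ?thesis .
qed

lemma integral_circle_power:
  assumes "j \<noteq> 0"
  shows "integral\<^sup>L circle_completion (\<lambda>z. z ^ j) = 0"
proof -
  define F where "F t = cis (real j * t) / (\<i> * of_nat j)" for t
  have "(F has_vector_derivative cis t ^ j) (at t within A)" for t A
    unfolding F_def has_vector_derivative_complex_iff using assms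
    by (auto simp: Re_divide Im_divide Complex.DeMoivre power2_eq_square intro!: derivative_eq_intros)
  moreover have "continuous_on {0..2 * pi} (\<lambda>t. cis t ^ j)"
    by (intro continuous_intros)
  ultimately have "(\<integral>t. indicator {0..2 * pi} t *\<^sub>R (cis t ^ j) \<partial>lborel) = F (2 * pi) - F 0"
    by (intro integral_FTC_Icc) auto
  also have "F (2 * pi) = F 0"
    using cis_multiple_2pi[of "real j"] by (simp add: F_def ac_simps)
  finally show ?thesis by (subst integral_circle_measure) auto
qed

text \<open>
  The measure space of the circle is not complete, so that an element of \<^const>\<open>L1_space\<close>, being
  only almost everywhere a limit of simple functions, need not be measurable. It is measurable
  with respect to the completion, which has the same integrals.
\<close>

lemma strongly_measurable_completion:
  assumes "strongly_measurable (h :: complex \<Rightarrow> complex)"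
  shows "h \<in> borel_measurable circle_completion"
proof -
  obtain s where s: "\<And>i::nat. simple_function circle_measure (s i)"
    and lim: "AE z in circle_measure. (\<lambda>i. s i z) \<longlonglongrightarrow> h z"
    using assms unfolding strongly_measurable_def by blast
  have meas: "(\<lambda>z. lim (\<lambda>i. s i z)) \<in> borel_measurable circle_measure"
    by (rule borel_measurable_lim_metric) (rule borel_measurable_simple_function[OF s])
  have ae: "AE z in circle_completion. lim (\<lambda>i. s i z) = h z"
    using AE_completion[OF lim] by eventually_elim (rule limI)
  show ?thesis
  proof (rule measurableI)
    fix A :: "complex set" assume A: "A \<in> sets borel"
    let ?B = "(\<lambda>z. lim (\<lambda>i. s i z)) -` A \<inter> space circle_completion"
    have B: "?B \<in> sets circle_completion"
      by (rule measurable_sets[OF measurable_completion[OF meas] A])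
    have "AE z in circle_completion. z \<in> ?B \<longleftrightarrow> z \<in> h -` A \<inter> space circle_completion"
      using ae by eventually_elim auto
    from completion.in_sets_AE[OF this B]
    show "h -` A \<inter> space circle_completion \<in> sets circle_completion" by simp
  qed simp
qed

lemma L1_norm_completion: "L1_norm F = (\<integral>\<^sup>+z. ennreal (norm (F z)) \<partial>circle_completion)"
  unfolding L1_norm_def by (rule nn_integral_completion[symmetric])

lemma L1_space_integrable:
  assumes "h \<in> L1_space"
  shows "integrable circle_completion (h :: complex \<Rightarrow> complex)"
    "L1_norm h = ennreal (\<integral>z. cmod (h z) \<partial>circle_completion)"
proof -
  show int: "integrable circle_completion h"
    using assms strongly_measurable_completion
    by (auto simp: L1_space_def integrable_iff_bounded L1_norm_completion)
  show "L1_norm h = ennreal (\<integral>z. cmod (h z) \<partial>circle_completion)"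
    unfolding L1_norm_completion by (rule nn_integral_eq_integral) (use int in auto)
qed

lemma strongly_measurable_compose:
  fixes F :: "complex \<Rightarrow> 'x::complex_banach" and l :: "'x \<Rightarrow> 'y::complex_banach"
  assumes F: "strongly_measurable F" and l: "continuous_on UNIV l"
  shows "strongly_measurable (\<lambda>z. l (F z))"
proof -
  obtain s where s: "\<And>i::nat. simple_function circle_measure (s i)"
    and lim: "AE z in circle_measure. (\<lambda>i. s i z) \<longlonglongrightarrow> F z"
    using F unfolding strongly_measurable_def by blast
  have "AE z in circle_measure. (\<lambda>i. l (s i z)) \<longlonglongrightarrow> l (F z)"
    using lim by eventually_elim (use l in \<open>auto intro: continuous_on_tendsto_compose\<close>)
  moreover have "simple_function circle_measure (\<lambda>z. l (s i z))" for i
    using simple_function_compose[OF s[of i], of l] by (simp add: comp_def)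
  ultimately show ?thesis unfolding strongly_measurable_def by (intro exI[of _ "\<lambda>i z. l (s i z)"]) blast
qed

text \<open>
  The \<open>n\<close>-th Fourier coefficient, by means of \<open>cnj z ^ n = z\<^sup>-\<^sup>n\<close> on the circle. Only the
  coefficients with \<open>n \<ge> 0\<close> are needed.
\<close>

definition fourier_coeff :: "nat \<Rightarrow> (complex \<Rightarrow> complex) \<Rightarrow> complex"
  where "fourier_coeff n h = (\<integral>z. h z * cnj z ^ n \<partial>circle_completion)"

lemma AE_circle_norm: "AE z in circle_completion. cmod z = 1"
  by (rule AE_I2) (simp add: space_circle_measure)

lemma integrable_mult_bounded:
  fixes h :: "complex \<Rightarrow> complex"
  assumes h: "integrable circle_completion h" and g: "g \<in> borel_measurable borel"
    and bound: "\<And>z. cmod z = 1 \<Longrightarrow> cmod (g z) \<le> B"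
  shows "integrable circle_completion (\<lambda>z. h z * g z)"
proof (rule Bochner_Integration.integrable_bound)
  show "integrable circle_completion (\<lambda>z. B *\<^sub>R h z)" using h by simp
  show "(\<lambda>z. h z * g z) \<in> borel_measurable circle_completion"
    using h borel_measurable_circle_completion[OF g] by (intro borel_measurable_times) auto
  show "AE z in circle_completion. cmod (h z * g z) \<le> cmod (B *\<^sub>R h z)"
    using AE_circle_norm
  proof eventually_elim
    case (elim z)
    have "cmod (h z) * cmod (g z) \<le> cmod (h z) * \<bar>B\<bar>"
      using bound[OF elim] by (intro mult_left_mono) auto
    then show ?case by (simp add: norm_mult mult.commute)
  qed
qed

lemma integrable_circle_bounded:
  assumes g: "g \<in> borel_measurable borel" and bound: "\<And>z. cmod z = 1 \<Longrightarrow> cmod (g z) \<le> B"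
  shows "integrable circle_completion (g :: complex \<Rightarrow> complex)"
  using integrable_mult_bounded[of "\<lambda>_. 1", OF _ g bound] by simp

lemma integrable_fourier:
  "integrable circle_completion h \<Longrightarrow> integrable circle_completion (\<lambda>z. h z * cnj z ^ n)"
  by (rule integrable_mult_bounded[where B=1]) (auto simp: norm_power
    intro!: borel_measurable_continuous_onI continuous_intros)

lemma integrable_circle_mult_power:
  "integrable circle_completion h \<Longrightarrow> integrable circle_completion (\<lambda>z. h z * z ^ n)"
  by (rule integrable_mult_bounded[where B=1]) (auto simp: norm_power
    intro!: borel_measurable_continuous_onI continuous_intros)

lemma fourier_coeff_le:
  assumes h: "integrable circle_completion h"
  shows "cmod (fourier_coeff n h) \<le> (\<integral>z. cmod (h z) \<partial>circle_completion)"
proof -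
  have "cmod (fourier_coeff n h) \<le> (\<integral>z. cmod (h z * cnj z ^ n) \<partial>circle_completion)"
    unfolding fourier_coeff_def by (rule integral_norm_bound)
  also have "\<dots> = (\<integral>z. cmod (h z) \<partial>circle_completion)"
  proof (rule integral_cong_AE)
    show "AE z in circle_completion. cmod (h z * cnj z ^ n) = cmod (h z)"
      using AE_circle_norm by eventually_elim (simp add: norm_mult norm_power)
  qed (use h integrable_fourier[OF h, of n] in auto)
  finally show ?thesis .
qed

lemma cnj_power_mult_power:
  assumes "cmod z = 1" shows "cnj z ^ n * z ^ n = 1"
proof -
  have "cnj z * z = 1" using assms by (simp add: complex_norm_square[symmetric] mult.commute)
  then show ?thesis by (simp flip: power_mult_distrib)
qed

lemma fourier_coeff_power: "fourier_coeff n (\<lambda>z. z ^ k) = (if k = n then 1 else 0)"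
proof -
  have *: "fourier_coeff n (\<lambda>z. z ^ k) =
      (\<integral>z. (if n \<le> k then z ^ (k - n) else cnj (z ^ (n - k))) \<partial>circle_completion)"
    unfolding fourier_coeff_def
  proof (rule integral_cong_AE)
    show "AE z in circle_completion. z ^ k * cnj z ^ n =
        (if n \<le> k then z ^ (k - n) else cnj (z ^ (n - k)))"
      using AE_circle_norm
    proof eventually_elim
      case (elim z)
      show ?case
      proof (cases "n \<le> k")
        case True
        then obtain d where "k = n + d" using le_Suc_ex by blast
        then have "z ^ k * cnj z ^ n = z ^ (k - n) * (cnj z ^ n * z ^ n)"
          by (simp add: power_add ac_simps)
        then show ?thesis using True elim by (simp add: cnj_power_mult_power)
      next
        case False
        then obtain d where "n = k + d" using le_Suc_ex[of k n] by auto
        then have "z ^ k * cnj z ^ n = cnj z ^ (n - k) * (cnj z ^ k * z ^ k)"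
          by (simp add: power_add ac_simps)
        then show ?thesis using False elim by (simp add: cnj_power_mult_power)
      qed
    qed
  next
    show "(\<lambda>z. if n \<le> k then z ^ (k - n) else cnj (z ^ (n - k))) \<in> borel_measurable circle_completion"
      by (cases "n \<le> k") (auto intro!: borel_measurable_circle_completion
          borel_measurable_continuous_onI continuous_intros)
  qed (intro borel_measurable_circle_completion borel_measurable_continuous_onI continuous_intros)
  show ?thesis
  proof (cases n k rule: linorder_cases)
    case less
    then show ?thesis unfolding * using integral_circle_power[of "k - n"] by simp
  next
    case equal
    then show ?thesis unfolding * using circle_completion.prob_space by simp
  next
    case greater
    then have "(\<integral>z. cnj (z ^ (n - k)) \<partial>circle_completion) = 0"
      using integral_circle_power[of "n - k"] by (subst Bochner_Integration.integral_cnj) simp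
    then show ?thesis unfolding * using greater by simp
  qed
qed


section \<open>Averages over finite words\<close>

text \<open>
  The average of \<open>f\<close> over all words of length \<open>n\<close> with letters in the finite set \<open>W\<close>, that is, the
  expectation of \<open>f\<close> for independent uniformly distributed letters. The recursion conditions
  on the last letter. Words are padded with \<open>0\<close> beyond position \<open>n\<close>.
\<close>

primrec avg :: "'w::zero set \<Rightarrow> nat \<Rightarrow> ((nat \<Rightarrow> 'w) \<Rightarrow> 'v::real_vector) \<Rightarrow> 'v" where
  "avg W 0 f = f (\<lambda>_. 0)"
| "avg W (Suc n) f = (1 / real (card W)) *\<^sub>R (\<Sum>w\<in>W. avg W n (\<lambda>v. f (v(n := w))))"

lemma avg_const:
  assumes "finite W" "W \<noteq> {}" shows "avg W n (\<lambda>_. c) = c"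
  by (induction n) (use assms in \<open>simp_all add: sum_constant_scaleR\<close>)

lemma avg_add: "avg W n (\<lambda>v. f v + g v) = avg W n f + avg W n g"
  by (induction n arbitrary: f g) (simp_all add: sum.distrib scaleR_add_right)

lemma avg_linear: "linear L \<Longrightarrow> L (avg W n f) = avg W n (\<lambda>v. L (f v))"
  by (induction n arbitrary: f) (simp_all add: linear_scale linear_sum)

lemma avg_sum: "avg W n (\<lambda>v. \<Sum>i\<in>I. f i v) = (\<Sum>i\<in>I. avg W n (f i))"
proof (induction n arbitrary: f)
  case (Suc n)
  show ?case by (simp add: Suc scaleR_sum_right[symmetric] sum.swap[of _ W I])
qed simp

lemma avg_mono:
  fixes f g :: "_ \<Rightarrow> real"
  assumes "\<And>v. (\<And>k. k < n \<Longrightarrow> v k \<in> W) \<Longrightarrow> f v \<le> g v"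
  shows "avg W n f \<le> avg W n g"
  using assms
proof (induction n arbitrary: f g)
  case (Suc n)
  have "avg W n (\<lambda>v. f (v(n := w))) \<le> avg W n (\<lambda>v. g (v(n := w)))" if "w \<in> W" for w
    by (rule Suc.IH, rule Suc.prems) (use that in auto)
  then show ?case by (auto intro!: divide_right_mono sum_mono)
qed simp

lemma avg_cong:
  assumes "\<And>v. (\<And>k. k < n \<Longrightarrow> v k \<in> W) \<Longrightarrow> f v = g v"
  shows "avg W n f = avg W n g"
  using assms
proof (induction n arbitrary: f g)
  case (Suc n)
  have "avg W n (\<lambda>v. f (v(n := w))) = avg W n (\<lambda>v. g (v(n := w)))" if "w \<in> W" for w
    by (rule Suc.IH, rule Suc.prems) (use that in auto)
  then show ?case by simp
qed simp

lemma norm_avg_le: "norm (avg W n f) \<le> avg W n (\<lambda>v. norm (f v))"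
proof (induction n arbitrary: f)
  case (Suc n)
  have "norm (\<Sum>w\<in>W. avg W n (\<lambda>v. f (v(n := w)))) \<le> (\<Sum>w\<in>W. avg W n (\<lambda>v. norm (f (v(n := w)))))"
    by (rule order_trans[OF norm_sum sum_mono[OF Suc]])
  then show ?case by (simp add: divide_right_mono)
qed simp

lemma avg_integral:
  fixes f :: "(nat \<Rightarrow> 'w::zero) \<Rightarrow> 'a \<Rightarrow> 'b::{banach, second_countable_topology}"
  assumes "\<And>v. integrable M (f v)"
  shows "integrable M (\<lambda>z. avg W n (\<lambda>v. f v z))"
    and "(\<integral>z. avg W n (\<lambda>v. f v z) \<partial>M) = avg W n (\<lambda>v. \<integral>z. f v z \<partial>M)"
proof -
  have "integrable M (\<lambda>z. avg W n (\<lambda>v. f v z)) \<and>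
      (\<integral>z. avg W n (\<lambda>v. f v z) \<partial>M) = avg W n (\<lambda>v. \<integral>z. f v z \<partial>M)"
    using assms
  proof (induction n arbitrary: f)
    case (Suc n)
    have "integrable M (\<lambda>z. avg W n (\<lambda>v. f (v(n := w)) z))"
      "(\<integral>z. avg W n (\<lambda>v. f (v(n := w)) z) \<partial>M) = avg W n (\<lambda>v. \<integral>z. f (v(n := w)) z \<partial>M)" for w
      using Suc.IH[of "\<lambda>v. f (v(n := w))"] Suc.prems by auto
    then show ?case by (simp add: Bochner_Integration.integral_sum)
  qed simp
  then show "integrable M (\<lambda>z. avg W n (\<lambda>v. f v z))"
    and "(\<integral>z. avg W n (\<lambda>v. f v z) \<partial>M) = avg W n (\<lambda>v. \<integral>z. f v z \<partial>M)" by auto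
qed


section \<open>Riesz products\<close>

text \<open>
  The corners \<open>\<plusminus>1 \<plusminus> \<i>\<close> of a square serve as a finite substitute for independent variables that
  are uniform on a circle: a uniformly distributed corner \<open>w\<close> satisfies \<open>E w = E w\<^sup>2 = 0\<close> and
  \<open>\<bar>w\<bar>\<^sup>2 = 2\<close>, and its real and imaginary parts are independent signs.
\<close>

definition corners :: "complex set"
  where "corners = {Complex 1 1, Complex 1 (-1), Complex (-1) 1, Complex (-1) (-1)}"

lemma finite_corners: "finite corners" "corners \<noteq> {}" "card corners = 4"
  by (simp_all add: corners_def)

lemma sum_corners:
  "(\<Sum>w\<in>corners. f w) = f (Complex 1 1) + f (Complex 1 (-1)) + f (Complex (-1) 1) + f (Complex (-1) (-1))"
  by (simp add: corners_def add.assoc)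

lemma norm_corner: "w \<in> corners \<Longrightarrow> cmod w = sqrt 2"
  by (auto simp: corners_def cmod_def)

text \<open>
  A Riesz product along the frequencies \<open>3\<^sup>k\<close>. As \<open>3\<^sup>n > 2 * (3\<^sup>0 + \<dots> + 3\<^sup>n\<^sup>-\<^sup>1)\<close>, its
  expansion has no coincidences among the frequencies. It is a probability density on the
  circle for every choice of the corners, and its average over the choices is \<open>1\<close>.
\<close>

definition riesz :: "nat \<Rightarrow> (nat \<Rightarrow> complex) \<Rightarrow> complex \<Rightarrow> real"
  where "riesz n v z = (\<Prod>k<n. 1 + Re (v k * z ^ (3 ^ k)) / 2)"

lemma riesz_0: "riesz 0 v z = 1"
  by (simp add: riesz_def)

lemma riesz_Suc: "riesz (Suc n) (v(n := w)) z = riesz n v z * (1 + Re (w * z ^ (3 ^ n)) / 2)"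
  by (simp add: riesz_def)

lemma riesz_nonneg:
  assumes "\<And>k. k < n \<Longrightarrow> v k \<in> corners" and "cmod z = 1"
  shows "0 \<le> riesz n v z"
  unfolding riesz_def
proof (rule prod_nonneg)
  fix k assume "k \<in> {..<n}"
  then have "cmod (v k * z ^ (3 ^ k)) = sqrt 2"
    using assms norm_corner[of "v k"] by (simp add: norm_mult norm_power)
  moreover have "sqrt 2 \<le> 2" by (rule real_le_lsqrt) auto
  ultimately show "0 \<le> 1 + Re (v k * z ^ (3 ^ k)) / 2"
    using abs_Re_le_cmod[of "v k * z ^ (3 ^ k)"] by linarith
qed

lemma avg_riesz: "avg corners n (\<lambda>v. riesz n v z) = 1"
proof (induction n)
  case (Suc n)
  have "avg corners (Suc n) (\<lambda>v. riesz (Suc n) v z) =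
      (1 / 4) * (\<Sum>w\<in>corners. avg corners n (\<lambda>v. riesz n v z * (1 + Re (w * z ^ (3 ^ n)) / 2)))"
    by (simp only: avg.simps riesz_Suc finite_corners real_scaleR_def of_nat_numeral)
  also have "\<dots> = (1 / 4) * (\<Sum>w\<in>corners. (1 + Re (w * z ^ (3 ^ n)) / 2) * avg corners n (\<lambda>v. riesz n v z))"
    by (subst avg_linear[where L="\<lambda>x. _ * x"]) (auto simp: mult.commute intro!: linearI simp: algebra_simps)
  also have "\<dots> = 1" by (simp only: Suc sum_corners) (simp add: field_simps)
  finally show ?case .
qed (simp add: riesz_0)

lemma borel_measurable_riesz [measurable]: "riesz n v \<in> borel_measurable borel"
  unfolding riesz_def by (intro borel_measurable_continuous_onI continuous_intros) auto

lemma riesz_bounded: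
  assumes "cmod z = 1" shows "\<bar>riesz n v z\<bar> \<le> (\<Prod>k<n. 1 + cmod (v k) / 2)"
  unfolding riesz_def abs_prod
proof (rule prod_mono)
  fix k assume "k \<in> {..<n}"
  have "\<bar>Re (v k * z ^ 3 ^ k)\<bar> \<le> cmod (v k)"
    using abs_Re_le_cmod[of "v k * z ^ 3 ^ k"] assms by (simp add: norm_mult norm_power)
  then show "0 \<le> \<bar>1 + Re (v k * z ^ 3 ^ k) / 2\<bar> \<and> \<bar>1 + Re (v k * z ^ 3 ^ k) / 2\<bar> \<le> 1 + cmod (v k) / 2"
    by linarith
qed

lemma integrable_mult_riesz:
  assumes "integrable circle_completion h"
  shows "integrable circle_completion (\<lambda>z. h z * complex_of_real (riesz n v z))"
  by (rule integrable_mult_bounded[OF assms, where B="\<Prod>k<n. 1 + cmod (v k) / 2"])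
    (auto simp: riesz_bounded)

lemma riesz_Suc_complex:
  assumes z: "cmod z = 1"
  shows "complex_of_real (riesz (Suc n) v z) = complex_of_real (riesz n v z)
    + (v n / 4) * (complex_of_real (riesz n v z) * z ^ (3 ^ n))
    + (cnj (v n) / 4) * (complex_of_real (riesz n v z) * cnj z ^ (3 ^ n))"
proof -
  have "complex_of_real (Re (v n * z ^ (3 ^ n))) = (v n * z ^ (3 ^ n) + cnj (v n * z ^ (3 ^ n))) / 2"
    by (subst complex_add_cnj) simp
  then have "complex_of_real (1 + Re (v n * z ^ (3 ^ n)) / 2) =
      1 + (v n / 4) * z ^ (3 ^ n) + (cnj (v n) / 4) * cnj z ^ (3 ^ n)"
    unfolding of_real_add of_real_divide by (simp del: times_complex.sel add: add_divide_distrib)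
  then have "complex_of_real (riesz (Suc n) v z) = complex_of_real (riesz n v z) *
      (1 + (v n / 4) * z ^ (3 ^ n) + (cnj (v n) / 4) * cnj z ^ (3 ^ n))"
    unfolding riesz_def prod.lessThan_Suc of_real_mult by (simp only:)
  then show ?thesis by (simp add: algebra_simps)
qed

lemma integral_riesz_Suc:
  assumes h: "integrable circle_completion h"
  shows "(\<integral>z. h z * complex_of_real (riesz (Suc n) v z) \<partial>circle_completion) =
    (\<integral>z. h z * complex_of_real (riesz n v z) \<partial>circle_completion)
    + (v n / 4) * (\<integral>z. h z * complex_of_real (riesz n v z) * z ^ (3 ^ n) \<partial>circle_completion)
    + (cnj (v n) / 4) * (\<integral>z. h z * complex_of_real (riesz n v z) * cnj z ^ (3 ^ n) \<partial>circle_completion)"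
proof -
  note int = integrable_mult_riesz[OF h, of n v]
  note int1 = integrable_circle_mult_power[OF int, of "3 ^ n"] and int2 = integrable_fourier[OF int, of "3 ^ n"]
  have "(\<integral>z. h z * complex_of_real (riesz (Suc n) v z) \<partial>circle_completion) =
    (\<integral>z. h z * complex_of_real (riesz n v z)
      + (v n / 4) * (h z * complex_of_real (riesz n v z) * z ^ (3 ^ n))
      + (cnj (v n) / 4) * (h z * complex_of_real (riesz n v z) * cnj z ^ (3 ^ n)) \<partial>circle_completion)"
  proof (rule integral_cong_AE)
    show "AE z in circle_completion. h z * complex_of_real (riesz (Suc n) v z) =
      h z * complex_of_real (riesz n v z)
      + (v n / 4) * (h z * complex_of_real (riesz n v z) * z ^ (3 ^ n))
      + (cnj (v n) / 4) * (h z * complex_of_real (riesz n v z) * cnj z ^ (3 ^ n))"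
      using AE_circle_norm by eventually_elim (subst riesz_Suc_complex, auto simp: algebra_simps)
  next
    show "(\<lambda>z. h z * complex_of_real (riesz (Suc n) v z)) \<in> borel_measurable circle_completion"
      using integrable_mult_riesz[OF h, of "Suc n" v] by auto
    show "(\<lambda>z. h z * complex_of_real (riesz n v z)
      + (v n / 4) * (h z * complex_of_real (riesz n v z) * z ^ (3 ^ n))
      + (cnj (v n) / 4) * (h z * complex_of_real (riesz n v z) * cnj z ^ (3 ^ n)))
      \<in> borel_measurable circle_completion"
      using int int1 int2 by (intro borel_measurable_integrable) simp
  qed
  also have "\<dots> = (\<integral>z. h z * complex_of_real (riesz n v z) \<partial>circle_completion)
    + (v n / 4) * (\<integral>z. h z * complex_of_real (riesz n v z) * z ^ (3 ^ n) \<partial>circle_completion)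
    + (cnj (v n) / 4) * (\<integral>z. h z * complex_of_real (riesz n v z) * cnj z ^ (3 ^ n) \<partial>circle_completion)"
    using int int1 int2 by simp
  finally show ?thesis .
qed

text \<open>
  Multiplication by the Riesz product moves the spectrum of an analytic function by at most
  \<open>3\<^sup>0 + \<dots> + 3\<^sup>n\<^sup>-\<^sup>1 = (3\<^sup>n - 1) / 2\<close> to the left.
\<close>

lemma integral_riesz_power:
  assumes h: "integrable circle_completion h"
    and zero: "\<And>j. j > 0 \<Longrightarrow> (\<integral>z. h z * z ^ j \<partial>circle_completion) = 0"
    and j: "3 ^ n < 2 * j"
  shows "(\<integral>z. h z * complex_of_real (riesz n v z) * z ^ j \<partial>circle_completion) = 0"
  using j
proof (induction n arbitrary: j)
  case 0 then show ?case by (simp add: riesz_0 zero)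
next
  case (Suc n)
  have hj: "integrable circle_completion (\<lambda>z. h z * z ^ j)" by (rule integrable_circle_mult_power[OF h])
  have le: "3 ^ n \<le> j" using Suc.prems by simp
  have "(\<integral>z. h z * z ^ j * complex_of_real (riesz n v z) * cnj z ^ (3 ^ n) \<partial>circle_completion) =
      (\<integral>z. h z * complex_of_real (riesz n v z) * z ^ (j - 3 ^ n) \<partial>circle_completion)"
  proof (rule integral_cong_AE)
    show "AE z in circle_completion. h z * z ^ j * complex_of_real (riesz n v z) * cnj z ^ (3 ^ n) =
        h z * complex_of_real (riesz n v z) * z ^ (j - 3 ^ n)"
      using AE_circle_norm
    proof eventually_elim
      case (elim z)
      have "z ^ j = z ^ (j - 3 ^ n) * z ^ (3 ^ n)" using le by (simp flip: power_add)
      then have "h z * z ^ j * complex_of_real (riesz n v z) * cnj z ^ (3 ^ n) =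
        h z * complex_of_real (riesz n v z) * z ^ (j - 3 ^ n) * (cnj z ^ (3 ^ n) * z ^ (3 ^ n))"
        by simp
      then show ?case by (simp add: cnj_power_mult_power[OF elim])
    qed
  qed (use integrable_fourier[OF integrable_mult_riesz[OF hj]]
      integrable_circle_mult_power[OF integrable_mult_riesz[OF h]] in auto)
  also have "\<dots> = 0" using Suc.prems by (intro Suc.IH) simp
  finally have m: "(\<integral>z. h z * z ^ j * complex_of_real (riesz n v z) * cnj z ^ (3 ^ n) \<partial>circle_completion) = 0" .
  have "(\<integral>z. h z * complex_of_real (riesz n v z) * z ^ (j + 3 ^ n) \<partial>circle_completion) = 0"
    using Suc.prems by (intro Suc.IH) simp
  then have p: "(\<integral>z. h z * z ^ j * complex_of_real (riesz n v z) * z ^ (3 ^ n) \<partial>circle_completion) = 0"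
    by (simp add: power_add ac_simps)
  have "(\<integral>z. h z * complex_of_real (riesz n v z) * z ^ j \<partial>circle_completion) = 0"
    using Suc.prems by (intro Suc.IH) simp
  then have "(\<integral>z. h z * z ^ j * complex_of_real (riesz n v z) \<partial>circle_completion) = 0"
    by (simp add: ac_simps)
  with m p integral_riesz_Suc[OF hj, of n v] show ?case by (simp add: ac_simps)
qed

lemma integral_riesz: "(\<integral>z. riesz n v z \<partial>circle_completion) = 1"
proof -
  have int: "integrable circle_completion (\<lambda>z. 1::complex)" by simp
  have z: "(\<integral>z. complex_of_real (riesz n v z) * z ^ (3 ^ n) \<partial>circle_completion) = 0" for n
    using integral_riesz_power[OF int, of n "3 ^ n" v] integral_circle_power by simp
  have "(\<integral>z. complex_of_real (riesz n v z) * cnj z ^ (3 ^ n) \<partial>circle_completion) = 0" for n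
    using Bochner_Integration.integral_cnj[of circle_completion
        "\<lambda>z. complex_of_real (riesz n v z) * z ^ (3 ^ n)"] z[of n] by simp
  then have "(\<integral>z. complex_of_real (riesz n v z) \<partial>circle_completion) = 1"
    using z integral_riesz_Suc[OF int, of _ v]
    by (induction n) (simp_all add: riesz_0 circle.prob_space)
  then show ?thesis by simp
qed


section \<open>Paley's inequality\<close>

lemma cmod_one_plus_ge:
  assumes "cmod u \<le> 1"
  shows "1 + Re u + (Im u)\<^sup>2 / 4 \<le> cmod (1 + u)"
proof -
  have 1: "cmod (1 + u) \<le> 2" using norm_triangle_ineq[of 1 u] assms by simp
  have 2: "1 + Re u \<le> cmod (1 + u)" using complex_Re_le_cmod[of "1 + u"] by simp
  have 3: "0 \<le> 1 + Re u" "1 + Re u \<le> 2" using abs_Re_le_cmod[of u] assms by auto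
  have "(cmod (1 + u) - (1 + Re u)) * (cmod (1 + u) + (1 + Re u)) = (Im u)\<^sup>2"
    using cmod_power2[of "1 + u"] by (simp add: power2_eq_square algebra_simps)
  moreover have "(cmod (1 + u) - (1 + Re u)) * (cmod (1 + u) + (1 + Re u)) \<le> (cmod (1 + u) - (1 + Re u)) * 4"
    using 1 2 3 by (intro mult_left_mono) auto
  ultimately show ?thesis by simp
qed

text \<open>
  Complex uniform convexity of the complex plane: averaging \<open>\<bar>A + w D\<bar>\<close> over the corners gains
  a quadratic term. Averaging over real signs would not, as \<open>A = 1\<close> and small real \<open>D\<close> show.
\<close>

lemma corners_convexity_aux:
  assumes "sqrt 2 * cmod D \<le> cmod A"
  shows "sqrt ((cmod A)\<^sup>2 + (cmod D)\<^sup>2 / 2) \<le> (\<Sum>w\<in>corners. cmod (A + w * D)) / 4"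
proof (cases "A = 0")
  case True
  then have "D = 0" using assms by (simp add: mult_le_0_iff)
  with True show ?thesis by simp
next
  case False
  \<comment> \<open>For \<open>\<bar>w d\<bar> \<le> 1\<close> the pointwise bound applies; its linear term averages to \<open>0\<close>.\<close>
  define d where "d = D / A"
  have d: "sqrt 2 * cmod d \<le> 1" using assms False by (simp add: d_def norm_divide)
  have D: "D = d * A" using False by (simp add: d_def)
  have "1 + Re (w * d) + (Im (w * d))\<^sup>2 / 4 \<le> cmod (1 + w * d)" if "w \<in> corners" for w
    using d norm_corner[OF that] by (intro cmod_one_plus_ge) (simp add: norm_mult)
  then have "(\<Sum>w\<in>corners. 1 + Re (w * d) + (Im (w * d))\<^sup>2 / 4) \<le> (\<Sum>w\<in>corners. cmod (1 + w * d))"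
    by (rule sum_mono)
  moreover have "(\<Sum>w\<in>corners. 1 + Re (w * d) + (Im (w * d))\<^sup>2 / 4) = 4 * (1 + (cmod d)\<^sup>2 / 4)"
    unfolding cmod_power2 by (simp add: sum_corners power2_eq_square field_simps)
  ultimately have *: "1 + (cmod d)\<^sup>2 / 4 \<le> (\<Sum>w\<in>corners. cmod (1 + w * d)) / 4" by simp
  have "sqrt (1 + (cmod d)\<^sup>2 / 2) \<le> 1 + (cmod d)\<^sup>2 / 4"
    by (rule real_le_lsqrt) (auto simp: power2_eq_square algebra_simps)
  with * have **: "sqrt (1 + (cmod d)\<^sup>2 / 2) * cmod A \<le> (\<Sum>w\<in>corners. cmod (1 + w * d)) / 4 * cmod A"
    by (intro mult_right_mono) auto
  have "(cmod A)\<^sup>2 + (cmod D)\<^sup>2 / 2 = (1 + (cmod d)\<^sup>2 / 2) * (cmod A)\<^sup>2"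
    by (simp add: D norm_mult power_mult_distrib algebra_simps)
  then have "sqrt ((cmod A)\<^sup>2 + (cmod D)\<^sup>2 / 2) = sqrt (1 + (cmod d)\<^sup>2 / 2) * cmod A"
    by (simp add: real_sqrt_mult)
  moreover have "cmod (A + w * D) = cmod (1 + w * d) * cmod A" for w
    by (simp add: D algebra_simps flip: norm_mult)
  ultimately show ?thesis using ** by (simp add: sum_distrib_right)
qed

lemma corners_convexity:
  "sqrt ((cmod A)\<^sup>2 + (cmod D)\<^sup>2 / 2) \<le> (\<Sum>w\<in>corners. cmod (A + cnj w * D)) / 4"
proof (cases "sqrt 2 * cmod D \<le> cmod A")
  case True
  have "(\<Sum>w\<in>corners. cmod (A + cnj w * D)) = (\<Sum>w\<in>corners. cmod (A + w * D))"
    by (simp add: sum_corners complex_cnj)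
  then show ?thesis using corners_convexity_aux[OF True] by simp
next
  case False
  \<comment> \<open>Exchange the roles of \<open>A\<close> and \<open>D\<close>.\<close>
  have "cmod (A + cnj w * D) = cmod (sqrt 2 * D + w * (A / sqrt 2))" if "w \<in> corners" for w
  proof -
    have "w * cnj w = 2" using that by (auto simp: corners_def complex_eq_iff)
    then have "complex_of_real (sqrt 2) * (sqrt 2 * D + w * (A / sqrt 2)) = w * (A + cnj w * D)"
      by (simp add: algebra_simps flip: of_real_mult) 
    then have "sqrt 2 * cmod (sqrt 2 * D + w * (A / sqrt 2)) = sqrt 2 * cmod (A + cnj w * D)"
      by (metis norm_corner[OF that] norm_mult norm_of_real abs_of_nonneg real_sqrt_ge_zero zero_le_numeral)
    then show ?thesis by simp
  qed
  then have "(\<Sum>w\<in>corners. cmod (A + cnj w * D)) / 4 =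
      (\<Sum>w\<in>corners. cmod (sqrt 2 * D + w * (A / sqrt 2))) / 4" by simp
  also have "\<dots> \<ge> sqrt ((cmod (sqrt 2 * D))\<^sup>2 + (cmod (A / sqrt 2))\<^sup>2 / 2)"
    using False by (intro corners_convexity_aux) (simp add: norm_mult norm_divide)
  also have "(cmod (sqrt 2 * D))\<^sup>2 + (cmod (A / sqrt 2))\<^sup>2 / 2 = 2 * (cmod D)\<^sup>2 + (cmod A)\<^sup>2 / 4"
    by (simp add: norm_mult norm_divide power_mult_distrib power_divide)
  also have "sqrt ((cmod A)\<^sup>2 + (cmod D)\<^sup>2 / 2) \<le> sqrt (2 * (cmod D)\<^sup>2 + (cmod A)\<^sup>2 / 4)"
  proof -
    have "(cmod A)\<^sup>2 \<le> (sqrt 2 * cmod D)\<^sup>2" using False by (intro power_mono) auto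
    then show ?thesis by (simp add: power_mult_distrib)
  qed
  finally show ?thesis by simp
qed

text \<open>
  The convexity inequality integrated over the preceding letters. The left-hand side is the
  squared norm of the average of the planar vectors \<open>(\<bar>A v\<bar>, \<bar>B v\<bar> / sqrt 32)\<close>, or smaller, so
  that the triangle inequality applies.
\<close>

lemma paley_step:
  fixes A B :: "(nat \<Rightarrow> complex) \<Rightarrow> complex"
  shows "(avg corners n (\<lambda>v. cmod (A v)))\<^sup>2 + (cmod (avg corners n B))\<^sup>2 / 32 \<le>
    ((1 / 4) * (\<Sum>w\<in>corners. avg corners n (\<lambda>v. cmod (A v + cnj w * (B v / 4)))))\<^sup>2"
proof -
  let ?g = "\<lambda>v. Complex (cmod (A v)) (cmod (B v) / sqrt 32)"
  have linR: "linear Re" and linI: "linear Im"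
    by (auto intro: bounded_linear.linear bounded_linear_Re bounded_linear_Im)
  have "Re (avg corners n ?g) = avg corners n (\<lambda>v. cmod (A v))"
    by (simp add: avg_linear[OF linR])
  moreover have "Im (avg corners n ?g) = avg corners n (\<lambda>v. cmod (B v)) / sqrt 32"
    by (simp add: avg_linear[OF linI])
      (subst avg_linear[where L="\<lambda>x. x / sqrt 32"], auto intro!: linearI simp: add_divide_distrib)
  ultimately have "(cmod (avg corners n ?g))\<^sup>2 =
      (avg corners n (\<lambda>v. cmod (A v)))\<^sup>2 + (avg corners n (\<lambda>v. cmod (B v)))\<^sup>2 / 32"
    by (simp add: cmod_power2 power_divide)
  moreover have "(cmod (avg corners n B))\<^sup>2 \<le> (avg corners n (\<lambda>v. cmod (B v)))\<^sup>2"
    by (intro power_mono norm_avg_le) auto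
  ultimately have 1: "(avg corners n (\<lambda>v. cmod (A v)))\<^sup>2 + (cmod (avg corners n B))\<^sup>2 / 32 \<le>
      (cmod (avg corners n ?g))\<^sup>2" by simp
  have "cmod (avg corners n ?g) \<le> avg corners n (\<lambda>v. cmod (?g v))" by (rule norm_avg_le)
  also have "\<dots> \<le> avg corners n (\<lambda>v. (1 / 4) * (\<Sum>w\<in>corners. cmod (A v + cnj w * (B v / 4))))"
  proof (rule avg_mono)
    fix v
    have "cmod (?g v) = sqrt ((cmod (A v))\<^sup>2 + (cmod (B v / 4))\<^sup>2 / 2)"
      by (simp add: cmod_def power_divide)
    also have "\<dots> \<le> (\<Sum>w\<in>corners. cmod (A v + cnj w * (B v / 4))) / 4" by (rule corners_convexity)
    finally show "cmod (?g v) \<le> (1 / 4) * (\<Sum>w\<in>corners. cmod (A v + cnj w * (B v / 4)))" by simp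
  qed
  also have "\<dots> = (1 / 4) * (\<Sum>w\<in>corners. avg corners n (\<lambda>v. cmod (A v + cnj w * (B v / 4))))"
    by (subst avg_linear[where L="\<lambda>x. (1 / 4) * x", symmetric])
      (auto intro!: linearI simp: algebra_simps avg_sum)
  finally have "(cmod (avg corners n ?g))\<^sup>2 \<le>
      ((1 / 4) * (\<Sum>w\<in>corners. avg corners n (\<lambda>v. cmod (A v + cnj w * (B v / 4)))))\<^sup>2"
    by (intro power_mono) auto
  with 1 show ?thesis by simp
qed

text \<open>
  Paley's inequality for functions in the Hardy space. The averages of \<open>\<bar>\<integral> h * riesz n v\<bar>\<close>
  over \<open>v\<close> are at most the norm of \<open>h\<close>. When \<open>n\<close> increases by one, analyticity of \<open>h\<close> makes
  the integral change from \<open>A\<close> to \<open>A + cnj w * B / 4\<close> without a term in \<open>w\<close>, where the average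
  of \<open>B\<close> is the coefficient of \<open>h\<close> at \<open>3\<^sup>n\<close>; by convexity, the square of the average increases
  by at least a fixed multiple of the square of this coefficient.
\<close>

theorem Paley_inequality:
  assumes h: "integrable circle_completion h"
    and zero: "\<And>j. j > 0 \<Longrightarrow> (\<integral>z. h z * z ^ j \<partial>circle_completion) = 0"
  shows "(\<Sum>k<n. (cmod (fourier_coeff (3 ^ k) h))\<^sup>2) \<le> 32 * (\<integral>z. cmod (h z) \<partial>circle_completion)\<^sup>2"
proof -
  define a where "a n v = (\<integral>z. h z * complex_of_real (riesz n v z) \<partial>circle_completion)" for n v
  define b where "b n v = (\<integral>z. h z * complex_of_real (riesz n v z) * cnj z ^ (3 ^ n) \<partial>circle_completion)" for n v
  have indep: "riesz n (v(n := w)) z = riesz n v z" for n v w z by (simp add: riesz_def)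
  have a_Suc: "a (Suc n) (v(n := w)) = a n v + cnj w * (b n v / 4)" for n v w
    using integral_riesz_Suc[OF h, of n "v(n := w)"] integral_riesz_power[OF h zero, of n "3 ^ n" v]
    by (simp add: a_def b_def indep)
  have avg_of_real: "avg corners n (\<lambda>v. x * complex_of_real (riesz n v z)) = x" for n x z
    using avg_linear[where L="\<lambda>r. x * complex_of_real r" and W=corners and n=n and f="\<lambda>v. riesz n v z"]
    by (simp add: avg_riesz linear_iff algebra_simps scaleR_conv_of_real)
  have avg_b: "avg corners n (b n) = fourier_coeff (3 ^ n) h" for n
  proof -
    have "avg corners n (b n) =
        (\<integral>z. avg corners n (\<lambda>v. (h z * cnj z ^ (3 ^ n)) * complex_of_real (riesz n v z)) \<partial>circle_completion)"
      unfolding b_def using integrable_mult_riesz[OF integrable_fourier[OF h, of "3 ^ n"], of n]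
      by (subst avg_integral) (auto simp: mult.assoc mult.commute[of "cnj _ ^ _"])
    then show ?thesis unfolding avg_of_real fourier_coeff_def .
  qed
  have "(1 / 32) * (\<Sum>k<n. (cmod (fourier_coeff (3 ^ k) h))\<^sup>2) \<le> (avg corners n (\<lambda>v. cmod (a n v)))\<^sup>2"
  proof (induction n)
    case (Suc n)
    have "(1 / 32) * (\<Sum>k<Suc n. (cmod (fourier_coeff (3 ^ k) h))\<^sup>2) \<le>
        (avg corners n (\<lambda>v. cmod (a n v)))\<^sup>2 + (cmod (avg corners n (b n)))\<^sup>2 / 32"
      using Suc by (simp add: avg_b algebra_simps)
    also have "\<dots> \<le> ((1 / 4) * (\<Sum>w\<in>corners. avg corners n (\<lambda>v. cmod (a n v + cnj w * (b n v / 4)))))\<^sup>2"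
      by (rule paley_step)
    also have "\<dots> = (avg corners (Suc n) (\<lambda>v. cmod (a (Suc n) v)))\<^sup>2"
      by (simp add: a_Suc finite_corners)
    finally show ?case .
  qed simp
  also have "(avg corners n (\<lambda>v. cmod (a n v)))\<^sup>2 \<le> (\<integral>z. cmod (h z) \<partial>circle_completion)\<^sup>2"
  proof (rule power_mono)
    have hn: "integrable circle_completion (\<lambda>z. complex_of_real (cmod (h z)))" using h by simp
    have int: "integrable circle_completion (\<lambda>z. cmod (h z) * riesz n v z)" for v
      using integrable_mult_riesz[OF hn, of n v]
      by (simp only: of_real_mult[symmetric] complex_of_real_integrable_eq)
    have "avg corners n (\<lambda>v. cmod (a n v)) \<le>
        avg corners n (\<lambda>v. \<integral>z. cmod (h z) * riesz n v z \<partial>circle_completion)"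
    proof (rule avg_mono)
      fix v assume v: "\<And>k. k < n \<Longrightarrow> v k \<in> corners"
      have "cmod (a n v) \<le> (\<integral>z. cmod (h z * complex_of_real (riesz n v z)) \<partial>circle_completion)"
        unfolding a_def by (rule integral_norm_bound)
      also have "\<dots> = (\<integral>z. cmod (h z) * riesz n v z \<partial>circle_completion)"
      proof (rule integral_cong_AE)
        show "AE z in circle_completion. cmod (h z * complex_of_real (riesz n v z)) = cmod (h z) * riesz n v z"
          using AE_circle_norm by eventually_elim (use v in \<open>simp add: norm_mult riesz_nonneg\<close>)
      qed (use int[of v] integrable_mult_riesz[OF h, of n v] in auto)
      finally show "cmod (a n v) \<le> (\<integral>z. cmod (h z) * riesz n v z \<partial>circle_completion)" .
    qed
    also have "\<dots> = (\<integral>z. avg corners n (\<lambda>v. cmod (h z) * riesz n v z) \<partial>circle_completion)"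
      by (rule avg_integral(2)[symmetric]) (rule int)
    also have "(\<lambda>z. avg corners n (\<lambda>v. cmod (h z) * riesz n v z)) = (\<lambda>z. cmod (h z))"
    proof
      fix z
      show "avg corners n (\<lambda>v. cmod (h z) * riesz n v z) = cmod (h z)"
        using avg_linear[where L="\<lambda>r. cmod (h z) * r" and W=corners and n=n and f="\<lambda>v. riesz n v z"]
        by (simp add: avg_riesz linear_iff algebra_simps)
    qed
    finally show "avg corners n (\<lambda>v. cmod (a n v)) \<le> (\<integral>z. cmod (h z) \<partial>circle_completion)" .
    have "avg corners n (\<lambda>v. 0 :: real) \<le> avg corners n (\<lambda>v. cmod (a n v))" by (rule avg_mono) simp
    then show "0 \<le> avg corners n (\<lambda>v. cmod (a n v))" by (simp add: avg_const finite_corners)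
  qed
  finally show ?thesis by simp
qed


section \<open>Averages over signs\<close>

interpretation sign: product_prob_space "\<lambda>_::nat. uniform_count_measure {1, -1::real}" UNIV
  by (intro product_prob_spaceI prob_space_uniform_count_measure) auto

lemma space_sign_measure: "space sign_measure = {\<omega>. \<forall>k. \<omega> k = 1 \<or> \<omega> k = -1}"
  by (auto simp: sign_measure_def space_PiM PiE_def Pi_def space_uniform_count_measure)

text \<open>
  The sign sequences that agree with \<open>t\<close> at the positions from \<open>n\<close> to \<open>m - 1\<close>.
\<close>

definition cylinder :: "(nat \<Rightarrow> real) \<Rightarrow> nat \<Rightarrow> nat \<Rightarrow> (nat \<Rightarrow> real) set"
  where "cylinder t n m = {\<omega> \<in> space sign_measure. \<forall>k\<in>{n..<m}. \<omega> k \<in> {t k}}"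

lemma measure_cylinder:
  assumes "\<And>k. t k \<in> {1, -1}"
  shows "cylinder t n m \<in> sets sign_measure" "measure sign_measure (cylinder t n m) = (1 / 2) ^ (m - n)"
proof -
  have X: "{t k} \<in> sets (uniform_count_measure {1, -1})" for k
    using assms[of k] by (auto simp: sets_uniform_count_measure)
  have "{t k} \<subseteq> {1, -1}" for k using assms[of k] by auto
  then have m: "emeasure (uniform_count_measure {1, -1::real}) {t k} = ennreal (1 / 2)" for k
    by (subst emeasure_uniform_count_measure) auto
  have "emeasure sign_measure (cylinder t n m) =
      (\<Prod>i\<in>{n..<m}. emeasure (uniform_count_measure {1, -1}) {t i})"
    unfolding cylinder_def sign_measure_def
    by (rule sign.emeasure_PiM_Collect) (auto intro: X)
  also have "\<dots> = ennreal ((1 / 2) ^ (m - n))"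
    unfolding m prod_constant by (subst ennreal_power) auto
  finally show "measure sign_measure (cylinder t n m) = (1 / 2) ^ (m - n)"
    by (simp add: measure_def)
  show "cylinder t n m \<in> sets sign_measure"
    unfolding cylinder_def sign_measure_def
    by (rule sets.sets_Collect_finite_All) (auto intro!: sets_Collect_single' simp: sets_uniform_count_measure)
qed

text \<open>
  The cylinder over the positions from \<open>n\<close> on keeps track of the letters already split off in
  the induction.
\<close>

lemma integral_sign_cylinder:
  fixes f :: "(nat \<Rightarrow> real) \<Rightarrow> real"
  assumes "\<And>v v'. (\<And>k. k < n \<Longrightarrow> v k = v' k) \<Longrightarrow> f v = f v'"
    and "\<And>k. t k \<in> {1, -1}" and "n \<le> m"
  shows "integrable sign_measure (\<lambda>v. f v * indicator (cylinder t n m) v) \<and>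
    (\<integral>v. f v * indicator (cylinder t n m) v \<partial>sign_measure) = avg {1, -1} n f / 2 ^ (m - n)"
  using assms
proof (induction n arbitrary: f t)
  case 0
  have "f v = f (\<lambda>_. 0)" for v by (rule 0) auto
  then have eq: "f v * indicator (cylinder t 0 m) v = f (\<lambda>_. 0) * indicator (cylinder t 0 m) v" for v
    by metis
  interpret prob_space sign_measure unfolding sign_measure_def by (rule sign.P.prob_space_axioms)
  show ?case
    unfolding eq using measure_cylinder[of t 0 m, OF 0(2)]
    by (auto simp: power_divide less_top[symmetric] intro!: integrable_real_indicator)
next
  case (Suc n)
  let ?g = "\<lambda>s v. f (v(n := s)) * indicator (cylinder (t(n := s)) n m) v"
  have g: "integrable sign_measure (?g s) \<and>
    (\<integral>v. ?g s v \<partial>sign_measure) = avg {1, -1} n (\<lambda>v. f (v(n := s))) / 2 ^ (m - n)" if "s \<in> {1, -1}" for s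
  proof (rule Suc.IH)
    show "f (v(n := s)) = f (v'(n := s))" if "\<And>k. k < n \<Longrightarrow> v k = v' k" for v v'
      using that by (intro Suc.prems) (auto simp: less_Suc_eq)
  qed (use Suc.prems that in auto)
  have eq: "f v * indicator (cylinder t (Suc n) m) v = ?g 1 v + ?g (-1) v" if "v \<in> space sign_measure" for v
  proof -
    have "v n = 1 \<or> v n = -1" using that by (simp add: space_sign_measure)
    moreover have "indicator (cylinder (t(n := s)) n m) v =
        (if v n = s then indicator (cylinder t (Suc n) m) v else 0 :: real)" for s
    proof -
      have "{n..<m} = insert n {Suc n..<m}" using Suc.prems by auto
      then show ?thesis by (auto simp: cylinder_def indicator_def)
    qed
    moreover have "v(n := v n) = v" by simp
    ultimately show ?thesis by (auto simp del: fun_upd_triv)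
  qed
  have "integrable sign_measure (\<lambda>v. f v * indicator (cylinder t (Suc n) m) v) \<longleftrightarrow>
      integrable sign_measure (\<lambda>v. ?g 1 v + ?g (-1) v)"
    by (rule Bochner_Integration.integrable_cong[OF refl eq])
  moreover have "(\<integral>v. f v * indicator (cylinder t (Suc n) m) v \<partial>sign_measure) =
      (\<integral>v. ?g 1 v + ?g (-1) v \<partial>sign_measure)"
    by (rule Bochner_Integration.integral_cong[OF refl eq])
  moreover have "m - n = Suc (m - Suc n)" using Suc.prems by simp
  ultimately show ?case using g by (simp add: field_simps)
qed

lemma integral_sign_measure:
  fixes f :: "(nat \<Rightarrow> real) \<Rightarrow> real"
  assumes "\<And>v v'. (\<And>k. k < n \<Longrightarrow> v k = v' k) \<Longrightarrow> f v = f v'"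
  shows "(\<integral>v. f v \<partial>sign_measure) = avg {1, -1} n f"
proof -
  have "(\<integral>v. f v \<partial>sign_measure) = (\<integral>v. f v * indicator (cylinder (\<lambda>_. 1) n n) v \<partial>sign_measure)"
    by (rule Bochner_Integration.integral_cong) (auto simp: cylinder_def)
  also have "\<dots> = avg {1, -1} n f"
    using integral_sign_cylinder[of n f "\<lambda>_. 1" n, OF assms] by simp
  finally show ?thesis .
qed

lemma avg_square_le:
  fixes f :: "_ \<Rightarrow> real"
  assumes W: "finite W" "W \<noteq> {}"
  shows "(avg W n f)\<^sup>2 \<le> avg W n (\<lambda>v. (f v)\<^sup>2)"
proof -
  let ?m = "avg W n f"
  have "0 = avg W n (\<lambda>_. 0 :: real)" using W by (simp add: avg_const)
  also have "\<dots> \<le> avg W n (\<lambda>v. (f v - ?m)\<^sup>2)" by (rule avg_mono) simp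
  also have "(\<lambda>v. (f v - ?m)\<^sup>2) = (\<lambda>v. (f v)\<^sup>2 + ((- 2 * ?m) * f v + ?m\<^sup>2))"
    by (simp add: power2_eq_square algebra_simps)
  also have "avg W n \<dots> = avg W n (\<lambda>v. (f v)\<^sup>2) + ((- 2 * ?m) * ?m + ?m\<^sup>2)"
    unfolding avg_add using W avg_linear[where L="\<lambda>x. (- 2 * ?m) * x" and f=f]
    by (simp add: avg_const linear_iff algebra_simps)
  finally show ?thesis by (simp add: power2_eq_square)
qed

lemma avg_corners_component:
  fixes g :: "(nat \<Rightarrow> real) \<Rightarrow> 'v::real_vector"
  shows "avg corners n (\<lambda>v. g (\<lambda>k. Re (v k))) = avg {1, -1} n g"
    and "avg corners n (\<lambda>v. g (\<lambda>k. Im (v k))) = avg {1, -1} n g"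
proof -
  have upd: "(\<lambda>k. Re ((v(n := w)) k)) = (\<lambda>k. Re (v k))(n := Re w)"
    "(\<lambda>k. Im ((v(n := w)) k)) = (\<lambda>k. Im (v k))(n := Im w)" for v n w by auto
  have half: "(1 / 4) *\<^sub>R (x + x + (y + y)) = (1 / 2) *\<^sub>R (x + y)" for x y :: 'v
    by (simp add: scaleR_2[symmetric] flip: scaleR_add_right)
  show "avg corners n (\<lambda>v. g (\<lambda>k. Re (v k))) = avg {1, -1} n g"
  proof (induction n arbitrary: g)
    case (Suc n)
    show ?case
      unfolding avg.simps upd Suc[of "\<lambda>v. g (v(n := _))"] sum_corners
      using half by (simp add: finite_corners add.assoc)
  qed simp
  show "avg corners n (\<lambda>v. g (\<lambda>k. Im (v k))) = avg {1, -1} n g"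
  proof (induction n arbitrary: g)
    case (Suc n)
    show ?case
      unfolding avg.simps upd Suc[of "\<lambda>v. g (v(n := _))"] sum_corners
      using half by (simp add: finite_corners ac_simps)
  qed simp
qed


section \<open>Lacunary sums\<close>

lemma scaleC_zero_left [simp]: "0 *\<^sub>C x = 0"
  using scaleC_add_left[of 0 0 x] by simp

lemma scaleC_one [simp]: "1 *\<^sub>C x = x"
  using scaleR_scaleC[of 1 x] by simp

lemma scaleC_zero_right [simp]: "c *\<^sub>C 0 = 0"
  using scaleC_add_right[of c 0 0] by simp

lemma scaleC_sum_left: "(\<Sum>i\<in>I. c i) *\<^sub>C x = (\<Sum>i\<in>I. c i *\<^sub>C x)"
  by (induction I rule: infinite_finite_induct) (simp_all add: scaleC_add_left)

lemma scaleC_sum_right: "c *\<^sub>C (\<Sum>i\<in>I. x i) = (\<Sum>i\<in>I. c *\<^sub>C x i)"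
  by (induction I rule: infinite_finite_induct) (simp_all add: scaleC_add_right)

lemma avg_scaleR: "avg W n (\<lambda>v. r *\<^sub>R f v) = r *\<^sub>R avg W n f"
  by (rule avg_linear[symmetric]) (simp add: linear_iff algebra_simps)

lemma avg_scaleR_left: "avg W n (\<lambda>v. f v *\<^sub>R y) = avg W n f *\<^sub>R y"
  by (rule avg_linear[where L="\<lambda>r. r *\<^sub>R y", symmetric]) (simp add: linear_iff algebra_simps)

text \<open>
  Integrating out the corners recovers the lacunary sum, since \<open>cnj (v k)\<close> has mean \<open>z\<^sup>m / 2\<close>,
  with \<open>m = 3\<^sup>k\<close>, under the weight \<open>riesz n v z\<close>.
\<close>

lemma lacunary_sum_eq_avg:
  fixes x :: "nat \<Rightarrow> 'x::complex_banach"
  shows "(\<Sum>k<n. z ^ (3 ^ k) *\<^sub>C x k) = 2 *\<^sub>R avg corners n (\<lambda>v. riesz n v z *\<^sub>R (\<Sum>k<n. cnj (v k) *\<^sub>C x k))"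
proof (induction n)
  case (Suc n)
  let ?c = "z ^ (3 ^ n)"
  let ?V = "\<lambda>v. \<Sum>k<n. cnj (v k) *\<^sub>C x k"
  have sum1: "(\<Sum>w\<in>corners. 1 + Re (w * ?c) / 2) = 4"
    by (simp add: sum_corners field_simps)
  have sum2: "(\<Sum>w\<in>corners. complex_of_real (1 + Re (w * ?c) / 2) * cnj w) = 2 * ?c"
    by (simp add: sum_corners complex_eq_iff field_simps)
  have f: "riesz (Suc n) (v(n := w)) z *\<^sub>R (\<Sum>k<Suc n. cnj ((v(n := w)) k) *\<^sub>C x k) =
      riesz n v z *\<^sub>R ((1 + Re (w * ?c) / 2) *\<^sub>R ?V v + (complex_of_real (1 + Re (w * ?c) / 2) * cnj w) *\<^sub>C x n)" for v w
    by (simp only: riesz_Suc) (simp add: scaleR_scaleC scaleC_scaleC scaleC_add_right mult.assoc)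
  have "avg corners (Suc n) (\<lambda>v. riesz (Suc n) v z *\<^sub>R (\<Sum>k<Suc n. cnj (v k) *\<^sub>C x k)) =
      (1 / 4) *\<^sub>R avg corners n (\<lambda>v. \<Sum>w\<in>corners. riesz n v z *\<^sub>R
        ((1 + Re (w * ?c) / 2) *\<^sub>R ?V v + (complex_of_real (1 + Re (w * ?c) / 2) * cnj w) *\<^sub>C x n))"
    unfolding avg.simps f by (simp add: finite_corners avg_sum)
  also have "(\<lambda>v. \<Sum>w\<in>corners. riesz n v z *\<^sub>R
        ((1 + Re (w * ?c) / 2) *\<^sub>R ?V v + (complex_of_real (1 + Re (w * ?c) / 2) * cnj w) *\<^sub>C x n)) =
      (\<lambda>v. 4 *\<^sub>R (riesz n v z *\<^sub>R ?V v) + riesz n v z *\<^sub>R ((2 * ?c) *\<^sub>C x n))"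
    unfolding scaleR_sum_right[symmetric] sum.distrib scaleR_sum_left[symmetric]
      scaleC_sum_left[symmetric]
    by (simp only: sum1[unfolded sum.distrib] sum2 scaleR_add_right scaleR_scaleR mult.commute[of _ "4::real"])
  also have "avg corners n \<dots> = 4 *\<^sub>R avg corners n (\<lambda>v. riesz n v z *\<^sub>R ?V v) +
      avg corners n (\<lambda>v. riesz n v z) *\<^sub>R ((2 * ?c) *\<^sub>C x n)"
    by (simp only: avg_add avg_scaleR avg_scaleR_left)
  also have "(2 * ?c) *\<^sub>C x n = 2 *\<^sub>R (?c *\<^sub>C x n)" by (simp add: scaleR_scaleC scaleC_scaleC)
  finally show ?case using Suc by (simp add: avg_riesz scaleR_add_right)
qed simp

text \<open>
  Lacunary sums behave like Rademacher sums: since every Riesz product is a probability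
  density, the preceding identity bounds the norm of the lacunary sum by a mean of the norms
  of sums with random corners, which split into two Rademacher sums.
\<close>

lemma L1_norm_lacunary_le:
  fixes x :: "nat \<Rightarrow> 'x::complex_banach"
  shows "L1_norm (\<lambda>z. \<Sum>k<n. z ^ (3 ^ k) *\<^sub>C x k) \<le>
    ennreal (4 * sqrt (\<integral>\<epsilon>. (norm (\<Sum>k<n. \<epsilon> k *\<^sub>R x k))\<^sup>2 \<partial>sign_measure))"
proof -
  let ?V = "\<lambda>v. norm (\<Sum>k<n. cnj (v k) *\<^sub>C x k)"
  let ?S = "\<lambda>\<epsilon>. norm (\<Sum>k<n. \<epsilon> k *\<^sub>R x k)"
  have int: "integrable circle_completion (\<lambda>z. riesz n v z * ?V v)" for v
  proof -
    have "integrable circle_completion (\<lambda>z. 1 * complex_of_real (riesz n v z))"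
      by (rule integrable_mult_riesz) simp
    then show ?thesis by (simp add: complex_of_real_integrable_eq)
  qed
  have pt: "norm (\<Sum>k<n. z ^ (3 ^ k) *\<^sub>C x k) \<le> 2 * avg corners n (\<lambda>v. riesz n v z * ?V v)"
    if z: "cmod z = 1" for z
  proof -
    have "norm (\<Sum>k<n. z ^ (3 ^ k) *\<^sub>C x k) =
        2 * norm (avg corners n (\<lambda>v. riesz n v z *\<^sub>R (\<Sum>k<n. cnj (v k) *\<^sub>C x k)))"
      unfolding lacunary_sum_eq_avg by simp
    also have "\<dots> \<le> 2 * avg corners n (\<lambda>v. norm (riesz n v z *\<^sub>R (\<Sum>k<n. cnj (v k) *\<^sub>C x k)))"
      by (intro mult_left_mono norm_avg_le) auto
    also have "avg corners n (\<lambda>v. norm (riesz n v z *\<^sub>R (\<Sum>k<n. cnj (v k) *\<^sub>C x k))) =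
        avg corners n (\<lambda>v. riesz n v z * ?V v)"
      by (rule avg_cong) (use z in \<open>simp add: riesz_nonneg\<close>)
    finally show ?thesis .
  qed
  have "L1_norm (\<lambda>z. \<Sum>k<n. z ^ (3 ^ k) *\<^sub>C x k) \<le>
      (\<integral>\<^sup>+z. ennreal (2 * avg corners n (\<lambda>v. riesz n v z * ?V v)) \<partial>circle_completion)"
    unfolding L1_norm_completion
  proof (rule nn_integral_mono_AE)
    show "AE z in circle_completion. ennreal (norm (\<Sum>k<n. z ^ (3 ^ k) *\<^sub>C x k))
        \<le> ennreal (2 * avg corners n (\<lambda>v. riesz n v z * ?V v))"
      using AE_circle_norm by eventually_elim (intro ennreal_leI pt)
  qed
  also have "\<dots> = ennreal (\<integral>z. 2 * avg corners n (\<lambda>v. riesz n v z * ?V v) \<partial>circle_completion)"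
  proof (rule nn_integral_eq_integral)
    show "integrable circle_completion (\<lambda>z. 2 * avg corners n (\<lambda>v. riesz n v z * ?V v))"
      using avg_integral(1)[OF int] by simp
    show "AE z in circle_completion. 0 \<le> 2 * avg corners n (\<lambda>v. riesz n v z * ?V v)"
      using AE_circle_norm by eventually_elim (rule order_trans[OF norm_ge_zero pt])
  qed
  also have "(\<integral>z. 2 * avg corners n (\<lambda>v. riesz n v z * ?V v) \<partial>circle_completion) = 2 * avg corners n ?V"
    by (simp add: avg_integral(2)[OF int] integral_riesz)
  also have "avg corners n ?V \<le> avg corners n (\<lambda>v. ?S (\<lambda>k. Re (v k)) + ?S (\<lambda>k. Im (v k)))"
  proof (rule avg_mono)
    fix v :: "nat \<Rightarrow> complex"
    have "cnj w *\<^sub>C y = Re w *\<^sub>R y - \<i> *\<^sub>C (Im w *\<^sub>R y)" for w and y :: 'x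
    proof -
      have "cnj w = complex_of_real (Re w) + \<i> * complex_of_real (- Im w)" by (simp add: complex_eq_iff)
      then have "cnj w *\<^sub>C y = Re w *\<^sub>R y + \<i> *\<^sub>C ((- Im w) *\<^sub>R y)"
        by (simp only: scaleC_add_left scaleR_scaleC scaleC_scaleC)
      then show ?thesis using scaleC_add_right[of \<i> "Im w *\<^sub>R y" "- Im w *\<^sub>R y"]
        by (simp add: eq_neg_iff_add_eq_0 add.commute)
    qed
    then have "(\<Sum>k<n. cnj (v k) *\<^sub>C x k) = (\<Sum>k<n. Re (v k) *\<^sub>R x k) - \<i> *\<^sub>C (\<Sum>k<n. Im (v k) *\<^sub>R x k)"
      by (simp add: sum_subtractf scaleC_sum_right)
    then have "?V v \<le> norm (\<Sum>k<n. Re (v k) *\<^sub>R x k) + norm (\<i> *\<^sub>C (\<Sum>k<n. Im (v k) *\<^sub>R x k))"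
      by (simp add: norm_triangle_ineq4)
    then show "?V v \<le> ?S (\<lambda>k. Re (v k)) + ?S (\<lambda>k. Im (v k))" by (simp add: norm_scaleC)
  qed
  also have "\<dots> = 2 * avg {1, -1} n ?S"
    unfolding avg_add avg_corners_component[where g="?S"] by simp
  also have "avg {1, -1} n ?S \<le> sqrt (avg {1, -1} n (\<lambda>\<epsilon>. (?S \<epsilon>)\<^sup>2))"
    by (rule real_le_rsqrt) (rule avg_square_le, auto)
  also have "avg {1, -1} n (\<lambda>\<epsilon>. (?S \<epsilon>)\<^sup>2) = (\<integral>\<epsilon>. (?S \<epsilon>)\<^sup>2 \<partial>sign_measure)"
    by (rule integral_sign_measure[symmetric]) simp
  finally show ?thesis by (simp add: ennreal_leI mult.assoc)
qed


section \<open>Bounded polynomials with prescribed lacunary coefficients\<close>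

text \<open>
  Fournier's recursion, written with polynomials: the pair \<open>(g, h)\<close> has its squared Euclidean
  norm multiplied by \<open>1 + \<bar>a k\<bar>\<^sup>2\<close> at each point of the circle, while \<open>g\<close> gains the term
  \<open>a k * z\<^sup>m\<close>, with \<open>m = 3\<^sup>k\<close>, and further terms at frequencies strictly between \<open>3\<^sup>k\<^sup>-\<^sup>1\<close> and
  \<open>3\<^sup>k\<close>. Both polynomials have degree at most \<open>3\<^sup>k\<^sup>-\<^sup>1\<close> at stage \<open>k\<close>; the quotient
  \<open>3 ^ k div 3\<close> is \<open>0\<close> for \<open>k = 0\<close>.
\<close>

primrec fournier :: "(nat \<Rightarrow> complex) \<Rightarrow> nat \<Rightarrow> complex poly \<times> complex poly" where
  "fournier a 0 = (0, 1)"
| "fournier a (Suc k) =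
    (let (g, h) = fournier a k; h' = monom 1 (3 ^ k - 3 ^ k div 3) * h
     in (g + smult (a k) h', h' - smult (cnj (a k)) g))"

lemma fournier_norm:
  assumes z: "cmod z = 1"
  shows "(cmod (poly (fst (fournier a n)) z))\<^sup>2 + (cmod (poly (snd (fournier a n)) z))\<^sup>2 =
    (\<Prod>k<n. 1 + (cmod (a k))\<^sup>2)"
proof (induction n)
  case (Suc n)
  obtain g h where gh: "fournier a n = (g, h)" by fastforce
  define u where "u = poly g z"
  define w where "w = z ^ (3 ^ n - 3 ^ n div 3) * poly h z"
  have w: "cmod w = cmod (poly h z)" using z by (simp add: w_def norm_mult norm_power)
  have "(cmod (u + a n * w))\<^sup>2 + (cmod (w - cnj (a n) * u))\<^sup>2 = (1 + (cmod (a n))\<^sup>2) * ((cmod u)\<^sup>2 + (cmod w)\<^sup>2)"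
    unfolding cmod_power2 by (simp add: power2_eq_square algebra_simps)
  also have "(cmod u)\<^sup>2 + (cmod w)\<^sup>2 = (\<Prod>k<n. 1 + (cmod (a k))\<^sup>2)"
    using Suc w by (simp add: gh u_def)
  finally show ?case by (simp add: gh Let_def u_def w_def poly_monom mult.commute)
qed simp

lemma fournier_coeff:
  "(\<forall>i > 3 ^ n div 3. coeff (fst (fournier a n)) i = 0) \<and>
   (\<forall>i > 3 ^ n div 3. coeff (snd (fournier a n)) i = 0) \<and>
   coeff (snd (fournier a n)) (3 ^ n div 3) = 1 \<and>
   (\<forall>j<n. coeff (fst (fournier a n)) (3 ^ j) = a j)"
proof (induction n)
  case (Suc n)
  obtain g h where gh: "fournier a n = (g, h)" by fastforce
  define N where "N = (3::nat) ^ n div 3"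
  have N: "2 * N < 3 ^ n" "3 ^ n - N \<le> 3 ^ n" "N < 3 ^ n - N"
    by (cases n; simp add: N_def)+
  have IH: "\<And>i. i > N \<Longrightarrow> coeff g i = 0" "\<And>i. i > N \<Longrightarrow> coeff h i = 0" "coeff h N = 1"
    "\<And>j. j < n \<Longrightarrow> coeff g (3 ^ j) = a j"
    using Suc by (auto simp: gh N_def)
  have small: "(3::nat) ^ j \<le> N" if "j < n" for j
  proof -
    obtain m where m: "n = Suc m" using \<open>j < n\<close> by (cases n) auto
    then show ?thesis using that by (simp add: N_def power_increasing)
  qed
  have top: "3 ^ n - (3 ^ n - N) = N" using N by simp
  have c: "coeff (fst (fournier a (Suc n))) i =
      coeff g i + a n * (if 3 ^ n - N \<le> i then coeff h (i - (3 ^ n - N)) else 0)"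
    "coeff (snd (fournier a (Suc n))) i =
      (if 3 ^ n - N \<le> i then coeff h (i - (3 ^ n - N)) else 0) - cnj (a n) * coeff g i" for i
    by (simp_all add: gh Let_def N_def[symmetric] coeff_monom_mult)
  have "coeff (fst (fournier a (Suc n))) (3 ^ j) = a j" if "j < Suc n" for j
  proof (cases "j = n")
    case True then show ?thesis using N IH top by (simp add: c del: fournier.simps)
  next
    case False
    then have "j < n" using that by simp
    then show ?thesis using small[of j] N IH(4)[of j] by (simp add: c del: fournier.simps)
  qed
  moreover have "coeff (fst (fournier a (Suc n))) i = 0 \<and> coeff (snd (fournier a (Suc n))) i = 0"
    if "i > 3 ^ n" for i
    using that N IH(1)[of i] IH(2)[of "i - (3 ^ n - N)"] by (simp add: c del: fournier.simps)
  moreover have "coeff (snd (fournier a (Suc n))) (3 ^ n) = 1"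
    using N IH top by (simp add: c del: fournier.simps)
  ultimately show ?case by simp
qed simp

text \<open>
  Each finite sequence is the sequence of lacunary coefficients of a polynomial whose supremum
  on the circle is at most twice its Euclidean norm; here that norm is at most \<open>1\<close>.
\<close>

theorem bounded_polynomial_lacunary_coeffs:
  assumes a: "(\<Sum>k<n. (cmod (a k))\<^sup>2) \<le> 1"
  obtains p :: "complex poly" where "\<And>j. j < n \<Longrightarrow> coeff p (3 ^ j) = a j"
    "\<And>z. cmod z = 1 \<Longrightarrow> cmod (poly p z) \<le> 2"
proof
  let ?p = "fst (fournier a n)"
  show "coeff ?p (3 ^ j) = a j" if "j < n" for j using fournier_coeff that by blast
  fix z :: complex assume z: "cmod z = 1"
  have "(cmod (poly ?p z))\<^sup>2 \<le> (\<Prod>k<n. 1 + (cmod (a k))\<^sup>2)"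
    using fournier_norm[OF z, of a n] by (metis le_add_same_cancel1 zero_le_power2)
  also have "\<dots> \<le> (\<Prod>k<n. exp ((cmod (a k))\<^sup>2))" by (intro prod_mono) (auto simp: add_nonneg_nonneg)
  also have "\<dots> = exp (\<Sum>k<n. (cmod (a k))\<^sup>2)" by (simp add: exp_sum)
  also have "\<dots> \<le> exp 1" using a by simp
  also have "\<dots> \<le> 2\<^sup>2" using exp_le by simp
  finally show "cmod (poly ?p z) \<le> 2" by (rule power2_le_imp_le) simp
qed


section \<open>Orthonormal systems\<close>

lemma cinner_right:
  fixes x y z :: "'h::complex_hilbert"
  shows "cinner x (y + z) = cinner x y + cinner x z" "cinner x (c *\<^sub>C y) = cnj c * cinner x y"
  using cinner_commute[of x "y + z"] cinner_commute[of x "c *\<^sub>C y"] cinner_commute[of x y] cinner_commute[of x z]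
  by (simp_all add: cinner_add_left cinner_scaleC_left)

lemma cinner_sum_left: "cinner (\<Sum>i\<in>I. x i) y = (\<Sum>i\<in>I. cinner (x i) (y::'h::complex_hilbert))"
proof -
  have "cinner 0 y = 0" using cinner_add_left[of 0 0 y] by simp
  then show ?thesis by (induction I rule: infinite_finite_induct) (auto simp: cinner_add_left)
qed

lemma cinner_diff_left: "cinner (x - y) z = cinner x z - cinner y (z::'h::complex_hilbert)"
  using cinner_add_left[of "x - y" y z] by simp

lemma cinner_self: "cinner x x = complex_of_real ((norm (x::'h::complex_hilbert))\<^sup>2)"
proof -
  have "0 \<le> sqrt (Re (cinner x x))" using norm_ge_zero[of x] unfolding norm_eq_sqrt_cinner .
  then have "Re (cinner x x) = (norm x)\<^sup>2" unfolding norm_eq_sqrt_cinner by simp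
  moreover have "Im (cinner x x) = 0" using cinner_commute[of x x] by (simp add: complex_eq_iff)
  ultimately show ?thesis by (simp add: complex_eq_iff)
qed

text \<open>
  Orthonormality of the first \<open>m\<close> members of a sequence.
\<close>

definition orthonormal :: "nat \<Rightarrow> (nat \<Rightarrow> 'h::complex_hilbert) \<Rightarrow> bool"
  where "orthonormal m e \<longleftrightarrow> (\<forall>i<m. \<forall>j<m. cinner (e i) (e j) = (if i = j then 1 else 0))"

lemma orthonormal_residual:
  fixes x :: "'h::complex_hilbert"
  assumes e: "orthonormal m e"
  defines "r \<equiv> x - (\<Sum>j<m. cinner x (e j) *\<^sub>C e j)"
  shows "i < m \<Longrightarrow> cinner r (e i) = 0" "cinner x r = complex_of_real ((norm r)\<^sup>2)"
    "(norm x)\<^sup>2 = (norm r)\<^sup>2 + (\<Sum>j<m. (cmod (cinner x (e j)))\<^sup>2)"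
proof -
  have 0: "cinner r (e i) = 0" if "i < m" for i
  proof -
    have "(\<Sum>j<m. cinner x (e j) * cinner (e j) (e i)) = (\<Sum>j<m. if j = i then cinner x (e i) else 0)"
      using e that unfolding orthonormal_def by (intro sum.cong) auto
    then show ?thesis using that by (simp add: r_def cinner_diff_left cinner_sum_left cinner_scaleC_left)
  qed
  then show "cinner r (e i) = 0" if "i < m" for i using that .
  have er: "cinner (e i) r = 0" if "i < m" for i using 0[OF that] cinner_commute[of "e i" r] by simp
  have x: "x = r + (\<Sum>j<m. cinner x (e j) *\<^sub>C e j)" by (simp add: r_def)
  have "cinner x r = cinner r r + (\<Sum>j<m. cinner x (e j) * cinner (e j) r)"
    by (subst x) (simp add: cinner_add_left cinner_sum_left cinner_scaleC_left)
  then show xr: "cinner x r = complex_of_real ((norm r)\<^sup>2)" by (simp add: er cinner_self)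
  have "complex_of_real ((norm x)\<^sup>2) = cinner r x + (\<Sum>j<m. cinner x (e j) * cinner (e j) x)"
    unfolding cinner_self[symmetric]
    by (subst (1) x) (simp add: cinner_add_left cinner_sum_left cinner_scaleC_left)
  also have "cinner r x = complex_of_real ((norm r)\<^sup>2)"
    using xr cinner_commute[of r x] by simp
  also have "(\<Sum>j<m. cinner x (e j) * cinner (e j) x) = complex_of_real (\<Sum>j<m. (cmod (cinner x (e j)))\<^sup>2)"
    unfolding of_real_sum complex_norm_square using cinner_commute[of _ x] by simp
  finally show "(norm x)\<^sup>2 = (norm r)\<^sup>2 + (\<Sum>j<m. (cmod (cinner x (e j)))\<^sup>2)"
    by (simp only: of_real_add[symmetric] of_real_eq_iff)
qed

lemma Bessel_inequality:
  "orthonormal m e \<Longrightarrow> (\<Sum>j<m. (cmod (cinner x (e j)))\<^sup>2) \<le> (norm x)\<^sup>2"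
  using orthonormal_residual(3)[of m e x] by simp

text \<open>
  Gram--Schmidt, in terms of Parseval's identity for the given vectors.
\<close>

lemma exists_orthonormal_Parseval:
  fixes v :: "nat \<Rightarrow> 'h::complex_hilbert"
  obtains m e where "orthonormal m e"
    "\<And>k. k < n \<Longrightarrow> (\<Sum>j<m. (cmod (cinner (v k) (e j)))\<^sup>2) = (norm (v k))\<^sup>2"
proof -
  have "\<exists>m e. orthonormal m e \<and> (\<forall>k<n. (\<Sum>j<m. (cmod (cinner (v k) (e j)))\<^sup>2) = (norm (v k))\<^sup>2)"
  proof (induction n)
    case 0
    show ?case by (intro exI[of _ 0]) (simp add: orthonormal_def)
  next
    case (Suc n)
    then obtain m e where e: "orthonormal m e"
      and p: "\<And>k. k < n \<Longrightarrow> (\<Sum>j<m. (cmod (cinner (v k) (e j)))\<^sup>2) = (norm (v k))\<^sup>2" by blast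
    define r where "r = v n - (\<Sum>j<m. cinner (v n) (e j) *\<^sub>C e j)"
    note res = orthonormal_residual[OF e, where x = "v n", folded r_def]
    show ?case
    proof (cases "r = 0")
      case True
      then show ?thesis using e p res(3) by (intro exI[of _ m] exI[of _ e]) (auto simp: less_Suc_eq)
    next
      case False
      define f where "f = complex_of_real (inverse (norm r)) *\<^sub>C r"
      define e' where "e' = e(m := f)"
      have nz: "norm r \<noteq> 0" using False by simp
      have ff: "cinner f f = 1"
        unfolding f_def cinner_scaleC_left cinner_right cinner_self[of r]
        using nz by (simp add: power2_eq_square field_simps)
      have fe: "cinner f (e i) = 0" "cinner (e i) f = 0" if "i < m" for i
        using res(1)[OF that] cinner_commute[of "e i" f] by (simp_all add: f_def cinner_scaleC_left)
      have e': "orthonormal (Suc m) e'"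
        using e ff fe unfolding orthonormal_def e'_def by (auto simp: less_Suc_eq)
      have split: "(\<Sum>j<Suc m. (cmod (cinner x (e' j)))\<^sup>2) =
          (\<Sum>j<m. (cmod (cinner x (e j)))\<^sup>2) + (cmod (cinner x f))\<^sup>2" for x
        by (simp add: e'_def)
      have "(\<Sum>j<Suc m. (cmod (cinner (v k) (e' j)))\<^sup>2) = (norm (v k))\<^sup>2" if "k < Suc n" for k
      proof (cases "k = n")
        case True
        have "cmod (cinner (v n) f) = norm r"
          using nz by (simp add: f_def cinner_right res(2) norm_mult norm_inverse power2_eq_square)
        then show ?thesis using True res(3) by (simp only: split)
      next
        case False
        then have "k < n" using that by simp
        \<comment> \<open>Parseval's identity for \<open>e\<close> and Bessel's inequality for \<open>e'\<close> leave no room for a new coefficient.\<close>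
        then show ?thesis using Bessel_inequality[OF e', of "v k"] p[of k] by (simp only: split) simp
      qed
      then show ?thesis using e' by blast
    qed
  qed
  then show ?thesis using that by blast
qed


section \<open>Analytic polynomials and limits in the Bochner norm\<close>

lemma continuous_scaleC_left: "continuous_on A (\<lambda>c. c *\<^sub>C (x::'x::complex_banach))"
proof -
  have "bounded_linear (\<lambda>c. c *\<^sub>C x)"
    by (rule bounded_linear_intro[where K="norm x"])
      (auto simp: scaleC_add_left norm_scaleC scaleR_scaleC scaleC_scaleC scaleC_complex_def)
  then show ?thesis by (rule linear_continuous_on)
qed

text \<open>
  The analytic polynomials of arbitrary degree, as functions on the whole plane.
\<close>

definition analytic_polys :: "(complex \<Rightarrow> 'x::complex_banach) set"
  where "analytic_polys = {F. \<exists>n x. F = analytic_poly n x}"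

lemma analytic_polys_continuous: "F \<in> analytic_polys \<Longrightarrow> continuous_on UNIV F"
  unfolding analytic_polys_def analytic_poly_def
  by (auto intro!: continuous_intros continuous_on_compose2[OF continuous_scaleC_left[of UNIV]])

lemma analytic_polys_monomial: "(\<lambda>z. z ^ k *\<^sub>C x) \<in> analytic_polys"
proof -
  have "z ^ k *\<^sub>C x = analytic_poly k (\<lambda>i. if i = k then x else 0) z" for z
  proof -
    have "analytic_poly k (\<lambda>i. if i = k then x else 0) z = (\<Sum>i\<le>k. if i = k then z ^ k *\<^sub>C x else 0)"
      unfolding analytic_poly_def by (intro sum.cong) auto
    then show ?thesis by simp
  qed
  then show ?thesis unfolding analytic_polys_def by blast
qed

lemma analytic_polys_add_scaleR:
  assumes "F \<in> analytic_polys" "G \<in> analytic_polys"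
  shows "(\<lambda>z. F z + r *\<^sub>R G z) \<in> analytic_polys"
proof -
  obtain n x m y where F: "F = analytic_poly n x" and G: "G = analytic_poly m y"
    using assms unfolding analytic_polys_def by blast
  have pad: "(\<Sum>k\<le>n. z ^ k *\<^sub>C x k) = (\<Sum>k\<le>n + m. z ^ k *\<^sub>C (if k \<le> n then x k else 0))"
    for n m z and x :: "nat \<Rightarrow> 'a"
    by (rule sum.mono_neutral_cong_left) auto
  have "F z + r *\<^sub>R G z =
      analytic_poly (n + m) (\<lambda>k. (if k \<le> n then x k else 0) + r *\<^sub>R (if k \<le> m then y k else 0)) z" for z
    unfolding F G analytic_poly_def pad[of z x n m] pad[of z y m n] add.commute[of m n]
    by (simp add: scaleR_sum_right sum.distrib[symmetric] scaleC_add_right)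
      (intro sum.cong refl, simp add: scaleR_scaleC scaleC_scaleC mult.commute)
  then show ?thesis unfolding analytic_polys_def by blast
qed

lemma analytic_polys_zero: "(\<lambda>z. 0) \<in> analytic_polys"
  using analytic_polys_add_scaleR[OF analytic_polys_monomial[of 0 0] analytic_polys_monomial[of 0 0]] by simp

lemma analytic_polys_sum:
  assumes "\<And>i. i \<in> I \<Longrightarrow> F i \<in> analytic_polys"
  shows "(\<lambda>z. \<Sum>i\<in>I. F i z) \<in> analytic_polys"
  using assms
proof (induction I rule: infinite_finite_induct)
  case (insert i I)
  then show ?case using analytic_polys_add_scaleR[of "F i" "\<lambda>z. \<Sum>i\<in>I. F i z" 1] by simp
qed (simp_all add: analytic_polys_zero)

text \<open>
  The norm of the Bochner space as a real number; it agrees with \<^const>\<open>L1_norm\<close> for continuous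
  functions.
\<close>

definition L1_real :: "(complex \<Rightarrow> 'x::complex_banach) \<Rightarrow> real"
  where "L1_real F = (\<integral>z. norm (F z) \<partial>circle_completion)"

lemma continuous_L1:
  assumes F: "continuous_on UNIV F"
  shows "integrable circle_completion (\<lambda>z. norm (F z))" "L1_norm F = ennreal (L1_real F)"
proof -
  have "compact ((\<lambda>z. norm (F z)) ` sphere 0 1)"
    using F by (intro compact_continuous_image continuous_on_norm) (auto intro: continuous_on_subset)
  from compact_imp_bounded[OF this] obtain B where B: "\<And>z. z \<in> sphere 0 1 \<Longrightarrow> norm (F z) \<le> B"
    unfolding bounded_iff by fastforce
  have "AE z in circle_completion. norm (norm (F z)) \<le> B"
    using AE_circle_norm by eventually_elim (simp add: B)
  then show int: "integrable circle_completion (\<lambda>z. norm (F z))"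
    by (rule circle_completion.integrable_const_bound)
      (use F in \<open>intro borel_measurable_circle_completion borel_measurable_continuous_onI continuous_on_norm\<close>)
  show "L1_norm F = ennreal (L1_real F)"
    unfolding L1_norm_completion L1_real_def by (rule nn_integral_eq_integral) (use int in auto)
qed

lemma L1_real_nonneg: "0 \<le> L1_real F"
  by (simp add: L1_real_def)

lemma L1_real_scaleR: "L1_real (\<lambda>z. r *\<^sub>R F z) = \<bar>r\<bar> * L1_real F"
  by (simp add: L1_real_def)

lemma L1_real_triangle:
  assumes "continuous_on UNIV F" "continuous_on UNIV G"
  shows "L1_real (\<lambda>z. F z + G z) \<le> L1_real F + L1_real G"
proof -
  have "L1_real (\<lambda>z. F z + G z) \<le> (\<integral>z. norm (F z) + norm (G z) \<partial>circle_completion)"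
    unfolding L1_real_def using assms
    by (intro integral_mono continuous_L1 continuous_on_add Bochner_Integration.integrable_add norm_triangle_ineq)
  also have "\<dots> = L1_real F + L1_real G"
    unfolding L1_real_def using assms by (intro Bochner_Integration.integral_add continuous_L1)
  finally show ?thesis .
qed

lemma simple_approx_circle:
  "\<exists>s. simple_function circle_measure s \<and> (\<forall>z. cmod (s z - z) \<le> 2 / real (Suc i))"
proof -
  let ?N = "real (Suc i)"
  define r where "r t = real_of_int \<lfloor>?N * t\<rfloor> / ?N" for t
  define s where "s z = Complex (r (Re z)) (r (Im z))" for z
  have r: "\<bar>r t - t\<bar> \<le> 1 / ?N" for t
  proof -
    have "r t - t = (real_of_int \<lfloor>?N * t\<rfloor> - ?N * t) / ?N" by (simp add: r_def diff_divide_distrib)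
    moreover have "\<bar>real_of_int \<lfloor>?N * t\<rfloor> - ?N * t\<bar> \<le> 1" by linarith
    ultimately show ?thesis by (simp add: divide_right_mono)
  qed
  have "cmod (s z - z) \<le> 2 / ?N" for z
    using cmod_le[of "s z - z"] r[of "Re z"] r[of "Im z"] by (simp add: s_def add_divide_distrib[symmetric])
  moreover have "simple_function circle_measure s"
  proof (rule simple_function_borel_measurable)
    have "s = (\<lambda>z. complex_of_real (r (Re z)) + \<i> * complex_of_real (r (Im z)))"
      by (simp add: s_def complex_eq_iff fun_eq_iff)
    moreover have "\<dots> \<in> borel_measurable borel" unfolding r_def by measurable
    ultimately show "s \<in> borel_measurable circle_measure" by (simp add: borel_measurable_circle)
    let ?A = "(\<lambda>k. real_of_int k / ?N) ` {- int (Suc i)..int (Suc i)}"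
    have range: "- N \<le> x \<and> x < N + 1" if "x \<le> N * 1" "N * (-1) \<le> x" for x N :: real
      using that by linarith
    have rA: "r t \<in> ?A" if "\<bar>t\<bar> \<le> 1" for t
    proof -
      have "?N * t \<le> ?N * 1" "?N * (-1) \<le> ?N * t" using that by (intro mult_left_mono; simp)+
      then have "\<lfloor>?N * t\<rfloor> \<in> {- int (Suc i)..int (Suc i)}"
        unfolding atLeastAtMost_iff le_floor_iff floor_le_iff of_int_minus of_int_of_nat_eq
        by (rule range)
      then show ?thesis unfolding r_def by (rule imageI)
    qed
    have "s ` space circle_measure \<subseteq> (\<lambda>(a, b). Complex a b) ` (?A \<times> ?A)"
    proof (rule image_subsetI)
      fix z assume "z \<in> space circle_measure"
      then have "\<bar>Re z\<bar> \<le> 1" "\<bar>Im z\<bar> \<le> 1"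
        using abs_Re_le_cmod[of z] abs_Im_le_cmod[of z] by (simp_all add: space_circle_measure)
      then have "(r (Re z), r (Im z)) \<in> ?A \<times> ?A" by (intro SigmaI rA)
      from imageI[OF this, of "\<lambda>(a, b). Complex a b"]
      show "s z \<in> (\<lambda>(a, b). Complex a b) ` (?A \<times> ?A)" by (simp add: s_def)
    qed
    then show "finite (s ` space circle_measure)" by (rule finite_subset) auto
  qed
  ultimately show ?thesis by blast
qed

lemma strongly_measurable_limit:
  fixes F :: "nat \<Rightarrow> complex \<Rightarrow> 'x::complex_banach"
  assumes F: "\<And>k. continuous_on UNIV (F k)"
    and lim: "AE z in circle_measure. (\<lambda>k. F k z) \<longlonglongrightarrow> G z"
  shows "strongly_measurable G"
proof -
  have "\<exists>t. simple_function circle_measure t \<and> (\<forall>z\<in>sphere 0 1. norm (t z - F k z) \<le> 1 / real (Suc k))" for k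
  proof -
    have "uniformly_continuous_on (cball 0 3) (F k)"
      using F by (intro compact_uniformly_continuous) (auto intro: continuous_on_subset)
    moreover have "0 < 1 / real (Suc k)" by simp
    ultimately obtain d where d: "d > 0"
      "\<And>z z'. z \<in> cball 0 3 \<Longrightarrow> z' \<in> cball 0 3 \<Longrightarrow> dist z' z < d \<Longrightarrow> dist (F k z') (F k z) < 1 / real (Suc k)"
      unfolding uniformly_continuous_on_def by meson
    obtain i where i: "2 / d < real (Suc i)" using reals_Archimedean2[of "2 / d"] by (meson less_trans lessI of_nat_less_iff)
    obtain s where s: "simple_function circle_measure s" "\<And>z. cmod (s z - z) \<le> 2 / real (Suc i)"
      using simple_approx_circle by blast
    have "norm (F k (s z) - F k z) \<le> 1 / real (Suc k)" if "z \<in> sphere 0 1" for z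
    proof -
      have "2 / real (Suc i) < d" using i d(1) by (simp add: field_simps)
      then have "dist (s z) z < d" using s(2)[of z] by (simp add: dist_norm)
      moreover have "2 / real (Suc i) \<le> 2" by (simp add: field_simps)
      then have "cmod (s z) \<le> 3" using s(2)[of z] that norm_triangle_sub[of "s z" z] by auto
      ultimately show ?thesis using d(2)[of z "s z"] that by (simp add: dist_norm)
    qed
    moreover have "simple_function circle_measure (\<lambda>z. F k (s z))"
      using simple_function_compose[OF s(1), of "F k"] by (simp add: comp_def)
    ultimately show ?thesis by blast
  qed
  then obtain t where t: "\<And>k. simple_function circle_measure (t k)"
    "\<And>k z. z \<in> sphere 0 1 \<Longrightarrow> norm (t k z - F k z) \<le> 1 / real (Suc k)" by metis
  have "AE z in circle_measure. z \<in> sphere 0 1"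
    by (rule AE_I2) (simp add: space_circle_measure)
  with lim have "AE z in circle_measure. (\<lambda>k. t k z) \<longlonglongrightarrow> G z"
  proof eventually_elim
    case (elim z)
    have "(\<lambda>k. t k z - F k z) \<longlonglongrightarrow> 0"
    proof (rule Lim_null_comparison)
      show "\<forall>\<^sub>F k in sequentially. norm (t k z - F k z) \<le> 1 / real (Suc k)"
        using t(2) elim by auto
      show "(\<lambda>k. 1 / real (Suc k)) \<longlonglongrightarrow> 0"
        using LIMSEQ_inverse_real_of_nat by (simp add: inverse_eq_divide)
    qed
    from tendsto_add[OF this elim(1)] show ?case by simp
  qed
  then show ?thesis unfolding strongly_measurable_def using t(1) by blast
qed

lemma norm_lim_diff_le_suminf:
  fixes f :: "nat \<Rightarrow> 'a::banach"
  shows "ennreal (norm (lim f - f k)) \<le> (\<Sum>j. ennreal (norm (f (Suc (j + k)) - f (j + k))))"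
    and "(\<Sum>j. ennreal (norm (f (Suc (j + k)) - f (j + k)))) \<noteq> \<top> \<Longrightarrow> f \<longlonglongrightarrow> lim f"
proof -
  let ?d = "\<lambda>j. f (Suc (j + k)) - f (j + k)"
  have main: "f \<longlonglongrightarrow> lim f \<and> ennreal (norm (lim f - f k)) \<le> (\<Sum>j. ennreal (norm (?d j)))"
    if fin: "(\<Sum>j. ennreal (norm (?d j))) \<noteq> \<top>"
  proof -
    have sn: "summable (\<lambda>j. norm (?d j))" by (rule summable_suminf_not_top[OF _ fin]) simp
    have "(\<Sum>j<n. ?d j) = f (n + k) - f k" for n by (induction n) simp_all
    then have "(\<lambda>n. f (n + k) - f k) \<longlonglongrightarrow> suminf ?d"
      using summable_LIMSEQ[OF summable_norm_cancel[OF sn]] by simp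
    from tendsto_add[OF this tendsto_const[of "f k"]]
    have f: "f \<longlonglongrightarrow> suminf ?d + f k" by (simp add: LIMSEQ_offset)
    then have l: "lim f = suminf ?d + f k" by (rule limI)
    have "ennreal (norm (suminf ?d)) \<le> ennreal (\<Sum>j. norm (?d j))"
      by (intro ennreal_leI summable_norm sn)
    also have "\<dots> = (\<Sum>j. ennreal (norm (?d j)))" by (rule suminf_ennreal2[symmetric]) (simp_all add: sn)
    finally show ?thesis using f l by simp
  qed
  show "ennreal (norm (lim f - f k)) \<le> (\<Sum>j. ennreal (norm (?d j)))"
  proof (cases "(\<Sum>j. ennreal (norm (?d j))) = \<top>")
    case True
    show ?thesis unfolding True by (rule top_greatest)
  qed (use main in blast)
  show "(\<Sum>j. ennreal (norm (?d j))) \<noteq> \<top> \<Longrightarrow> f \<longlonglongrightarrow> lim f" using main by blast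
qed

text \<open>
  The instance of completeness of the Hardy space that the gliding hump needs.
\<close>

lemma L1_limit:
  fixes F :: "nat \<Rightarrow> complex \<Rightarrow> 'x::complex_banach"
  assumes F: "\<And>k. F k \<in> analytic_polys"
    and step: "\<And>k. L1_real (\<lambda>z. F (Suc k) z - F k z) \<le> (1 / 3) ^ k"
  obtains G where "G \<in> H1_space" "(\<lambda>k. L1_norm (\<lambda>z. G z - F k z)) \<longlonglongrightarrow> 0"
proof -
  define G where "G z = lim (\<lambda>k. F k z)" for z
  have cont: "continuous_on UNIV (F k)" for k by (rule analytic_polys_continuous[OF F])
  have cd: "continuous_on UNIV (\<lambda>z. F (Suc k) z - F k z)" for k
    by (intro continuous_on_diff cont)
  have meas: "(\<lambda>z. ennreal (norm (F (Suc k) z - F k z))) \<in> borel_measurable circle_completion" for k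
    using continuous_L1(1)[OF cd[of k]] by auto
  have bound: "(\<integral>\<^sup>+z. (\<Sum>j. ennreal (norm (F (Suc (j + k)) z - F (j + k) z))) \<partial>circle_completion)
      \<le> ennreal ((3 / 2) * (1 / 3) ^ k)" for k
  proof -
    have "(\<integral>\<^sup>+z. (\<Sum>j. ennreal (norm (F (Suc (j + k)) z - F (j + k) z))) \<partial>circle_completion) =
        (\<Sum>j. L1_norm (\<lambda>z. F (Suc (j + k)) z - F (j + k) z))"
      unfolding L1_norm_completion by (rule nn_integral_suminf) (rule meas)
    also have "\<dots> \<le> (\<Sum>j. ennreal ((1 / 3) ^ j * (1 / 3) ^ k))"
      using step[of "_ + k"] by (intro suminf_le) (auto simp: continuous_L1(2)[OF cd] power_add intro!: ennreal_leI)
    also have "\<dots> = ennreal (\<Sum>j. (1 / 3) ^ j * (1 / 3) ^ k)"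
      by (rule suminf_ennreal2) (auto intro!: summable_mult2 summable_geometric)
    also have "(\<Sum>j. (1 / 3 :: real) ^ j * (1 / 3) ^ k) = (3 / 2) * (1 / 3) ^ k"
      by (subst suminf_mult2[symmetric]) (auto simp: suminf_geometric summable_geometric)
    finally show ?thesis .
  qed
  have norm_le: "L1_norm (\<lambda>z. G z - F k z) \<le> ennreal ((3 / 2) * (1 / 3) ^ k)" for k
  proof -
    have "L1_norm (\<lambda>z. G z - F k z) \<le>
        (\<integral>\<^sup>+z. (\<Sum>j. ennreal (norm (F (Suc (j + k)) z - F (j + k) z))) \<partial>circle_completion)"
      unfolding L1_norm_completion G_def by (intro nn_integral_mono norm_lim_diff_le_suminf(1))
    then show ?thesis using bound[of k] by (rule order_trans)
  qed
  have "(\<integral>\<^sup>+z. (\<Sum>j. ennreal (norm (F (Suc (j + 0)) z - F (j + 0) z))) \<partial>circle_completion) \<noteq> \<infinity>"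
    using bound[of 0] by (auto simp: top_unique)
  then have "AE z in circle_completion. (\<Sum>j. ennreal (norm (F (Suc (j + 0)) z - F (j + 0) z))) \<noteq> \<infinity>"
    using meas by (intro nn_integral_PInf_AE) auto
  then have "AE z in circle_completion. (\<lambda>k. F k z) \<longlonglongrightarrow> G z"
    by eventually_elim (unfold G_def, rule norm_lim_diff_le_suminf(2)[where k=0], simp)
  then have "strongly_measurable G"
    unfolding AE_completion_iff by (intro strongly_measurable_limit[of F] cont)
  moreover have lim: "(\<lambda>k. L1_norm (\<lambda>z. G z - F k z)) \<longlonglongrightarrow> 0"
  proof (rule tendsto_sandwich[of "\<lambda>_. 0" _ _ "\<lambda>k. ennreal ((3 / 2) * (1 / 3) ^ k)"])
    have "(\<lambda>k. (3 / 2) * (1 / 3 :: real) ^ k) \<longlonglongrightarrow> (3 / 2) * 0"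
      by (intro tendsto_mult tendsto_const LIMSEQ_realpow_zero) auto
    then show "(\<lambda>k. ennreal ((3 / 2) * (1 / 3) ^ k)) \<longlonglongrightarrow> 0"
      by (subst ennreal_0[symmetric]) (intro tendsto_ennrealI, simp)
  qed (use norm_le in auto)
  moreover have "L1_norm G < \<infinity>"
  proof -
    have "L1_norm G \<le> (\<integral>\<^sup>+z. (\<Sum>j. ennreal (norm (F (Suc (j + 0)) z - F (j + 0) z))) + ennreal (norm (F 0 z)) \<partial>circle_completion)"
      unfolding L1_norm_completion
    proof (rule nn_integral_mono)
      fix z
      have "ennreal (norm (G z)) \<le> ennreal (norm (G z - F 0 z)) + ennreal (norm (F 0 z))"
        using norm_triangle_sub[of "G z" "F 0 z"]
        by (simp add: ennreal_plus[symmetric] ennreal_leI add.commute del: ennreal_plus)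
      also have "\<dots> \<le> (\<Sum>j. ennreal (norm (F (Suc (j + 0)) z - F (j + 0) z))) + ennreal (norm (F 0 z))"
        unfolding G_def by (intro add_right_mono norm_lim_diff_le_suminf(1))
      finally show "ennreal (norm (G z)) \<le> \<dots>" .
    qed
    also have "\<dots> = (\<integral>\<^sup>+z. (\<Sum>j. ennreal (norm (F (Suc (j + 0)) z - F (j + 0) z))) \<partial>circle_completion)
        + ennreal (L1_real (F 0))"
      unfolding continuous_L1(2)[OF cont[of 0], symmetric] L1_norm_completion
      using meas continuous_L1(1)[OF cont[of 0]] by (intro nn_integral_add) auto
    also have "\<dots> \<le> ennreal ((3 / 2) * (1 / 3) ^ 0) + ennreal (L1_real (F 0))"
      by (intro add_right_mono bound)
    also have "\<dots> < \<infinity>" by (simp flip: ennreal_plus add: L1_real_nonneg)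
    finally show ?thesis .
  qed
  moreover have "\<exists>n x. L1_norm (\<lambda>z. G z - analytic_poly n x z) < e" if e: "e > 0" for e
  proof -
    obtain k where "L1_norm (\<lambda>z. G z - F k z) < e"
      using order_tendstoD(2)[OF lim e] by (auto simp: eventually_sequentially)
    then show ?thesis using F[of k] unfolding analytic_polys_def mem_Collect_eq by metis
  qed
  ultimately have "G \<in> H1_space" unfolding H1_space_def L1_space_def by blast
  then show ?thesis using that lim by blast
qed


section \<open>Lacunary functionals\<close>

text \<open>
  A linear contraction from the space into the \<open>m\<close>-dimensional Hilbert space, given by its
  coordinates.
\<close>

definition contraction_system :: "nat \<Rightarrow> (nat \<Rightarrow> 'x::complex_banach \<Rightarrow> complex) \<Rightarrow> bool"
  where "contraction_system m l \<longleftrightarrow>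
    (\<forall>j<m. bounded_clinear (l j)) \<and> (\<forall>x. (\<Sum>j<m. (cmod (l j x))\<^sup>2) \<le> (norm x)\<^sup>2)"

text \<open>
  The functional \<open>F \<mapsto> \<Sum>\<^sub>j \<langle>l j, F\<^sub>j\<rangle>\<close>, where \<open>F\<^sub>j\<close> is the Fourier coefficient at \<open>3\<^sup>j\<close>. The
  coefficient is taken after the application of \<open>l j\<close>, so that no vector-valued integral is
  needed.
\<close>

definition lacunary_functional ::
    "nat \<Rightarrow> (nat \<Rightarrow> 'x::complex_banach \<Rightarrow> complex) \<Rightarrow> (complex \<Rightarrow> 'x) \<Rightarrow> complex"
  where "lacunary_functional m l F = (\<Sum>j<m. fourier_coeff (3 ^ j) (\<lambda>z. l j (F z)))"

lemma contraction_system_le: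
  assumes "contraction_system m l" "j < m" shows "cmod (l j x) \<le> norm x"
proof -
  have "(cmod (l j x))\<^sup>2 \<le> (\<Sum>j<m. (cmod (l j x))\<^sup>2)"
    using assms(2) by (intro member_le_sum) auto
  also have "\<dots> \<le> (norm x)\<^sup>2" using assms(1) unfolding contraction_system_def by blast
  finally show ?thesis by (rule power2_le_imp_le) simp
qed

lemma fourier_coeff_add:
  assumes "integrable circle_completion g" "integrable circle_completion h"
  shows "fourier_coeff n (\<lambda>z. g z + h z) = fourier_coeff n g + fourier_coeff n h"
  unfolding fourier_coeff_def using integrable_fourier[OF assms(1)] integrable_fourier[OF assms(2)]
  by (simp add: distrib_right)

lemma fourier_coeff_diff:
  assumes "integrable circle_completion g" "integrable circle_completion h"
  shows "fourier_coeff n (\<lambda>z. g z - h z) = fourier_coeff n g - fourier_coeff n h"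
  unfolding fourier_coeff_def using integrable_fourier[OF assms(1)] integrable_fourier[OF assms(2)]
  by (simp add: left_diff_distrib)

lemma fourier_coeff_scale: "fourier_coeff n (\<lambda>z. c * h z) = c * fourier_coeff n h"
  unfolding fourier_coeff_def by (simp add: mult.assoc)

lemma fourier_coeff_zero: "fourier_coeff n (\<lambda>z. 0) = 0"
  by (simp add: fourier_coeff_def)

lemma fourier_coeff_sum:
  assumes "\<And>i. i \<in> I \<Longrightarrow> integrable circle_completion (h i)"
  shows "fourier_coeff n (\<lambda>z. \<Sum>i\<in>I. c i * h i z) = (\<Sum>i\<in>I. c i * fourier_coeff n (h i))"
  using assms
  by (induction I rule: infinite_finite_induct)
    (simp_all add: fourier_coeff_zero fourier_coeff_add fourier_coeff_scale)

lemma fourier_coeff_cong_AE: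
  assumes "integrable circle_completion g" "integrable circle_completion h"
    and "AE z in circle_measure. g z = h z"
  shows "fourier_coeff n g = fourier_coeff n h"
  unfolding fourier_coeff_def
proof (rule integral_cong_AE)
  show "AE z in circle_completion. g z * cnj z ^ n = h z * cnj z ^ n"
    using AE_completion[OF assms(3)] by eventually_elim simp
qed (use integrable_fourier assms in auto)

lemma integrable_poly: "integrable circle_completion (poly (p :: complex poly))"
proof -
  have "compact (poly p ` sphere 0 1)"
    by (intro compact_continuous_image continuous_intros) simp
  from compact_imp_bounded[OF this] obtain B where "\<And>z. cmod z = 1 \<Longrightarrow> cmod (poly p z) \<le> B"
    unfolding bounded_iff by fastforce
  then show ?thesis
    by (intro integrable_circle_bounded borel_measurable_continuous_onI continuous_intros) auto
qed

lemma fourier_coeff_poly: "fourier_coeff n (poly p) = coeff p n"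
proof -
  have "(\<lambda>z::complex. z ^ i) = poly (monom 1 i)" for i by (simp add: fun_eq_iff poly_monom)
  then have power: "integrable circle_completion (\<lambda>z. z ^ i)" for i by (simp add: integrable_poly)
  have "fourier_coeff n (\<lambda>z. \<Sum>i\<le>degree p. coeff p i * z ^ i) =
      (\<Sum>i\<le>degree p. coeff p i * fourier_coeff n (\<lambda>z. z ^ i))"
    by (intro fourier_coeff_sum power)
  also have "\<dots> = (\<Sum>i\<le>degree p. if i = n then coeff p n else 0)"
    by (intro sum.cong) (auto simp: fourier_coeff_power)
  also have "\<dots> = coeff p n" by (auto simp: coeff_eq_0)
  finally show ?thesis by (simp add: poly_altdef[abs_def])
qed

lemma fourier_coeff_le_L1_norm:
  assumes g: "integrable circle_completion g" and le: "\<And>z. cmod (g z) \<le> norm (D z)"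
  shows "ennreal (cmod (fourier_coeff n g)) \<le> L1_norm D"
proof -
  have "ennreal (cmod (fourier_coeff n g)) \<le> ennreal (\<integral>z. cmod (g z) \<partial>circle_completion)"
    by (intro ennreal_leI fourier_coeff_le g)
  also have "\<dots> = (\<integral>\<^sup>+z. ennreal (cmod (g z)) \<partial>circle_completion)"
    by (rule nn_integral_eq_integral[symmetric]) (use g in auto)
  also have "\<dots> \<le> L1_norm D"
    unfolding L1_norm_completion by (intro nn_integral_mono ennreal_leI le)
  finally show ?thesis .
qed

lemma integrable_functional_compose:
  assumes F: "F \<in> L1_space" and l: "bounded_clinear l" and le: "\<And>x. cmod (l x) \<le> norm x"
  shows "integrable circle_completion (\<lambda>z. l (F z))"
proof -
  have "continuous_on UNIV l"
    by (rule linear_continuous_on[OF bounded_clinearD(1)[OF l]])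
  then have "strongly_measurable (\<lambda>z. l (F z))"
    using F unfolding L1_space_def by (blast intro: strongly_measurable_compose)
  moreover have "L1_norm (\<lambda>z. l (F z)) \<le> L1_norm F"
    unfolding L1_norm_completion by (intro nn_integral_mono ennreal_leI le)
  then have "L1_norm (\<lambda>z. l (F z)) < \<infinity>"
    using F unfolding L1_space_def by auto
  ultimately have "(\<lambda>z. l (F z)) \<in> L1_space" unfolding L1_space_def by blast
  then show ?thesis by (rule L1_space_integrable)
qed

lemma analytic_polys_L1_space: "F \<in> analytic_polys \<Longrightarrow> F \<in> L1_space"
  unfolding L1_space_def
  using continuous_L1(2)[OF analytic_polys_continuous] strongly_measurable_limit[of "\<lambda>_. F" F]
    analytic_polys_continuous
  by auto

lemma ennreal_cmod_sum_le:
  assumes "\<And>j. j < m \<Longrightarrow> ennreal (cmod (f j)) \<le> B"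
  shows "ennreal (cmod (\<Sum>j<m. f j)) \<le> of_nat m * B"
proof -
  have "ennreal (cmod (\<Sum>j<m. f j)) \<le> ennreal (\<Sum>j<m. cmod (f j))"
    by (intro ennreal_leI norm_sum)
  also have "\<dots> = (\<Sum>j<m. ennreal (cmod (f j)))" by simp
  also have "\<dots> \<le> (\<Sum>j<m. B)" using assms by (intro sum_mono) auto
  finally show ?thesis by simp
qed

lemma lacunary_functional_diff_le:
  assumes l: "contraction_system m l" and F: "F \<in> L1_space" and G: "G \<in> L1_space"
  shows "ennreal (cmod (lacunary_functional m l F - lacunary_functional m l G)) \<le>
    of_nat m * L1_norm (\<lambda>z. F z - G z)"
proof -
  have "lacunary_functional m l F - lacunary_functional m l G =
      (\<Sum>j<m. fourier_coeff (3 ^ j) (\<lambda>z. l j (F z)) - fourier_coeff (3 ^ j) (\<lambda>z. l j (G z)))"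
    by (simp add: lacunary_functional_def sum_subtractf)
  also have "ennreal (cmod \<dots>) \<le> of_nat m * L1_norm (\<lambda>z. F z - G z)"
  proof (rule ennreal_cmod_sum_le)
    fix j assume j: "j < m"
    have lj: "bounded_clinear (l j)" using l j unfolding contraction_system_def by blast
    note int = integrable_functional_compose[OF F lj contraction_system_le[OF l j]]
      integrable_functional_compose[OF G lj contraction_system_le[OF l j]]
    show "ennreal (cmod (fourier_coeff (3 ^ j) (\<lambda>z. l j (F z)) - fourier_coeff (3 ^ j) (\<lambda>z. l j (G z))))
        \<le> L1_norm (\<lambda>z. F z - G z)"
      unfolding fourier_coeff_diff[OF int, symmetric]
    proof (rule fourier_coeff_le_L1_norm)
      show "cmod (l j (F z) - l j (G z)) \<le> norm (F z - G z)" for z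
        using contraction_system_le[OF l j, of "F z - G z"] by (simp only: bounded_clinearD(5)[OF lj])
    qed (use int in simp)
  qed
  finally show ?thesis .
qed

lemma lacunary_functional_add_scaleR:
  assumes l: "contraction_system m l" and F: "F \<in> L1_space" and G: "G \<in> L1_space"
  shows "lacunary_functional m l (\<lambda>z. F z + r *\<^sub>R G z) =
    lacunary_functional m l F + r *\<^sub>R lacunary_functional m l G"
proof -
  have "fourier_coeff (3 ^ j) (\<lambda>z. l j (F z + r *\<^sub>R G z)) =
      fourier_coeff (3 ^ j) (\<lambda>z. l j (F z)) + r *\<^sub>R fourier_coeff (3 ^ j) (\<lambda>z. l j (G z))" if j: "j < m" for j
  proof -
    have lj: "bounded_clinear (l j)" using l j unfolding contraction_system_def by blast
    note int = integrable_functional_compose[OF F lj contraction_system_le[OF l j]]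
      integrable_functional_compose[OF G lj contraction_system_le[OF l j]]
    have "fourier_coeff (3 ^ j) (\<lambda>z. l j (F z) + of_real r * l j (G z)) =
      fourier_coeff (3 ^ j) (\<lambda>z. l j (F z)) + of_real r * fourier_coeff (3 ^ j) (\<lambda>z. l j (G z))"
      using int by (simp add: fourier_coeff_add fourier_coeff_scale)
    then show ?thesis
      by (simp add: bounded_clinearD(2)[OF lj] bounded_clinearD(8)[OF lj] scaleR_conv_of_real)
  qed
  then show ?thesis
    by (simp add: lacunary_functional_def sum.distrib scaleR_sum_right)
qed


section \<open>Duality with the projective tensor product\<close>

text \<open>
  The value of a lacunary functional on a formal tensor. By Paley's inequality it is bounded
  for the projective norm, uniformly in the contraction system.
\<close>

definition tensor_pairing ::
    "nat \<Rightarrow> (nat \<Rightarrow> 'x::complex_banach \<Rightarrow> complex) \<Rightarrow> 'x formal_tensor \<Rightarrow> complex"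
  where "tensor_pairing m l u = (\<Sum>(h, x)\<leftarrow>u. \<Sum>j<m. l j x * fourier_coeff (3 ^ j) h)"

lemma H1_space_integrable: "h \<in> H1_space \<Longrightarrow> integrable circle_completion (h :: complex \<Rightarrow> complex)"
  unfolding H1_space_def by (blast intro: L1_space_integrable)

lemma H1_space_integral_power:
  fixes h :: "complex \<Rightarrow> complex"
  assumes h: "h \<in> H1_space" and j: "j > 0"
  shows "(\<integral>z. h z * z ^ j \<partial>circle_completion) = 0"
proof -
  have int: "integrable circle_completion h" by (rule H1_space_integrable[OF h])
  have "cmod (\<integral>z. h z * z ^ j \<partial>circle_completion) \<le> e" if "e > 0" for e
  proof -
    have "0 < ennreal e" using that by simp
    then obtain n x where nx: "L1_norm (\<lambda>z. h z - analytic_poly n x z) < ennreal e"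
      using h unfolding H1_space_def by blast
    define p where "p = (\<Sum>k\<le>n. monom (x k) k)"
    have p: "analytic_poly n x = poly p"
      by (rule ext) (simp add: p_def analytic_poly_def poly_sum poly_monom scaleC_complex_def mult.commute)
    have ip: "integrable circle_completion (poly p)" by (rule integrable_poly)
    have "(\<integral>z. poly p z * z ^ j \<partial>circle_completion) = fourier_coeff 0 (poly (p * monom 1 j))"
      by (simp add: fourier_coeff_def poly_monom)
    also have "\<dots> = 0" using j by (simp add: fourier_coeff_poly coeff_mult)
    finally have "(\<integral>z. h z * z ^ j \<partial>circle_completion) =
        (\<integral>z. (h z - poly p z) * z ^ j \<partial>circle_completion)"
      using integrable_circle_mult_power[OF int] integrable_circle_mult_power[OF ip]
      by (simp add: left_diff_distrib)
    also have "cmod \<dots> \<le> (\<integral>z. cmod ((h z - poly p z) * z ^ j) \<partial>circle_completion)"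
      by (rule integral_norm_bound)
    also have "\<dots> = (\<integral>z. cmod (h z - poly p z) \<partial>circle_completion)"
    proof (rule integral_cong_AE)
      show "AE z in circle_completion. cmod ((h z - poly p z) * z ^ j) = cmod (h z - poly p z)"
        using AE_circle_norm by eventually_elim (simp add: norm_mult norm_power)
    qed (use integrable_circle_mult_power[of "\<lambda>z. h z - poly p z" j] int ip in auto)
    finally have "ennreal (cmod (\<integral>z. h z * z ^ j \<partial>circle_completion)) \<le>
        ennreal (\<integral>z. cmod (h z - poly p z) \<partial>circle_completion)" by (rule ennreal_leI)
    also have "\<dots> = L1_norm (\<lambda>z. h z - analytic_poly n x z)"
      unfolding L1_norm_completion p by (rule nn_integral_eq_integral[symmetric]) (use int ip in auto)
    also have "\<dots> < ennreal e" by (rule nx)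
    finally show ?thesis using that by (simp add: ennreal_less_iff)
  qed
  from field_le_epsilon[of "cmod _" 0, simplified, OF this] show ?thesis by simp
qed

lemma tensor_pairing_append: "tensor_pairing m l (u @ v) = tensor_pairing m l u + tensor_pairing m l v"
  by (simp add: tensor_pairing_def)

lemma tensor_pairing_eq:
  assumes l: "contraction_system m l"
  shows "tensor_eq u v \<Longrightarrow> tensor_pairing m l u = tensor_pairing m l v"
proof (induction rule: tensor_eq.induct)
  case (tensor_append u u' v v')
  then show ?case by (simp add: tensor_pairing_append)
next
  case (tensor_commute u v)
  then show ?case by (simp add: tensor_pairing_append)
next
  case (tensor_zero h)
  then show ?case
    using l by (simp add: tensor_pairing_def contraction_system_def bounded_clinearD)
next
  case (tensor_add_left h g x)
  then show ?case
    by (simp add: tensor_pairing_def fourier_coeff_add H1_space_integrable sum.distrib algebra_simps)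
next
  case (tensor_add_right h x y)
  then show ?case
    using l by (simp add: tensor_pairing_def contraction_system_def bounded_clinearD sum.distrib algebra_simps)
next
  case (tensor_scale h c x)
  then show ?case
    using l by (simp add: tensor_pairing_def contraction_system_def bounded_clinearD scaleC_complex_def
        fourier_coeff_scale algebra_simps)
next
  case (tensor_AE h g x)
  then have "fourier_coeff n h = fourier_coeff n g" for n
    by (intro fourier_coeff_cong_AE H1_space_integrable)
  then show ?case by (simp add: tensor_pairing_def)
qed simp_all

lemma elementary_tensor_pairing_le:
  assumes l: "contraction_system m l" and h: "h \<in> H1_space"
  shows "ennreal (cmod (\<Sum>j<m. l j x * fourier_coeff (3 ^ j) h) / 6) \<le> L1_norm h * ennreal (norm x)"
proof -
  let ?I = "\<integral>z. cmod (h z) \<partial>circle_completion"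
  have I: "0 \<le> ?I" by simp
  have int: "integrable circle_completion h" by (rule H1_space_integrable[OF h])
  have "(\<Sum>j<m. (cmod (fourier_coeff (3 ^ j) h))\<^sup>2) \<le> 32 * ?I\<^sup>2"
    by (rule Paley_inequality[OF int H1_space_integral_power[OF h]])
  also have "\<dots> \<le> (6 * ?I)\<^sup>2" by (simp add: power_mult_distrib)
  finally have 1: "L2_set (\<lambda>j. cmod (fourier_coeff (3 ^ j) h)) {..<m} \<le> 6 * ?I"
    unfolding L2_set_def using I by (intro real_le_lsqrt) (auto intro: sum_nonneg)
  have 2: "L2_set (\<lambda>j. cmod (l j x)) {..<m} \<le> norm x"
    unfolding L2_set_def using l by (intro real_le_lsqrt) (auto simp: contraction_system_def intro: sum_nonneg)
  have "cmod (\<Sum>j<m. l j x * fourier_coeff (3 ^ j) h) \<le> (\<Sum>j<m. \<bar>cmod (l j x)\<bar> * \<bar>cmod (fourier_coeff (3 ^ j) h)\<bar>)"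
    by (rule order_trans[OF norm_sum]) (simp add: norm_mult)
  also have "\<dots> \<le> L2_set (\<lambda>j. cmod (l j x)) {..<m} * L2_set (\<lambda>j. cmod (fourier_coeff (3 ^ j) h)) {..<m}"
    by (rule L2_set_mult_ineq)
  also have "\<dots> \<le> norm x * (6 * ?I)" by (intro mult_mono 1 2) auto
  finally have "cmod (\<Sum>j<m. l j x * fourier_coeff (3 ^ j) h) / 6 \<le> ?I * norm x" by (simp add: field_simps)
  then have "ennreal (cmod (\<Sum>j<m. l j x * fourier_coeff (3 ^ j) h) / 6) \<le> ennreal (?I * norm x)"
    by (rule ennreal_leI)
  also have "\<dots> = L1_norm h * ennreal (norm x)"
    using h L1_space_integrable(2)[of h] I by (simp add: H1_space_def ennreal_mult)
  finally show ?thesis .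
qed

lemma tensor_pairing_le:
  assumes l: "contraction_system m l"
  shows "ennreal (cmod (tensor_pairing m l u) / 6) \<le> projective_norm u"
  unfolding projective_norm_def
proof (rule INF_greatest)
  fix v assume "v \<in> {v \<in> tensors. tensor_eq u v}"
  then have v: "v \<in> tensors" and eq: "tensor_pairing m l u = tensor_pairing m l v"
    using tensor_pairing_eq[OF l] by auto
  have "ennreal (cmod (tensor_pairing m l v) / 6) \<le> (\<Sum>(h, x)\<leftarrow>v. L1_norm h * ennreal (norm x))"
    using v
  proof (induction v)
    case (Cons p v)
    obtain h x where p: "p = (h, x)" by fastforce
    have h: "h \<in> H1_space" and v: "v \<in> tensors" using Cons.prems by (auto simp: tensors_def p)
    have "cmod (tensor_pairing m l (p # v)) / 6 \<le>
        cmod (\<Sum>j<m. l j x * fourier_coeff (3 ^ j) h) / 6 + cmod (tensor_pairing m l v) / 6"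
      by (simp add: tensor_pairing_def p norm_triangle_ineq flip: add_divide_distrib)
    then have "ennreal (cmod (tensor_pairing m l (p # v)) / 6) \<le>
        ennreal (cmod (\<Sum>j<m. l j x * fourier_coeff (3 ^ j) h) / 6) + ennreal (cmod (tensor_pairing m l v) / 6)"
      by (simp add: ennreal_plus[symmetric] ennreal_leI del: ennreal_plus)
    also have "\<dots> \<le> L1_norm h * ennreal (norm x) + (\<Sum>(h, x)\<leftarrow>v. L1_norm h * ennreal (norm x))"
      by (intro add_mono elementary_tensor_pairing_le[OF l h] Cons.IH v)
    finally show ?case by (simp add: p)
  qed (simp add: tensor_pairing_def)
  then show "ennreal (cmod (tensor_pairing m l u) / 6) \<le> (\<Sum>(h, x)\<leftarrow>v. L1_norm h * ennreal (norm x))"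
    by (simp add: eq)
qed

lemma sum_list_tensor_finite:
  "u \<in> tensors \<Longrightarrow> (\<Sum>(h, x)\<leftarrow>u. L1_norm h * ennreal (norm x)) < \<infinity>"
proof (induction u)
  case (Cons p u)
  obtain h x where p: "p = (h, x)" by fastforce
  have "L1_norm h < \<infinity>" "u \<in> tensors"
    using Cons.prems by (auto simp: p tensors_def H1_space_def L1_space_def)
  then show ?case using Cons.IH by (simp add: p ennreal_mult_less_top)
qed simp

lemma tensor_pairing_diff:
  assumes l: "contraction_system m l"
  shows "tensor_pairing m l (tensor_diff u v) = tensor_pairing m l u - tensor_pairing m l v"
proof -
  have "tensor_pairing m l (map (\<lambda>(h, x). (h, - x)) v) = - tensor_pairing m l v"
    using l by (induction v) (auto simp: tensor_pairing_def contraction_system_def bounded_clinearD sum_negf)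
  then show ?thesis by (simp add: tensor_diff_def tensor_pairing_append)
qed

lemma lacunary_functional_tensor_le:
  assumes l: "contraction_system m l" and F: "F \<in> L1_space" and u: "u \<in> tensors"
  shows "ennreal (cmod (lacunary_functional m l F - tensor_pairing m l u)) \<le>
    of_nat m * L1_norm (\<lambda>z. F z - tensor_fun u z)"
proof -
  have coeff: "integrable circle_completion (\<lambda>z. lj (tensor_fun u z)) \<and>
      fourier_coeff n (\<lambda>z. lj (tensor_fun u z)) = (\<Sum>(h, x)\<leftarrow>u. lj x * fourier_coeff n h)"
    if lj: "bounded_clinear lj" for lj n
    using u
  proof (induction u)
    case Nil
    then show ?case using lj by (simp add: tensor_fun_def bounded_clinearD fourier_coeff_zero)
  next
    case (Cons p u)
    obtain h x where p: "p = (h, x)" by fastforce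
    have h: "integrable circle_completion h" and u: "u \<in> tensors"
      using Cons.prems by (auto simp: tensors_def p H1_space_integrable)
    have eq: "lj (tensor_fun (p # u) z) = lj x * h z + lj (tensor_fun u z)" for z
      by (simp add: tensor_fun_def p bounded_clinearD[OF lj] scaleC_complex_def mult.commute)
    show ?case unfolding eq using Cons.IH[OF u] h
      by (simp add: fourier_coeff_add fourier_coeff_scale p)
  qed
  have "lacunary_functional m l F - tensor_pairing m l u =
      (\<Sum>j<m. fourier_coeff (3 ^ j) (\<lambda>z. l j (F z)) - fourier_coeff (3 ^ j) (\<lambda>z. l j (tensor_fun u z)))"
  proof -
    have "tensor_pairing m l u = (\<Sum>j<m. \<Sum>(h, x)\<leftarrow>u. l j x * fourier_coeff (3 ^ j) h)"
      by (induction u) (auto simp: tensor_pairing_def sum.distrib)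
    also have "\<dots> = (\<Sum>j<m. fourier_coeff (3 ^ j) (\<lambda>z. l j (tensor_fun u z)))"
      using l coeff by (intro sum.cong) (auto simp: contraction_system_def)
    finally show ?thesis by (simp add: lacunary_functional_def sum_subtractf)
  qed
  also have "ennreal (cmod \<dots>) \<le> of_nat m * L1_norm (\<lambda>z. F z - tensor_fun u z)"
  proof (rule ennreal_cmod_sum_le)
    fix j assume j: "j < m"
    have lj: "bounded_clinear (l j)" using l j unfolding contraction_system_def by blast
    have int: "integrable circle_completion (\<lambda>z. l j (F z))"
      "integrable circle_completion (\<lambda>z. l j (tensor_fun u z))"
      using integrable_functional_compose[OF F lj contraction_system_le[OF l j]] coeff[OF lj] by auto
    show "ennreal (cmod (fourier_coeff (3 ^ j) (\<lambda>z. l j (F z)) - fourier_coeff (3 ^ j) (\<lambda>z. l j (tensor_fun u z))))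
        \<le> L1_norm (\<lambda>z. F z - tensor_fun u z)"
      unfolding fourier_coeff_diff[OF int, symmetric]
    proof (rule fourier_coeff_le_L1_norm)
      show "cmod (l j (F z) - l j (tensor_fun u z)) \<le> norm (F z - tensor_fun u z)" for z
        using contraction_system_le[OF l j, of "F z - tensor_fun u z"] by (simp only: bounded_clinearD(5)[OF lj])
    qed (use int in simp)
  qed
  finally show ?thesis .
qed

text \<open>
  A single function from the Hardy space is the limit of a sequence of tensors that is bounded
  for the projective norm, and the bounds on the pairing do not depend on the contraction
  system.
\<close>

lemma H1_projective_pointwise_bounded:
  fixes F :: "complex \<Rightarrow> 'x::complex_banach"
  assumes X: "H1_projective TYPE('x)" and F: "F \<in> H1_space"
  obtains K where "\<And>m l. contraction_system m l \<Longrightarrow> cmod (lacunary_functional m l F) \<le> K"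
proof -
  obtain U where U: "U \<in> projective_tensor_product" and map: "canonical_map U F"
    using X F unfolding H1_projective_def by blast
  have tens: "U n \<in> tensors" for n using U unfolding projective_tensor_product_def by blast
  obtain N where N: "\<And>m n. m \<ge> N \<Longrightarrow> n \<ge> N \<Longrightarrow> projective_norm (tensor_diff (U m) (U n)) < 1"
    using U unfolding projective_tensor_product_def mem_Collect_eq by (meson zero_less_one)
  have "projective_norm (U N) \<le> (\<Sum>(h, x)\<leftarrow>U N. L1_norm h * ennreal (norm x))"
    unfolding projective_norm_def by (rule INF_lower) (simp add: tens tensor_refl)
  also have "\<dots> < \<infinity>"
    using tens[of N] by (rule sum_list_tensor_finite)
  finally obtain K where K: "0 \<le> K" "projective_norm (U N) = ennreal K"
    by (cases "projective_norm (U N)") auto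
  have "cmod (lacunary_functional m l F) \<le> 6 * K + 6" if l: "contraction_system m l" for m l
  proof -
    have KN: "cmod (tensor_pairing m l (U N)) \<le> 6 * K"
      using tensor_pairing_le[OF l, of "U N"] K by simp
    have Kn: "cmod (tensor_pairing m l (U n)) \<le> 6 * K + 6" if "n \<ge> N" for n
    proof -
      have "ennreal (cmod (tensor_pairing m l (tensor_diff (U n) (U N))) / 6) \<le> ennreal 1"
        using order_trans[OF tensor_pairing_le[OF l] less_imp_le[OF N[OF that order_refl]]]
        by (simp only: ennreal_1)
      then have "ennreal (cmod (tensor_pairing m l (U n) - tensor_pairing m l (U N)) / 6) \<le> ennreal 1"
        by (simp only: tensor_pairing_diff[OF l])
      then have "cmod (tensor_pairing m l (U n) - tensor_pairing m l (U N)) \<le> 6"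
        by (subst (asm) ennreal_le_iff) auto
      then show ?thesis
        using norm_triangle_sub[of "tensor_pairing m l (U n)" "tensor_pairing m l (U N)"] KN by linarith
    qed
    have FL: "F \<in> L1_space" using F unfolding H1_space_def by blast
    have "(\<lambda>n. L1_norm (\<lambda>z. F z - tensor_fun (U n) z)) \<longlonglongrightarrow> 0"
      using map unfolding canonical_map_def by blast
    then have "(\<lambda>n. of_nat m * L1_norm (\<lambda>z. F z - tensor_fun (U n) z)) \<longlonglongrightarrow> of_nat m * 0"
      by (intro ennreal_tendsto_cmult) (auto simp: of_nat_less_top)
    then have lim: "(\<lambda>n. of_nat m * L1_norm (\<lambda>z. F z - tensor_fun (U n) z)) \<longlonglongrightarrow> 0" by simp
    show ?thesis
    proof (rule field_le_epsilon)
      fix e :: real assume "e > 0"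
      then have "\<forall>\<^sub>F n in sequentially. of_nat m * L1_norm (\<lambda>z. F z - tensor_fun (U n) z) < ennreal e"
        using order_tendstoD(2)[OF lim, of "ennreal e"] by simp
      moreover have "\<forall>\<^sub>F n in sequentially. n \<ge> N" by (rule eventually_ge_at_top)
      ultimately have "\<forall>\<^sub>F n in sequentially. of_nat m * L1_norm (\<lambda>z. F z - tensor_fun (U n) z) < ennreal e \<and> n \<ge> N"
        by (rule eventually_conj)
      then obtain n where n: "of_nat m * L1_norm (\<lambda>z. F z - tensor_fun (U n) z) < ennreal e" "n \<ge> N"
        unfolding eventually_sequentially by blast
      have "ennreal (cmod (lacunary_functional m l F - tensor_pairing m l (U n))) < ennreal e"
        using lacunary_functional_tensor_le[OF l FL tens] n(1) by (rule le_less_trans)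
      then have "cmod (lacunary_functional m l F - tensor_pairing m l (U n)) < e"
        by (simp add: ennreal_less_iff)
      then show "cmod (lacunary_functional m l F) \<le> 6 * K + 6 + e"
        using norm_triangle_sub[of "lacunary_functional m l F" "tensor_pairing m l (U n)"] Kn[OF n(2)]
        by linarith
    qed
  qed
  then show ?thesis using that by blast
qed


section \<open>Uniform boundedness\<close>

lemma lacunary_functional_le_L1_real:
  assumes l: "contraction_system m l" and F: "F \<in> analytic_polys"
  shows "cmod (lacunary_functional m l F) \<le> real m * L1_real F"
proof -
  have zero: "lacunary_functional m l (\<lambda>z. 0) = 0"
    using l by (simp add: lacunary_functional_def contraction_system_def bounded_clinearD fourier_coeff_zero)
  have "ennreal (cmod (lacunary_functional m l F)) \<le> of_nat m * L1_norm F"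
    using lacunary_functional_diff_le[OF l analytic_polys_L1_space[OF F] analytic_polys_L1_space[OF analytic_polys_zero]]
    by (simp add: zero)
  also have "\<dots> = ennreal (real m * L1_real F)"
    by (simp add: continuous_L1(2)[OF analytic_polys_continuous[OF F]] ennreal_mult L1_real_nonneg
        ennreal_of_nat_eq_real_of_nat)
  finally show ?thesis using L1_real_nonneg[of F] by (subst (asm) ennreal_le_iff) auto
qed

lemma lacunary_functional_scaleR:
  assumes l: "contraction_system m l" and F: "F \<in> analytic_polys"
  shows "lacunary_functional m l (\<lambda>z. r *\<^sub>R F z) = r *\<^sub>R lacunary_functional m l F"
proof -
  have zero: "lacunary_functional m l (\<lambda>z. 0) = 0"
    using l by (simp add: lacunary_functional_def contraction_system_def bounded_clinearD fourier_coeff_zero)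
  show ?thesis
    using lacunary_functional_add_scaleR[OF l analytic_polys_L1_space[OF analytic_polys_zero]
        analytic_polys_L1_space[OF F], of r] by (simp add: zero)
qed

text \<open>
  Here \<open>N\<close> is the norm of the functional on the analytic polynomials.
\<close>

lemma exists_nearly_norming_poly:
  assumes l: "contraction_system m l" and P: "P \<in> analytic_polys"
    and gt: "cmod (lacunary_functional m l P) > C * L1_real P" and C: "0 \<le> C"
  obtains N Q where "N \<ge> C" "Q \<in> analytic_polys" "L1_real Q \<le> 1"
    "cmod (lacunary_functional m l Q) \<ge> 2 / 3 * N"
    "\<And>F. F \<in> analytic_polys \<Longrightarrow> cmod (lacunary_functional m l F) \<le> N * L1_real F"
proof -
  let ?B = "\<lambda>F. cmod (lacunary_functional m l F)"
  define S where "S = {?B F | F. F \<in> analytic_polys \<and> L1_real F \<le> 1}"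
  have bdd: "bdd_above S"
  proof (rule bdd_aboveI)
    fix s assume "s \<in> S"
    then obtain F where F: "s = ?B F" "F \<in> analytic_polys" "L1_real F \<le> 1" unfolding S_def by blast
    have "s \<le> real m * L1_real F" unfolding F(1) by (rule lacunary_functional_le_L1_real[OF l F(2)])
    also have "\<dots> \<le> real m * 1" using F(3) by (intro mult_left_mono) auto
    finally show "s \<le> real m" by simp
  qed
  have normalise: "\<exists>s\<in>S. ?B F = s * L1_real F \<and> (L1_real F \<noteq> 0 \<or> ?B F = 0)" if F: "F \<in> analytic_polys" for F
  proof (cases "L1_real F = 0")
    case True
    have "0 \<in> S" unfolding S_def mem_Collect_eq
    proof (intro exI conjI)
      show "L1_real F \<le> 1" "F \<in> analytic_polys" "0 = ?B F"
        using lacunary_functional_le_L1_real[OF l F] True F by auto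
    qed
    then show ?thesis using lacunary_functional_le_L1_real[OF l F] True by auto
  next
    case False
    then have pos: "L1_real F > 0" using L1_real_nonneg[of F] by simp
    let ?F = "\<lambda>z. inverse (L1_real F) *\<^sub>R F z"
    have "?F \<in> analytic_polys"
      using analytic_polys_add_scaleR[OF analytic_polys_zero F] by simp
    moreover have "L1_real ?F = 1" using pos by (simp add: L1_real_scaleR)
    moreover have "?B ?F = inverse (L1_real F) * ?B F"
      using pos by (simp add: lacunary_functional_scaleR[OF l F])
    ultimately have "inverse (L1_real F) * ?B F \<in> S" unfolding S_def by force
    then show ?thesis using pos by (intro bexI) auto
  qed
  have S: "S \<noteq> {}" using normalise[OF P] by blast
  define N where "N = Sup S"
  have le: "?B F \<le> N * L1_real F" if F: "F \<in> analytic_polys" for F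
  proof -
    obtain s where s: "s \<in> S" "?B F = s * L1_real F" using normalise[OF F] by blast
    then show ?thesis
      unfolding N_def using cSup_upper[OF s(1) bdd] L1_real_nonneg[of F] by (simp add: mult_right_mono)
  qed
  have "C * L1_real P < N * L1_real P" using gt le[OF P] by simp
  then have N: "C < N" using L1_real_nonneg[of P] by (simp add: mult_less_cancel_right)
  then have "2 / 3 * N < Sup S" using C unfolding N_def[symmetric] by simp
  then obtain s where s: "s \<in> S" "2 / 3 * N < s" using less_cSup_iff[OF S bdd] by blast
  then obtain Q where "Q \<in> analytic_polys" "L1_real Q \<le> 1" "s = ?B Q" unfolding S_def by blast
  then show ?thesis using that[of N Q] N s le by auto
qed

text \<open>
  The uniform boundedness principle, by a gliding hump: the partial sums of the series below
  are moved by \<open>3\<^sup>-\<^sup>k\<close> in a direction that nearly norms the \<open>k\<close>-th functional, with a sign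
  that keeps its value large; the remaining steps change this value by at most half the norm
  times \<open>3\<^sup>-\<^sup>k\<close>.
\<close>

theorem H1_projective_uniformly_bounded:
  assumes X: "H1_projective TYPE('x::complex_banach)"
  obtains C where "C \<ge> 0" "\<And>m l (F :: complex \<Rightarrow> 'x). contraction_system m l \<Longrightarrow> F \<in> analytic_polys \<Longrightarrow>
    cmod (lacunary_functional m l F) \<le> C * L1_real F"
proof -
  have "\<exists>C\<ge>0. \<forall>m l (F :: complex \<Rightarrow> 'x). contraction_system m l \<longrightarrow> F \<in> analytic_polys \<longrightarrow>
    cmod (lacunary_functional m l F) \<le> C * L1_real F"
  proof (rule ccontr)
    assume neg: "\<not> ?thesis"
    have "\<exists>m l N (Q :: complex \<Rightarrow> 'x). contraction_system m l \<and> N \<ge> 6 ^ k \<and> Q \<in> analytic_polys \<and> L1_real Q \<le> 1 \<and>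
      cmod (lacunary_functional m l Q) \<ge> 2 / 3 * N \<and>
      (\<forall>F \<in> analytic_polys. cmod (lacunary_functional m l F) \<le> N * L1_real F)" for k :: nat
    proof -
      have "(0::real) \<le> 6 ^ k" by simp
      then obtain m l and F :: "complex \<Rightarrow> 'x" where lF: "contraction_system m l" "F \<in> analytic_polys"
        "6 ^ k * L1_real F < cmod (lacunary_functional m l F)"
        using neg by (meson not_le)
      obtain N Q where "N \<ge> 6 ^ k" "Q \<in> analytic_polys" "L1_real Q \<le> 1"
        "cmod (lacunary_functional m l Q) \<ge> 2 / 3 * N"
        "\<And>F. F \<in> analytic_polys \<Longrightarrow> cmod (lacunary_functional m l F) \<le> N * L1_real F"
        using exists_nearly_norming_poly[OF lF] by auto
      then show ?thesis using lF(1) by blast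
    qed
    then obtain m l N and Q :: "nat \<Rightarrow> complex \<Rightarrow> 'x" where
      l: "\<And>k. contraction_system (m k) (l k)" and N: "\<And>k. N k \<ge> 6 ^ k"
      and Q: "\<And>k. Q k \<in> analytic_polys" "\<And>k. L1_real (Q k) \<le> 1"
        "\<And>k. cmod (lacunary_functional (m k) (l k) (Q k)) \<ge> 2 / 3 * N k"
      and le: "\<And>k F. F \<in> analytic_polys \<Longrightarrow> cmod (lacunary_functional (m k) (l k) F) \<le> N k * L1_real F"
      by metis
    let ?B = "\<lambda>k. lacunary_functional (m k) (l k)"
    define r where "r k F = (if cmod (?B k F + (1 / 3) ^ k *\<^sub>R ?B k (Q k)) \<ge> (1 / 3) ^ k * cmod (?B k (Q k))
      then (1 / 3) ^ k else - ((1 / 3) ^ k) :: real)" for k F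
    define S where "S = rec_nat (\<lambda>z. 0) (\<lambda>k F z. F z + r k F *\<^sub>R Q k z)"
    have S_Suc: "S (Suc k) = (\<lambda>z. S k z + r k (S k) *\<^sub>R Q k z)" for k by (simp add: S_def)
    have r_abs: "\<bar>r k F\<bar> = (1 / 3) ^ k" for k F by (simp add: r_def)
    have S: "S k \<in> analytic_polys" for k
      by (induction k) (simp_all add: S_Suc analytic_polys_add_scaleR Q, simp add: S_def analytic_polys_zero)
    have diff: "(\<lambda>z. S i z - S j z) \<in> analytic_polys" for i j
      using analytic_polys_add_scaleR[OF S S, of i "-1" j] by simp
    have step: "L1_real (\<lambda>z. S (Suc k) z - S k z) \<le> (1 / 3) ^ k" for k
      using Q(2)[of k] by (simp add: S_Suc L1_real_scaleR r_abs mult_left_le)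
    \<comment> \<open>the geometric series from \<open>k + 1\<close> on, with sum \<open>3\<^sup>-\<^sup>k / 2\<close>\<close>
    have tail: "L1_real (\<lambda>z. S (Suc k + i) z - S (Suc k) z) \<le> (1 / 3) ^ k / 2 * (1 - (1 / 3) ^ i)" for k i
    proof (induction i)
      case 0
      show ?case by (simp add: L1_real_def)
    next
      case (Suc i)
      have "L1_real (\<lambda>z. (S (Suc (Suc k + i)) z - S (Suc k + i) z) + (S (Suc k + i) z - S (Suc k) z)) \<le>
          L1_real (\<lambda>z. S (Suc (Suc k + i)) z - S (Suc k + i) z) + L1_real (\<lambda>z. S (Suc k + i) z - S (Suc k) z)"
        by (intro L1_real_triangle analytic_polys_continuous diff)
      also have "\<dots> \<le> (1 / 3) ^ (Suc k + i) + (1 / 3) ^ k / 2 * (1 - (1 / 3) ^ i)"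
        by (intro add_mono step Suc)
      also have "\<dots> = (1 / 3) ^ k / 2 * (1 - (1 / 3) ^ Suc i)"
        by (simp add: power_add field_simps)
      finally show ?case by simp
    qed
    have large: "(1 / 3) ^ k * (2 / 3 * N k) \<le> cmod (?B k (S (Suc k)))" for k
    proof -
      have "?B k (S (Suc k)) = ?B k (S k) + r k (S k) *\<^sub>R ?B k (Q k)"
        unfolding S_Suc using l S Q(1)
        by (intro lacunary_functional_add_scaleR analytic_polys_L1_space)
      moreover have "(1 / 3) ^ k * cmod (?B k (Q k)) \<le> cmod (?B k (S k) + r k (S k) *\<^sub>R ?B k (Q k))"
      proof (cases "(1 / 3) ^ k * cmod (?B k (Q k)) \<le> cmod (?B k (S k) + (1 / 3) ^ k *\<^sub>R ?B k (Q k))")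
        case True
        then show ?thesis by (simp add: r_def)
      next
        case False
        define a b where "a = ?B k (S k)" and "b = (1 / 3) ^ k *\<^sub>R ?B k (Q k)"
        have b: "cmod b = (1 / 3) ^ k * cmod (?B k (Q k))" by (simp add: b_def)
        have r: "r k (S k) *\<^sub>R ?B k (Q k) = - b" using False by (simp add: r_def b_def)
        have "cmod (a + b) < cmod b" using False unfolding b a_def b_def by simp
        moreover have "(a + b) - (a - b) = 2 * b" by simp
        then have "2 * cmod b \<le> cmod (a + b) + cmod (a - b)"
          using norm_triangle_ineq4[of "a + b" "a - b"] by (simp only: norm_mult norm_numeral)
        ultimately have "cmod b \<le> cmod (a + - b)" by simp
        then show ?thesis unfolding r a_def[symmetric] b .
      qed
      ultimately have "(1 / 3) ^ k * cmod (?B k (Q k)) \<le> cmod (?B k (S (Suc k)))" by (simp only:)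
      with mult_left_mono[OF Q(3)] show ?thesis by (rule order_trans) simp
    qed
    have stays_large: "2 ^ k / 6 \<le> cmod (?B k (S (Suc k + i)))" for k i
    proof -
      have N0: "0 \<le> N k" using N[of k] zero_le_power[of "6::real" k] by linarith
      have "?B k (S (Suc k + i)) = ?B k (S (Suc k)) + 1 *\<^sub>R ?B k (\<lambda>z. S (Suc k + i) z - S (Suc k) z)"
        using lacunary_functional_add_scaleR[OF l analytic_polys_L1_space[OF S] analytic_polys_L1_space[OF diff],
            of k "Suc k" 1 "Suc k + i" "Suc k"] by simp
      then have "cmod (?B k (S (Suc k))) \<le> cmod (?B k (S (Suc k + i))) + cmod (?B k (\<lambda>z. S (Suc k + i) z - S (Suc k) z))"
        using norm_triangle_ineq4[of "?B k (S (Suc k + i))" "?B k (\<lambda>z. S (Suc k + i) z - S (Suc k) z)"] by simp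
      also have "cmod (?B k (\<lambda>z. S (Suc k + i) z - S (Suc k) z)) \<le> N k * ((1 / 3) ^ k / 2)"
      proof -
        have "(1 / 3) ^ k / 2 * (1 - (1 / 3) ^ i) \<le> (1 / 3 :: real) ^ k / 2 * 1"
          by (intro mult_left_mono) auto
        from order_trans[OF tail this]
        have "L1_real (\<lambda>z. S (Suc k + i) z - S (Suc k) z) \<le> (1 / 3) ^ k / 2"
          by (simp only: mult_1_right)
        then have "N k * L1_real (\<lambda>z. S (Suc k + i) z - S (Suc k) z) \<le> N k * ((1 / 3) ^ k / 2)"
          using N0 by (rule mult_left_mono)
        then show ?thesis using le[OF diff, of k "Suc k + i" "Suc k"] by linarith
      qed
      finally have "(1 / 3) ^ k * N k / 6 \<le> cmod (?B k (S (Suc k + i)))"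
        using large[of k] by (simp add: field_simps)
      moreover have "(2::real) ^ k \<le> (1 / 3) ^ k * N k"
      proof -
        have eq: "(2::real) ^ k = (1 / 3) ^ k * 6 ^ k" by (simp flip: power_mult_distrib)
        show ?thesis unfolding eq by (intro mult_left_mono N) simp
      qed
      ultimately show ?thesis by linarith
    qed
    obtain G where G: "G \<in> H1_space" "(\<lambda>i. L1_norm (\<lambda>z. G z - S i z)) \<longlonglongrightarrow> 0"
      using L1_limit[OF S step] .
    obtain K where K: "\<And>m l. contraction_system m l \<Longrightarrow> cmod (lacunary_functional m l G) \<le> K"
      using H1_projective_pointwise_bounded[OF X G(1)] by blast
    have bounded: "2 ^ k / 6 \<le> K + 1" for k :: nat
    proof -
      have "(\<lambda>i. of_nat (m k) * L1_norm (\<lambda>z. G z - S i z)) \<longlonglongrightarrow> of_nat (m k) * 0"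
        using G(2) by (intro ennreal_tendsto_cmult) (auto simp: of_nat_less_top)
      then have "\<forall>\<^sub>F i in sequentially. of_nat (m k) * L1_norm (\<lambda>z. G z - S i z) < ennreal 1"
        by (intro order_tendstoD(2)) auto
      then obtain i0 where "\<And>i. i \<ge> i0 \<Longrightarrow> of_nat (m k) * L1_norm (\<lambda>z. G z - S i z) < ennreal 1"
        unfolding eventually_sequentially by blast
      from this[of "Suc k + i0"] have small: "of_nat (m k) * L1_norm (\<lambda>z. G z - S (Suc k + i0) z) < ennreal 1" by simp
      have GL: "G \<in> L1_space" using G(1) unfolding H1_space_def by blast
      have "ennreal (cmod (?B k G - ?B k (S (Suc k + i0)))) < ennreal 1"
        by (rule le_less_trans[OF lacunary_functional_diff_le[OF l GL analytic_polys_L1_space[OF S]] small])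
      then have "cmod (?B k G - ?B k (S (Suc k + i0))) < 1" by (subst (asm) ennreal_less_iff) auto
      then show ?thesis
        using stays_large[of k i0] K[OF l, of k] norm_triangle_sub[of "?B k (S (Suc k + i0))" "?B k G"]
        by (simp add: norm_minus_commute)
    qed
    obtain k where "6 * (K + 1) < 2 ^ k" using real_arch_pow[of 2 "6 * (K + 1)"] by auto
    then have "K + 1 < 2 ^ k / 6" by (simp add: pos_less_divide_eq mult.commute)
    then show False using bounded[of k] unfolding not_le[symmetric] by (rule notE)
  qed
  then show ?thesis using that by blast
qed


section \<open>Cotype 2 and Grothendieck's theorem\<close>

theorem H1_projective_cotype2:
  assumes X: "H1_projective TYPE('x::complex_banach)"
  shows "cotype2 TYPE('x)"
proof -
  obtain C where C: "C \<ge> 0" "\<And>m l (F :: complex \<Rightarrow> 'x). contraction_system m l \<Longrightarrow> F \<in> analytic_polys \<Longrightarrow>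
    cmod (lacunary_functional m l F) \<le> C * L1_real F"
    using H1_projective_uniformly_bounded[OF X] by blast
  have "sqrt (\<Sum>k<n. (norm (x k))\<^sup>2) \<le>
      4 * C * sqrt (\<integral>\<epsilon>. (norm (\<Sum>k<n. \<epsilon> k *\<^sub>R x k))\<^sup>2 \<partial>sign_measure)" for n and x :: "nat \<Rightarrow> 'x"
  proof -
    \<comment> \<open>Weighted norming functionals turn the lacunary functional into the \<open>\<ell>\<^sup>2\<close> sum of the norms.\<close>
    define s where "s = sqrt (\<Sum>k<n. (norm (x k))\<^sup>2)"
    have s2: "s\<^sup>2 = (\<Sum>k<n. (norm (x k))\<^sup>2)" unfolding s_def by (simp add: sum_nonneg)
    have "\<exists>\<xi>. bounded_clinear \<xi> \<and> (\<forall>y. cmod (\<xi> y) \<le> norm y) \<and> \<xi> (x k) = complex_of_real (norm (x k))" for k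
      using complex_Hahn_Banach_norm[of "x k"] by metis
    then obtain \<xi> where \<xi>: "\<And>k. bounded_clinear (\<xi> k)" "\<And>k y. cmod (\<xi> k y) \<le> norm y"
      "\<And>k. \<xi> k (x k) = complex_of_real (norm (x k))" by metis
    define l where "l k y = complex_of_real (norm (x k) / s) * \<xi> k y" for k y
    have l: "contraction_system n l"
      unfolding contraction_system_def
    proof (intro conjI allI impI)
      fix k
      have "bounded_linear (l k)"
        unfolding l_def
        by (rule bounded_linear_compose[OF bounded_linear_mult_right bounded_clinearD(1)[OF \<xi>(1)]])
      then show "bounded_clinear (l k)"
        using \<xi>(1)[of k] unfolding bounded_clinear_def by (simp add: l_def scaleC_complex_def)
    next
      fix y
      have "(\<Sum>k<n. (cmod (l k y))\<^sup>2) \<le> (\<Sum>k<n. (norm (x k) / s)\<^sup>2 * (norm y)\<^sup>2)"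
      proof (rule sum_mono)
        fix k
        have "(cmod (\<xi> k y))\<^sup>2 \<le> (norm y)\<^sup>2" by (intro power_mono \<xi>(2)) simp
        then show "(cmod (l k y))\<^sup>2 \<le> (norm (x k) / s)\<^sup>2 * (norm y)\<^sup>2"
          unfolding l_def norm_mult power_mult_distrib norm_of_real power2_abs by (intro mult_left_mono) auto
      qed
      also have "\<dots> = (\<Sum>k<n. (norm (x k))\<^sup>2) / s\<^sup>2 * (norm y)\<^sup>2"
        by (simp add: sum_distrib_right sum_divide_distrib power_divide)
      also have "\<dots> \<le> 1 * (norm y)\<^sup>2" unfolding s2[symmetric] by (intro mult_right_mono) auto
      finally show "(\<Sum>k<n. (cmod (l k y))\<^sup>2) \<le> (norm y)\<^sup>2" by simp
    qed
    define F where "F z = (\<Sum>k<n. z ^ (3 ^ k) *\<^sub>C x k)" for z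
    have F: "F \<in> analytic_polys"
      unfolding F_def by (intro analytic_polys_sum analytic_polys_monomial)
    have "fourier_coeff (3 ^ j) (\<lambda>z. l j (F z)) = l j (x j)" if j: "j < n" for j
    proof -
      have lj: "bounded_clinear (l j)" using l j unfolding contraction_system_def by blast
      have "(\<lambda>z::complex. z ^ i) = poly (monom 1 i)" for i by (simp add: fun_eq_iff poly_monom)
      then have int: "integrable circle_completion (\<lambda>z. z ^ i)" for i by (simp add: integrable_poly)
      have "fourier_coeff (3 ^ j) (\<lambda>z. l j (F z)) = fourier_coeff (3 ^ j) (\<lambda>z. \<Sum>k<n. l j (x k) * z ^ (3 ^ k))"
        by (simp add: F_def bounded_clinearD[OF lj] scaleC_complex_def mult.commute)
      also have "\<dots> = (\<Sum>k<n. l j (x k) * fourier_coeff (3 ^ j) (\<lambda>z. z ^ (3 ^ k)))"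
        by (rule fourier_coeff_sum) (rule int)
      also have "\<dots> = (\<Sum>k<n. if k = j then l j (x j) else 0)"
        by (intro sum.cong) (auto simp: fourier_coeff_power)
      finally show ?thesis using j by simp
    qed
    then have "lacunary_functional n l F = (\<Sum>j<n. l j (x j))" by (simp add: lacunary_functional_def)
    also have "\<dots> = complex_of_real ((\<Sum>j<n. (norm (x j))\<^sup>2) / s)"
      by (simp add: l_def \<xi>(3) sum_divide_distrib power2_eq_square)
    also have "(\<Sum>j<n. (norm (x j))\<^sup>2) / s = s" unfolding s2[symmetric] by (simp add: power2_eq_square)
    finally have "s \<le> cmod (lacunary_functional n l F)" by simp
    also have "\<dots> \<le> C * L1_real F" by (rule C(2)[OF l F])
    also have "\<dots> \<le> C * (4 * sqrt (\<integral>\<epsilon>. (norm (\<Sum>k<n. \<epsilon> k *\<^sub>R x k))\<^sup>2 \<partial>sign_measure))"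
    proof (rule mult_left_mono[OF _ C(1)])
      have "ennreal (L1_real F) \<le> ennreal (4 * sqrt (\<integral>\<epsilon>. (norm (\<Sum>k<n. \<epsilon> k *\<^sub>R x k))\<^sup>2 \<partial>sign_measure))"
        using L1_norm_lacunary_le[of x n] continuous_L1(2)[OF analytic_polys_continuous[OF F]]
        by (simp add: F_def[abs_def])
      then show "L1_real F \<le> 4 * sqrt (\<integral>\<epsilon>. (norm (\<Sum>k<n. \<epsilon> k *\<^sub>R x k))\<^sup>2 \<partial>sign_measure)"
        by (subst (asm) ennreal_le_iff) auto
    qed
    finally show ?thesis by (simp add: s_def)
  qed
  then show ?thesis unfolding cotype2_def by blast
qed

lemma analytic_polys_poly_scaleC: "(\<lambda>z. poly p z *\<^sub>C x) \<in> analytic_polys"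
proof -
  have "poly p z *\<^sub>C x = (\<Sum>i\<le>degree p. z ^ i *\<^sub>C (coeff p i *\<^sub>C x))" for z
    by (simp add: poly_altdef scaleC_sum_left scaleC_scaleC mult.commute)
  then show ?thesis by (simp add: analytic_polys_sum analytic_polys_monomial)
qed

theorem H1_projective_GT_space:
  assumes X: "H1_projective TYPE('x::complex_banach)"
  shows "GT_space TYPE('x) TYPE('h::complex_hilbert)"
  unfolding GT_space_def
proof (intro allI impI)
  fix u :: "'x \<Rightarrow> 'h" assume u: "bounded_clinear u"
  obtain C where C: "C \<ge> 0" "\<And>m l (F :: complex \<Rightarrow> 'x). contraction_system m l \<Longrightarrow> F \<in> analytic_polys \<Longrightarrow>
    cmod (lacunary_functional m l F) \<le> C * L1_real F"
    using H1_projective_uniformly_bounded[OF X] by blast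
  \<comment> \<open>The summand \<open>1\<close> keeps \<open>L\<close> positive also for \<open>u = 0\<close>.\<close>
  define L where "L = onorm u + 1"
  have L: "L > 0" "\<And>x. norm (u x) \<le> L * norm x"
  proof -
    have bl: "bounded_linear u" using bounded_clinearD(1)[OF u] .
    show "L > 0" using onorm_pos_le[OF bl] by (simp add: L_def)
    show "norm (u x) \<le> L * norm x" for x
      using onorm[OF bl, of x] norm_ge_zero[of x] unfolding L_def distrib_right by linarith
  qed
  have "(\<Sum>k<n. norm (u (x k))) \<le> (2 * L * C) *
      (SUP \<xi> \<in> {\<xi> :: 'x \<Rightarrow> complex. bounded_clinear \<xi> \<and> onorm \<xi> \<le> 1}. \<Sum>k<n. cmod (\<xi> (x k)))"
    (is "_ \<le> _ * ?W") for n and x :: "nat \<Rightarrow> 'x"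
  proof -
    obtain m e where e: "orthonormal m e"
      and Parseval: "\<And>k. k < n \<Longrightarrow> (\<Sum>j<m. (cmod (cinner (u (x k)) (e j)))\<^sup>2) = (norm (u (x k)))\<^sup>2"
      using exists_orthonormal_Parseval[of n "\<lambda>k. u (x k)"] by metis
    define l where "l j y = cinner (u y) (e j) / complex_of_real L" for j y
    have l: "contraction_system m l"
      unfolding contraction_system_def
    proof (intro conjI allI impI)
      fix y
      have "(\<Sum>j<m. (cmod (l j y))\<^sup>2) = (\<Sum>j<m. (cmod (cinner (u y) (e j)))\<^sup>2) / L\<^sup>2"
        by (simp add: l_def norm_divide power_divide sum_divide_distrib)
      also have "\<dots> \<le> (norm (u y))\<^sup>2 / L\<^sup>2"
        by (intro divide_right_mono Bessel_inequality e) simp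
      also have "\<dots> \<le> (L * norm y)\<^sup>2 / L\<^sup>2"
        by (intro divide_right_mono power_mono L) auto
      also have "\<dots> = (norm y)\<^sup>2" using L(1) by (simp add: power_mult_distrib)
      finally show sq: "(\<Sum>j<m. (cmod (l j y))\<^sup>2) \<le> (norm y)\<^sup>2" .
    next
      fix j assume j: "j < m"
      have clin: "l j (c *\<^sub>C y) = c *\<^sub>C l j y" for c y
        by (simp add: l_def bounded_clinearD[OF u] cinner_scaleC_left scaleC_complex_def)
      have "bounded_linear (l j)"
      proof (rule bounded_linear_intro[where K=1])
        show "l j (y + y') = l j y + l j y'" for y y'
          by (simp add: l_def bounded_clinearD[OF u] cinner_add_left add_divide_distrib)
        show "l j (r *\<^sub>R y) = r *\<^sub>R l j y" for r y by (simp only: scaleR_scaleC clin)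
        show "norm (l j y) \<le> norm y * 1" for y
        proof -
          have "(cmod (cinner (u y) (e j)))\<^sup>2 \<le> (\<Sum>j<m. (cmod (cinner (u y) (e j)))\<^sup>2)"
            using j by (intro member_le_sum) auto
          also have "\<dots> \<le> (norm (u y))\<^sup>2" by (rule Bessel_inequality[OF e])
          finally have "cmod (cinner (u y) (e j)) \<le> norm (u y)" by (rule power2_le_imp_le) simp
          then show ?thesis using L(2)[of y] L(1) by (simp add: l_def norm_divide field_simps)
        qed
      qed
      then show "bounded_clinear (l j)" unfolding bounded_clinear_def using clin by blast
    qed
    \<comment> \<open>The coordinates of the unit vector in the direction of \<open>u (x k)\<close>, or \<open>0\<close> if \<open>u (x k) = 0\<close>; they become
      the lacunary coefficients of a bounded polynomial.\<close>
    define a where "a k j = cnj (cinner (u (x k)) (e j)) / complex_of_real (norm (u (x k)))" for k j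
    have "\<exists>p. (\<forall>j<m. coeff p (3 ^ j) = a k j) \<and> (\<forall>z. cmod z = 1 \<longrightarrow> cmod (poly p z) \<le> 2)" if "k < n" for k
    proof -
      have "(\<Sum>j<m. (cmod (a k j))\<^sup>2) = (\<Sum>j<m. (cmod (cinner (u (x k)) (e j)))\<^sup>2) / (norm (u (x k)))\<^sup>2"
        by (simp add: a_def norm_divide power_divide sum_divide_distrib)
      also have "\<dots> \<le> 1" using Parseval[OF that] by simp
      finally show ?thesis using bounded_polynomial_lacunary_coeffs by metis
    qed
    then obtain p where p: "\<And>k j. k < n \<Longrightarrow> j < m \<Longrightarrow> coeff (p k) (3 ^ j) = a k j"
      "\<And>k z. k < n \<Longrightarrow> cmod z = 1 \<Longrightarrow> cmod (poly (p k) z) \<le> 2" by metis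
    define F where "F z = (\<Sum>k<n. poly (p k) z *\<^sub>C x k)" for z
    have F: "F \<in> analytic_polys"
      unfolding F_def by (intro analytic_polys_sum analytic_polys_poly_scaleC)
    have bound: "norm (F z) \<le> 2 * ?W" if z: "cmod z = 1" for z
    proof -
      obtain \<xi> where \<xi>: "bounded_clinear \<xi>" "onorm \<xi> \<le> 1" "\<xi> (F z) = complex_of_real (norm (F z))"
        using complex_Hahn_Banach_norm[of "F z"] by metis
      have "norm (F z) = cmod (\<xi> (F z))" by (simp add: \<xi>(3))
      also have "\<dots> = cmod (\<Sum>k<n. poly (p k) z * \<xi> (x k))"
        by (simp add: F_def bounded_clinearD[OF \<xi>(1)] scaleC_complex_def)
      also have "\<dots> \<le> (\<Sum>k<n. 2 * cmod (\<xi> (x k)))"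
        by (rule sum_norm_le) (auto simp: norm_mult p(2) z intro: mult_right_mono)
      also have "\<dots> = 2 * (\<Sum>k<n. cmod (\<xi> (x k)))" by (simp add: sum_distrib_left)
      also have "(\<Sum>k<n. cmod (\<xi> (x k))) \<le> ?W"
      proof (rule cSUP_upper)
        show "bdd_above ((\<lambda>\<xi>. \<Sum>k<n. cmod (\<xi> (x k))) `
            {\<xi> :: 'x \<Rightarrow> complex. bounded_clinear \<xi> \<and> onorm \<xi> \<le> 1})"
        proof (rule bdd_aboveI2)
          fix \<eta> :: "'x \<Rightarrow> complex" assume "\<eta> \<in> {\<xi>. bounded_clinear \<xi> \<and> onorm \<xi> \<le> 1}"
          then have \<eta>: "bounded_linear \<eta>" "onorm \<eta> \<le> 1" using bounded_clinearD(1) by auto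
          have "cmod (\<eta> y) \<le> norm y" for y
            using onorm[OF \<eta>(1), of y] mult_right_mono[OF \<eta>(2) norm_ge_zero[of y]] by simp
          then show "(\<Sum>k<n. cmod (\<eta> (x k))) \<le> (\<Sum>k<n. norm (x k))" by (rule sum_mono)
        qed
      qed (use \<xi> in auto)
      finally show ?thesis by simp
    qed
    have "L1_real F \<le> (\<integral>z. 2 * ?W \<partial>circle_completion)"
      unfolding L1_real_def
    proof (rule integral_mono_AE)
      show "AE z in circle_completion. norm (F z) \<le> 2 * ?W"
        using AE_circle_norm by eventually_elim (rule bound)
    qed (use continuous_L1(1)[OF analytic_polys_continuous[OF F]] in simp_all)
    also have "\<dots> = 2 * ?W" by (simp add: circle.prob_space)
    finally have LF: "L1_real F \<le> 2 * ?W" .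
    have "fourier_coeff (3 ^ j) (\<lambda>z. l j (F z)) = (\<Sum>k<n. l j (x k) * a k j)" if j: "j < m" for j
    proof -
      have lj: "bounded_clinear (l j)" using l j unfolding contraction_system_def by blast
      have "fourier_coeff (3 ^ j) (\<lambda>z. l j (F z)) = fourier_coeff (3 ^ j) (\<lambda>z. \<Sum>k<n. l j (x k) * poly (p k) z)"
        by (simp add: F_def bounded_clinearD[OF lj] scaleC_complex_def mult.commute)
      also have "\<dots> = (\<Sum>k<n. l j (x k) * fourier_coeff (3 ^ j) (poly (p k)))"
        by (rule fourier_coeff_sum) (rule integrable_poly)
      finally show ?thesis using j by (simp add: fourier_coeff_poly p(1))
    qed
    then have "lacunary_functional m l F = (\<Sum>j<m. \<Sum>k<n. l j (x k) * a k j)"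
      by (simp add: lacunary_functional_def)
    also have "\<dots> = (\<Sum>k<n. \<Sum>j<m. l j (x k) * a k j)" by (rule sum.swap)
    also have "\<dots> = (\<Sum>k<n. complex_of_real (norm (u (x k)) / L))"
    proof (rule sum.cong[OF refl])
      fix k assume k: "k \<in> {..<n}"
      have "l j (x k) * a k j = complex_of_real ((cmod (cinner (u (x k)) (e j)))\<^sup>2 / (L * norm (u (x k))))" for j
        unfolding of_real_divide complex_norm_square by (simp add: l_def a_def)
      then have "(\<Sum>j<m. l j (x k) * a k j) =
          complex_of_real ((\<Sum>j<m. (cmod (cinner (u (x k)) (e j)))\<^sup>2) / (L * norm (u (x k))))"
        by (simp add: sum_divide_distrib)
      also have "\<dots> = complex_of_real (norm (u (x k)) / L)"
        using k Parseval[of k] by (simp add: power2_eq_square)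
      finally show "(\<Sum>j<m. l j (x k) * a k j) = complex_of_real (norm (u (x k)) / L)" .
    qed
    also have "\<dots> = complex_of_real ((\<Sum>k<n. norm (u (x k))) / L)" by (simp add: sum_divide_distrib)
    finally have "(\<Sum>k<n. norm (u (x k))) / L \<le> cmod (lacunary_functional m l F)"
      unfolding norm_of_real by (simp only: norm_of_real abs_ge_self)
    also have "\<dots> \<le> C * L1_real F" by (rule C(2)[OF l F])
    also have "\<dots> \<le> C * (2 * ?W)" by (rule mult_left_mono[OF LF C(1)])
    finally show ?thesis using L(1) by (simp add: field_simps)
  qed
  then show "one_summing u" unfolding one_summing_def using u by blast
qed

theorem theorem4p3:
  assumes "H1_projective TYPE('x::complex_banach)"
  shows "GT_space TYPE('x) TYPE('h::complex_hilbert) \<and> cotype2 TYPE('x)"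
  using H1_projective_GT_space[OF assms] H1_projective_cotype2[OF assms] by blast

end
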